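(* Let $g,r,d,k$ be positive integers with $r>d-g$ and $2\le k<\lfloor\frac{g+3}{2}\rfloor$. Let $\Gamma$ be a $k$-gonal chain of loops of genus $g$, and let $t$ be a $k$-uniform displacement tableau on $[r+1]\times[g-d+r]$ with alphabet $[g]$. The torus $\mathbb{T}(t)$ is maximal with respect to containment in $W^r_d(\Gamma)$ if and only if $t$ is scrollar. In other words, $$W^r_d(\Gamma)=\bigcup_{t\ \mathrm{scrollar}}\mathbb{T}(t),$$ where the union is over scrollar tableaux $t$ on $[r+1]\times[g-d+r]$ with alphabet $[g]$.
   Context: Notation: $[n]=\{1,\dots,n\}$. Chain of loops: $\Gamma$ is the metric graph consisting of $g$ loops arranged left to right, consecutive loops joined by bridges. The $j$th loop has a lefthand vertex and a righthand vertex, joined by a top edge of length $\ell_j$ and a bottom edge of length $m_j$; a bridge joins the righthand vertex of loop $j$ to the lefthand vertex of loop $j+1$. The $j$th torsion order $\tau_j$ is $0$ if $\ell_j+m_j$ is an irrational multiple of $m_j$, and otherwise is the minimum positive integer such that $\tau_jm_j$ is an integer multiple of $\ell_j+m_j$. $\Gamma$ is a $k$-gonal chain of loops of genus $g$ if $\tau_i=0$ for $i<k$ or $i>g-k+1$, and $\tau_i=k$ otherwise. Divisors: $\operatorname{Pic}^d(\Gamma)$ is the group of degree $d$ divisor classes on $\Gamma$ modulo tropical linear equivalence, and $W^r_d(\Gamma)\subseteq\operatorname{Pic}^d(\Gamma)$ is the set of classes of Baker–Norine rank at least $r$. On the $j$th loop, $\langle\xi\rangle_j$ denotes the point located $\xi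 m_j$ units from the righthand vertex in the counterclockwise direction; for integers $\xi,\eta$, $\langle\xi\rangle_j=\langle\eta\rangle_j$ iff $\xi\equiv\eta\pmod{\tau_j}$. Every divisor class $D$ of degree $d$ has a unique representative of the form $(d-g)\langle0\rangle_g+\sum_{j=1}^g\langle\xi_j(D)\rangle_j$, so the points $\langle\xi_j(D)\rangle_j$ are coordinates on $\operatorname{Pic}^d(\Gamma)$. Tableaux: a tableau on $[a]\times[b]$ with alphabet $[g]$ is a function $t:[a]\times[b]\to[g]$ with $t(x,y)<t(x,y+1)$ and $t(x,y)<t(x+1,y)$ whenever defined. It is a $k$-uniform displacement tableau if $t(x,y)=t(x',y')$ implies $x-y\equiv x'-y'\pmod k$. For such $t$, $$\mathbb{T}(t):=\{D\in\operatorname{Pic}^d(\Gamma) : \langle\xi_{t(x,y)}(D)\rangle_{t(x,y)}=\langle y-x\rangle_{t(x,y)}\ \text{for all }(x,y)\}.$$ "$\mathbb{T}(t)$ is maximal with respect to containment in $W^r_d(\Gamma)$" means maximal under inclusion among the tori $\mathbb{T}(t')$, $t'$ ranging over all $k$-uniform displacement tableaux on $[r+1]\times[g-d+r]$ with alphabet $[g]$. (A known theorem of Pflueger states that $W^r_d(\Gamma)$ is the union of all these $\mathbb{T}(t')$.) Scrollar tableaux: let $\alpha\le\min\{a,k-1\}$ be a positive integer with either $\alpha\ge k-b$ or $\alpha=a$. A tableau $t$ on $[a]\times[b]$ is scrollar of type $\alpha$ if: (1) for boxes $(x,y),(x',y')\in[a]\times[b]$, $t(x,y)=t(x',y')$ if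 and only if there is an integer $\ell$ with $x'-x=\ell\alpha$ and $y'-y=\ell(\alpha-k)$; (2) if $\alpha=a$, then $t(1,y)>t(a,y+a-k)$ for all $y>k-a$ (with $y\in[b]$); (3) if $\alpha=k-b$, then $t(x,1)>t(x+b-k,b)$ for all $x>k-b$ (with $x\in[a]$). A tableau is scrollar if it is scrollar of type $\alpha$ for some such $\alpha$. (Here $a=r+1$, $b=g-d+r$.) *)

theory Defs
  imports Complex_Main "HOL-Library.Poly_Mapping" "HOL-Number_Theory.Cong"
begin

section \<open>Metric graphs and their points\<close>

text \<open>
  A finite multigraph with edge lengths. The choice of source and target of an edge only serves
  to parametrise it by the interval from 0 to its length.
\<close>

record ('v, 'e) metric_graph =
  verts :: "'v set"
  edges :: "'e set"
  src :: "'e \<Rightarrow> 'v"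
  tgt :: "'e \<Rightarrow> 'v"
  len :: "'e \<Rightarrow> real"

datatype ('v, 'e) point = Vertex 'v | Inner 'e real

definition points :: "('v, 'e) metric_graph \<Rightarrow> ('v, 'e) point set" where
  "points G = Vertex ` verts G \<union> {Inner e x | e x. e \<in> edges G \<and> 0 < x \<and> x < len G e}"

text \<open>The point at distance \<open>x\<close> from the source of \<open>e\<close>, for \<open>0 \<le> x \<le> len G e\<close>.\<close>

definition edge_point :: "('v, 'e) metric_graph \<Rightarrow> 'e \<Rightarrow> real \<Rightarrow> ('v, 'e) point" where
  "edge_point G e x =
     (if x = 0 then Vertex (src G e) else if x = len G e then Vertex (tgt G e) else Inner e x)"


section \<open>Divisors and linear equivalence\<close>

type_synonym ('v, 'e) divisor = "('v, 'e) point \<Rightarrow>\<^sub>0 int"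

definition divisors :: "('v, 'e) metric_graph \<Rightarrow> ('v, 'e) divisor set" where
  "divisors G = {D. Poly_Mapping.keys D \<subseteq> points G}"

definition div_deg :: "('v, 'e) divisor \<Rightarrow> int" where
  "div_deg D = (\<Sum>p\<in>Poly_Mapping.keys D. Poly_Mapping.lookup D p)"

definition effective :: "('v, 'e) metric_graph \<Rightarrow> ('v, 'e) divisor \<Rightarrow> bool" where
  "effective G D \<longleftrightarrow> D \<in> divisors G \<and> (\<forall>p. 0 \<le> Poly_Mapping.lookup D p)"

text \<open>
  Piecewise linear functions with finitely many pieces and integer slopes on \<open>[0, L]\<close>;
  \<open>xs\<close> lists the breakpoints together with both ends. Since consecutive closed pieces share a
  breakpoint, such functions are continuous.
\<close>

definition pl_int_on :: "real \<Rightarrow> (real \<Rightarrow> real) \<Rightarrow> bool" where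
  "pl_int_on L f \<longleftrightarrow>
     (\<exists>xs. xs \<noteq> [] \<and> sorted_wrt (<) xs \<and> hd xs = 0 \<and> last xs = L \<and>
        (\<forall>i. Suc i < length xs \<longrightarrow>
           (\<exists>s::int. \<forall>x\<in>{xs ! i..xs ! Suc i}. f x = f (xs ! i) + of_int s * (x - xs ! i))))"

definition rational_function ::
  "('v, 'e) metric_graph \<Rightarrow> (('v, 'e) point \<Rightarrow> real) \<Rightarrow> bool" where
  "rational_function G f \<longleftrightarrow> (\<forall>e\<in>edges G. pl_int_on (len G e) (\<lambda>x. f (edge_point G e x)))"

text \<open>Slopes on either side of \<open>x\<close>, both taken in the direction of increasing parameter.\<close>

definition right_slope :: "(real \<Rightarrow> real) \<Rightarrow> real \<Rightarrow> int" where
  "right_slope f x = (THE s. \<forall>\<^sub>F y in at_right x. f y = f x + of_int s * (y - x))"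

definition left_slope :: "(real \<Rightarrow> real) \<Rightarrow> real \<Rightarrow> int" where
  "left_slope f x = (THE s. \<forall>\<^sub>F y in at_left x. f y = f x + of_int s * (y - x))"

text \<open>
  The sum of the outgoing slopes of \<open>f\<close> at \<open>p\<close>. The inner sum runs over the parameters at which
  the edge \<open>e\<close> passes through \<open>p\<close>; there is at most one, except when \<open>p\<close> is both ends of \<open>e\<close>.
\<close>

definition ord_at ::
  "('v, 'e) metric_graph \<Rightarrow> (('v, 'e) point \<Rightarrow> real) \<Rightarrow> ('v, 'e) point \<Rightarrow> int" where
  "ord_at G f p =
     (\<Sum>e\<in>edges G. \<Sum>x\<in>{x. 0 \<le> x \<and> x \<le> len G e \<and> edge_point G e x = p}.
        (if x < len G e then right_slope (\<lambda>y. f (edge_point G e y)) x else 0) -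
        (if 0 < x then left_slope (\<lambda>y. f (edge_point G e y)) x else 0))"

definition principal :: "('v, 'e) metric_graph \<Rightarrow> ('v, 'e) divisor \<Rightarrow> bool" where
  "principal G D \<longleftrightarrow> D \<in> divisors G \<and>
     (\<exists>f. rational_function G f \<and> (\<forall>p\<in>points G. Poly_Mapping.lookup D p = ord_at G f p))"

definition lin_equiv :: "('v, 'e) metric_graph \<Rightarrow> (('v, 'e) divisor \<times> ('v, 'e) divisor) set" where
  "lin_equiv G = {(D, E). D \<in> divisors G \<and> E \<in> divisors G \<and> principal G (D - E)}"

definition Pic :: "('v, 'e) metric_graph \<Rightarrow> int \<Rightarrow> ('v, 'e) divisor set set" where
  "Pic G d = {D \<in> divisors G. div_deg D = d} // lin_equiv G"


section \<open>Baker-Norine rank and Brill-Noether loci\<close>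

text \<open>
  The set is never empty, since no effective divisor has degree \<open>-1\<close>; in particular the rank is
  \<open>-1\<close> exactly when \<open>D\<close> is not equivalent to an effective divisor.
\<close>

definition bn_rank :: "('v, 'e) metric_graph \<Rightarrow> ('v, 'e) divisor \<Rightarrow> int" where
  "bn_rank G D = Max {s. - 1 \<le> s \<and>
     (\<forall>E. effective G E \<and> div_deg E = s \<longrightarrow> (\<exists>F. effective G F \<and> (D - E, F) \<in> lin_equiv G))}"

definition W :: "('v, 'e) metric_graph \<Rightarrow> int \<Rightarrow> int \<Rightarrow> ('v, 'e) divisor set set" where
  "W G r d = {C \<in> Pic G d. \<exists>D\<in>C. bn_rank G D \<ge> r}"


section \<open>Chains of loops\<close>

record loop_chain =
  genus :: nat
  top_len :: "nat \<Rightarrow> real"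
  bottom_len :: "nat \<Rightarrow> real"
  bridge_len :: "nat \<Rightarrow> real"

definition chain_of_loops :: "loop_chain \<Rightarrow> bool" where
  "chain_of_loops \<Gamma> \<longleftrightarrow>
     (\<forall>j\<in>{1..genus \<Gamma>}. 0 < top_len \<Gamma> j \<and> 0 < bottom_len \<Gamma> j) \<and>
     (\<forall>j\<in>{1..<genus \<Gamma>}. 0 < bridge_len \<Gamma> j)"

datatype chain_vertex = Lefthand nat | Righthand nat
datatype chain_edge = Top nat | Bottom nat | Bridge nat

text \<open>
  Top edges are directed from right to left and bottom edges from left to right, so that each
  loop is traversed counterclockwise.
\<close>

fun chain_src :: "chain_edge \<Rightarrow> chain_vertex" where
  "chain_src (Top j) = Righthand j"
| "chain_src (Bottom j) = Lefthand j"
| "chain_src (Bridge j) = Righthand j"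

fun chain_tgt :: "chain_edge \<Rightarrow> chain_vertex" where
  "chain_tgt (Top j) = Lefthand j"
| "chain_tgt (Bottom j) = Righthand j"
| "chain_tgt (Bridge j) = Lefthand (Suc j)"

fun chain_len :: "loop_chain \<Rightarrow> chain_edge \<Rightarrow> real" where
  "chain_len \<Gamma> (Top j) = top_len \<Gamma> j"
| "chain_len \<Gamma> (Bottom j) = bottom_len \<Gamma> j"
| "chain_len \<Gamma> (Bridge j) = bridge_len \<Gamma> j"

definition chain_graph :: "loop_chain \<Rightarrow> (chain_vertex, chain_edge) metric_graph" where
  "chain_graph \<Gamma> =
     \<lparr>verts = Lefthand ` {1..genus \<Gamma>} \<union> Righthand ` {1..genus \<Gamma>},
      edges = Top ` {1..genus \<Gamma>} \<union> Bottom ` {1..genus \<Gamma>} \<union> Bridge ` {1..<genus \<Gamma>},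
      src = chain_src, tgt = chain_tgt, len = chain_len \<Gamma>\<rparr>"

definition torsion_order :: "loop_chain \<Rightarrow> nat \<Rightarrow> nat" where
  "torsion_order \<Gamma> j =
     (if (top_len \<Gamma> j + bottom_len \<Gamma> j) / bottom_len \<Gamma> j \<notin> \<rat> then 0
      else LEAST \<tau>. 0 < \<tau> \<and>
        (\<exists>n::int. of_nat \<tau> * bottom_len \<Gamma> j = of_int n * (top_len \<Gamma> j + bottom_len \<Gamma> j)))"

text \<open>The condition \<open>i + k > g + 1\<close> is \<open>i > g - k + 1\<close>, written without truncated subtraction.\<close>

definition k_gonal_chain :: "nat \<Rightarrow> nat \<Rightarrow> loop_chain \<Rightarrow> bool" where
  "k_gonal_chain k g \<Gamma> \<longleftrightarrow> chain_of_loops \<Gamma> \<and> genus \<Gamma> = g \<and>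
     (\<forall>i\<in>{1..g}. torsion_order \<Gamma> i = (if i < k \<or> i + k > g + 1 then 0 else k))"

text \<open>
  The point \<open>\<langle>\<xi>\<rangle>\<^sub>j\<close>: \<open>\<xi> m\<^sub>j\<close> units counterclockwise from the righthand vertex, where the distance is
  first reduced modulo the circumference of the loop. The path runs along the top edge first.
\<close>

definition loop_point :: "loop_chain \<Rightarrow> nat \<Rightarrow> real \<Rightarrow> (chain_vertex, chain_edge) point" where
  "loop_point \<Gamma> j \<xi> =
     (let c = top_len \<Gamma> j + bottom_len \<Gamma> j; s = c * frac (\<xi> * bottom_len \<Gamma> j / c)
      in if s < top_len \<Gamma> j then edge_point (chain_graph \<Gamma>) (Top j) s
         else edge_point (chain_graph \<Gamma>) (Bottom j) (s - top_len \<Gamma> j))"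

text \<open>The divisor \<open>(d - g) \<langle>0\<rangle>\<^sub>g + (\<Sum>j = 1..g. \<langle>\<xi> j\<rangle>\<^sub>j)\<close>.\<close>

definition coord_divisor ::
  "loop_chain \<Rightarrow> int \<Rightarrow> (nat \<Rightarrow> real) \<Rightarrow> (chain_vertex, chain_edge) divisor" where
  "coord_divisor \<Gamma> d \<xi> =
     frag_cmul (d - int (genus \<Gamma>)) (frag_of (loop_point \<Gamma> (genus \<Gamma>) 0)) +
     (\<Sum>j\<in>{1..genus \<Gamma>}. frag_of (loop_point \<Gamma> j (\<xi> j)))"

text \<open>
  The coordinates of a divisor class of degree \<open>d\<close>. The real numbers \<open>\<xi> j\<close> are not determined by
  the class, but the points \<open>loop_point \<Gamma> j (\<xi> j)\<close> are, and only these are used.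
\<close>

definition coord ::
  "loop_chain \<Rightarrow> int \<Rightarrow> (chain_vertex, chain_edge) divisor set \<Rightarrow> nat \<Rightarrow> real" where
  "coord \<Gamma> d C = (SOME \<xi>. coord_divisor \<Gamma> d \<xi> \<in> C)"


section \<open>Tableaux and tori\<close>

text \<open>
  A tableau on \<open>[a] \<times> [b]\<close> is a function on all pairs of naturals of which only the values on
  \<open>{1..a} \<times> {1..b}\<close> matter.
\<close>

definition tableau :: "nat \<Rightarrow> nat \<Rightarrow> nat \<Rightarrow> (nat \<Rightarrow> nat \<Rightarrow> nat) \<Rightarrow> bool" where
  "tableau a b g t \<longleftrightarrow>
     (\<forall>x\<in>{1..a}. \<forall>y\<in>{1..b}. t x y \<in> {1..g} \<and>
        (y < b \<longrightarrow> t x y < t x (Suc y)) \<and> (x < a \<longrightarrow> t x y < t (Suc x) y))"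

definition k_uniform_displacement_tableau ::
  "nat \<Rightarrow> nat \<Rightarrow> nat \<Rightarrow> nat \<Rightarrow> (nat \<Rightarrow> nat \<Rightarrow> nat) \<Rightarrow> bool" where
  "k_uniform_displacement_tableau k a b g t \<longleftrightarrow> tableau a b g t \<and>
     (\<forall>x\<in>{1..a}. \<forall>y\<in>{1..b}. \<forall>x'\<in>{1..a}. \<forall>y'\<in>{1..b}.
        t x y = t x' y' \<longrightarrow> [int x - int y = int x' - int y'] (mod int k))"

definition torus ::
  "loop_chain \<Rightarrow> int \<Rightarrow> nat \<Rightarrow> nat \<Rightarrow> (nat \<Rightarrow> nat \<Rightarrow> nat) \<Rightarrow>
     (chain_vertex, chain_edge) divisor set set" where
  "torus \<Gamma> d a b t = {C \<in> Pic (chain_graph \<Gamma>) d. \<forall>x\<in>{1..a}. \<forall>y\<in>{1..b}.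
     loop_point \<Gamma> (t x y) (coord \<Gamma> d C (t x y)) = loop_point \<Gamma> (t x y) (real y - real x)}"

definition maximal_torus ::
  "loop_chain \<Rightarrow> int \<Rightarrow> nat \<Rightarrow> nat \<Rightarrow> nat \<Rightarrow> (nat \<Rightarrow> nat \<Rightarrow> nat) \<Rightarrow> bool" where
  "maximal_torus \<Gamma> d k a b t \<longleftrightarrow>
     (\<forall>t'. k_uniform_displacement_tableau k a b (genus \<Gamma>) t' \<and>
        torus \<Gamma> d a b t \<subseteq> torus \<Gamma> d a b t' \<longrightarrow> torus \<Gamma> d a b t = torus \<Gamma> d a b t')"

text \<open>
  Integer inequalities such as \<open>\<alpha> \<ge> k - b\<close> are written in additive form to avoid truncated
  subtraction; the remaining differences of naturals are nonnegative under their guards.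
\<close>

definition scrollar_of_type ::
  "nat \<Rightarrow> nat \<Rightarrow> nat \<Rightarrow> nat \<Rightarrow> (nat \<Rightarrow> nat \<Rightarrow> nat) \<Rightarrow> bool" where
  "scrollar_of_type \<alpha> k a b t \<longleftrightarrow>
     (\<forall>x\<in>{1..a}. \<forall>y\<in>{1..b}. \<forall>x'\<in>{1..a}. \<forall>y'\<in>{1..b}.
        t x y = t x' y' \<longleftrightarrow>
        (\<exists>l::int. int x' - int x = l * int \<alpha> \<and> int y' - int y = l * (int \<alpha> - int k))) \<and>
     (\<alpha> = a \<longrightarrow> (\<forall>y\<in>{1..b}. y + a > k \<longrightarrow> t 1 y > t a (y + a - k))) \<and>
     (\<alpha> + b = k \<longrightarrow> (\<forall>x\<in>{1..a}. x + b > k \<longrightarrow> t x 1 > t (x + b - k) b))"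

definition scrollar_tableau ::
  "nat \<Rightarrow> nat \<Rightarrow> nat \<Rightarrow> nat \<Rightarrow> (nat \<Rightarrow> nat \<Rightarrow> nat) \<Rightarrow> bool" where
  "scrollar_tableau k a b g t \<longleftrightarrow> tableau a b g t \<and>
     (\<exists>\<alpha>. 0 < \<alpha> \<and> \<alpha> \<le> min a (k - 1) \<and> (\<alpha> + b \<ge> k \<or> \<alpha> = a) \<and> scrollar_of_type \<alpha> k a b t)"

end

theory Submission
  imports Defs "HOL-Library.Real_Mod" "HOL-Analysis.Continuum_Not_Denumerable"
begin

text \<open>
  The proof has a tropical half, which describes the Brill-Noether locus by growing Young diagrams,
  and a combinatorial half, which compares the tableaux that record such growth.

  Collapsing everything on the left of loop \<open>j\<close> to its lefthand vertex and everything on the right to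
  its righthand vertex sends a divisor to a class \<open>jacobian \<Gamma> j D\<close> modulo the circumference of the
  loop. A divisor is principal iff its degree and all these classes vanish (\<open>principal_jacobian\<close>,
  \<open>principal_degree\<close>, \<open>principal_if_jacobian\<close>). Linear equivalence is thereby arithmetic in a product
  of circles, and the coordinates of a class are these invariants up to scaling and a shift.

  An effective divisor with \<open>n\<^sub>j\<close> chips on loop \<open>j\<close> can have any invariant at loop \<open>j\<close> if
  \<open>n\<^sub>j > 0\<close>, whereas \<open>n\<^sub>j = 0\<close> forces it to be the class of the chips on the earlier loops. Having
  rank at least \<open>r\<close> is therefore a game: an opponent removes \<open>r\<close> chips, and the numbers \<open>n\<^sub>j\<close> have to
  be chosen with the right total. Under optimal play the position after \<open>j\<close> loops is described by a
  Young diagram, which at loop \<open>j\<close> gains all addable boxes whose diagonal is allowed by the coordinate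
  \<open>\<xi>\<^sub>j\<close>, and the rank is at least \<open>r\<close> iff the final diagram contains the rectangle
  \<open>[r + 1] \<times> [g - d + r]\<close> (\<open>rank_condition\<close>). The times at which the boxes enter form a tableau, so
  that the Brill-Noether locus is the union of the tori of \<open>k\<close>-uniform displacement tableaux
  (\<open>W_eq_Union_torus\<close>).

  The torus of \<open>t\<close> is contained in that of \<open>t'\<close> iff \<open>t'\<close> draws its entries from \<open>t\<close>: each entry of
  \<open>t'\<close> occurs in \<open>t\<close> with the same diagonal modulo \<open>k\<close> (\<open>torus_subset_iff\<close>). Two facts about this
  relation finish the proof. First, each \<open>t\<close> admits a scrollar \<open>t'\<close> drawing from it
  (\<open>exists_scrollar_drawing_from\<close>): growing a diagram with all the entries of \<open>t\<close> produces a \<open>k\<close>-core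
  containing the rectangle, every such core contains a staircase invariant under translation by
  \<open>(\<alpha>, \<alpha> - k)\<close>, and removing corners from that staircase backwards in time gives a tableau with
  exactly the periodicity of a scrollar one. Second, a tableau that draws from a scrollar tableau
  equals it (\<open>scrollar_eq_if_draws_from\<close>), because the scrollar conditions make a tableau monotone
  across translates of the rectangle.
\<close>

section \<open>Slopes and summation by parts\<close>

abbreviation "lookup \<equiv> Poly_Mapping.lookup"
abbreviation "keys \<equiv> Poly_Mapping.keys"

lemma right_slopeI:
  assumes "x < u" "\<And>y. x \<le> y \<Longrightarrow> y \<le> u \<Longrightarrow> f y = f x + of_int s * (y - x)"
  shows "right_slope f x = s"
  unfolding right_slope_def
proof (rule the_equality)
  show ev: "\<forall>\<^sub>F y in at_right x. f y = f x + of_int s * (y - x)"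
    unfolding eventually_at_right_field using assms(1)
    by (intro exI[of _ u] conjI allI impI assms(2)) auto
  fix s' :: int assume "\<forall>\<^sub>F y in at_right x. f y = f x + of_int s' * (y - x)"
  with ev have "\<forall>\<^sub>F y in at_right x. f y = f x + of_int s * (y - x) \<and> f y = f x + of_int s' * (y - x) \<and> x < y"
    by (intro eventually_conj eventually_at_right_less)
  then obtain y where "f y = f x + of_int s * (y - x)" "f y = f x + of_int s' * (y - x)" "x < y"
    using eventually_happens'[OF trivial_limit_at_right_real] by blast
  then show "s' = s" by simp
qed

lemma left_slopeI:
  assumes "u < x" "\<And>y. u \<le> y \<Longrightarrow> y \<le> x \<Longrightarrow> f y = f x + of_int s * (y - x)"
  shows "left_slope f x = s"
  unfolding left_slope_def
proof (rule the_equality)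
  show ev: "\<forall>\<^sub>F y in at_left x. f y = f x + of_int s * (y - x)"
    unfolding eventually_at_left_field using assms(1)
    by (intro exI[of _ u] conjI allI impI assms(2)) auto
  have less: "\<forall>\<^sub>F y in at_left x. y < x"
    unfolding eventually_at_left_field using assms(1) by blast
  fix s' :: int assume "\<forall>\<^sub>F y in at_left x. f y = f x + of_int s' * (y - x)"
  with ev less have "\<forall>\<^sub>F y in at_left x. f y = f x + of_int s * (y - x) \<and> f y = f x + of_int s' * (y - x) \<and> y < x"
    by (intro eventually_conj)
  then obtain y where "f y = f x + of_int s * (y - x)" "f y = f x + of_int s' * (y - x)" "y < x"
    using eventually_happens'[OF trivial_limit_at_left_real] by blast
  then show "s' = s" by simp
qed

definition bend_at :: "real \<Rightarrow> (real \<Rightarrow> real) \<Rightarrow> real \<Rightarrow> int" where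
  "bend_at L f x = (if x < L then right_slope f x else 0) - (if 0 < x then left_slope f x else 0)"

text \<open>
  Summation by parts: on a piece of slope \<open>s\<close> from \<open>u\<close> to
  \<open>v\<close>, the right slopes of the points in \<open>[u, v)\<close> and the left slopes
  of the points in \<open>(u, v]\<close> cancel except at \<open>u\<close> and \<open>v\<close>,
  which leaves \<open>s\<close> times the increment of the affine weight, that is, \<open>-
  \<beta>\<close> times the increment of \<open>f\<close>. The set \<open>B\<close> consists of
  the breakpoints; adding points to it changes nothing, which allows all edges to be summed over
  preimages of one finite set of points.
\<close>

lemma sum_bend_affine:
  assumes "pl_int_on L f" "0 < L"
  shows "\<exists>B. finite B \<and> B \<subseteq> {0..L} \<and> (\<forall>X \<alpha> \<beta>. finite X \<longrightarrow> B \<subseteq> X \<longrightarrow> X \<subseteq> {0..L} \<longrightarrow>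
       (\<Sum>x\<in>X. of_int (bend_at L f x) * (\<alpha> + \<beta> * x)) = - \<beta> * (f L - f 0))"
proof -
  obtain xs where xs: "xs \<noteq> []" "sorted_wrt (<) xs" "hd xs = 0" "last xs = L"
    and pieces: "\<And>i. Suc i < length xs \<Longrightarrow>
      \<exists>s::int. \<forall>x\<in>{xs ! i..xs ! Suc i}. f x = f (xs ! i) + of_int s * (x - xs ! i)"
    using assms(1) unfolding pl_int_on_def by blast
  have first: "xs ! 0 = 0" using xs(1,3) by (simp add: hd_conv_nth)
  have lastx: "xs ! (length xs - 1) = L" using xs(1,4) by (simp add: last_conv_nth)
  have lt: "xs ! i < xs ! j" if "i < j" "j < length xs" for i j
    using xs(2) that by (simp add: sorted_wrt_iff_nth_less)
  have range: "0 \<le> xs ! i \<and> xs ! i \<le> L" if "i < length xs" for i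
  proof -
    have le: "xs ! i \<le> xs ! j" if "i \<le> j" "j < length xs" for i j
      using lt[of i j] that by (cases "i = j") auto
    have "i \<le> length xs - 1" "length xs - 1 < length xs" using that by linarith+
    then show ?thesis using le[of 0 i] le[of i "length xs - 1"] first lastx that by simp
  qed
  have total: "(\<Sum>x\<in>X. of_int (bend_at L f x) * (\<alpha> + \<beta> * x)) = - \<beta> * (f L - f 0)"
    if X: "finite X" "set xs \<subseteq> X" "X \<subseteq> {0..L}" for X and \<alpha> \<beta> :: real
  proof -
    define h where "h x = \<alpha> + \<beta> * x" for x
    define R where "R x = of_int (right_slope f x) * h x" for x
    define Q where "Q x = of_int (left_slope f x) * h x" for x
    have "sum R {x\<in>X. x < xs ! i} - sum Q {x\<in>X. 0 < x \<and> x \<le> xs ! i} = - \<beta> * (f (xs ! i) - f 0)"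
      if "i < length xs" for i
      using that
    proof (induction i)
      case 0
      have e: "{x\<in>X. x < xs ! 0} = {}" "{x\<in>X. 0 < x \<and> x \<le> xs ! 0} = {}" using first X(3) by auto
      show ?case unfolding e using first by simp
    next
      case (Suc i)
      let ?u = "xs ! i" and ?v = "xs ! Suc i"
      let ?M = "{x\<in>X. ?u < x \<and> x < ?v}"
      have uv: "?u < ?v" "0 \<le> ?u" "?u \<in> X" "?v \<in> X"
        using lt[of i "Suc i"] range[of i] Suc.prems X(2) by auto
      obtain s :: int where piece: "\<forall>x\<in>{?u..?v}. f x = f ?u + of_int s * (x - ?u)"
        using pieces[OF Suc.prems] by blast
      have s: "f x = f ?u + of_int s * (x - ?u)" if "?u \<le> x" "x \<le> ?v" for x
        by (rule bspec[OF piece]) (use that in simp)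
      have R: "R x = of_int s * h x" if "?u \<le> x" "x < ?v" for x
      proof -
        have "right_slope f x = s"
        proof (rule right_slopeI[OF that(2)])
          fix y assume "x \<le> y" "y \<le> ?v"
          then have "f y = f ?u + of_int s * (y - ?u)" "f x = f ?u + of_int s * (x - ?u)"
            using that by (intro s; linarith)+
          then show "f y = f x + of_int s * (y - x)" by (simp add: algebra_simps)
        qed
        then show ?thesis by (simp add: R_def)
      qed
      have Q: "Q x = of_int s * h x" if "?u < x" "x \<le> ?v" for x
      proof -
        have "left_slope f x = s"
        proof (rule left_slopeI[OF that(1)])
          fix y assume "?u \<le> y" "y \<le> x"
          then have "f y = f ?u + of_int s * (y - ?u)" "f x = f ?u + of_int s * (x - ?u)"
            using that by (intro s; linarith)+
          then show "f y = f x + of_int s * (y - x)" by (simp add: algebra_simps)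
        qed
        then show ?thesis by (simp add: Q_def)
      qed
      have eqR: "{x\<in>X. x < ?v} = {x\<in>X. x < ?u} \<union> insert ?u ?M"
        using uv by auto
      have "sum R {x\<in>X. x < ?v} = sum R {x\<in>X. x < ?u} + sum R (insert ?u ?M)"
        unfolding eqR by (rule sum.union_disjoint) (use X(1) in auto)
      also have "sum R (insert ?u ?M) = of_int s * h ?u + (\<Sum>x\<in>?M. of_int s * h x)"
        using X(1) R uv by (subst sum.insert) (auto intro!: sum.cong)
      finally have 1: "sum R {x\<in>X. x < ?v} =
          sum R {x\<in>X. x < ?u} + (of_int s * h ?u + (\<Sum>x\<in>?M. of_int s * h x))" .
      have eqQ: "{x\<in>X. 0 < x \<and> x \<le> ?v} = {x\<in>X. 0 < x \<and> x \<le> ?u} \<union> insert ?v ?M"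
        using uv by auto
      have "sum Q {x\<in>X. 0 < x \<and> x \<le> ?v} = sum Q {x\<in>X. 0 < x \<and> x \<le> ?u} + sum Q (insert ?v ?M)"
        unfolding eqQ by (rule sum.union_disjoint) (use X(1) uv in auto)
      also have "sum Q (insert ?v ?M) = of_int s * h ?v + (\<Sum>x\<in>?M. of_int s * h x)"
        using X(1) Q uv by (subst sum.insert) (auto intro!: sum.cong)
      finally have 2: "sum Q {x\<in>X. 0 < x \<and> x \<le> ?v} =
          sum Q {x\<in>X. 0 < x \<and> x \<le> ?u} + (of_int s * h ?v + (\<Sum>x\<in>?M. of_int s * h x))" .
      have "of_int s * h ?u - of_int s * h ?v = - \<beta> * (f ?v - f ?u)"
      proof -
        have "f ?v - f ?u = of_int s * (?v - ?u)" using s[of ?v] uv(1) by simp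
        then show ?thesis unfolding h_def by (simp only:) (simp add: algebra_simps)
      qed
      then show ?case using 1 2 Suc.IH Suc.prems by (simp add: algebra_simps)
    qed
    from this[of "length xs - 1"]
    have "sum R {x\<in>X. x < L} - sum Q {x\<in>X. 0 < x \<and> x \<le> L} = - \<beta> * (f L - f 0)"
      using xs(1) lastx by simp
    moreover have "sum R {x\<in>X. x < L} = (\<Sum>x\<in>X. if x < L then R x else 0)"
      using X(1) by (simp add: sum.inter_filter)
    moreover have "{x\<in>X. 0 < x \<and> x \<le> L} = {x\<in>X. 0 < x}" using X(3) by auto
    moreover have "sum Q {x\<in>X. 0 < x} = (\<Sum>x\<in>X. if 0 < x then Q x else 0)"
      using X(1) by (simp add: sum.inter_filter)
    moreover have "of_int (bend_at L f x) * (\<alpha> + \<beta> * x) =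
        (if x < L then R x else 0) - (if 0 < x then Q x else 0)" for x
      by (simp add: bend_at_def R_def Q_def h_def algebra_simps)
    ultimately show ?thesis by (simp add: sum_subtractf)
  qed
  have "set xs \<subseteq> {0..L}" using range by (auto simp: in_set_conv_nth)
  then show ?thesis by (intro exI[of _ "set xs"] conjI allI impI total) simp_all
qed

definition wf_graph :: "('v, 'e) metric_graph \<Rightarrow> bool" where
  "wf_graph G \<longleftrightarrow> finite (edges G) \<and>
     (\<forall>e\<in>edges G. 0 < len G e \<and> src G e \<in> verts G \<and> tgt G e \<in> verts G)"

lemma edge_point_in_points:
  assumes "wf_graph G" "e \<in> edges G" "0 \<le> x" "x \<le> len G e"
  shows "edge_point G e x \<in> points G"
  using assms by (force simp: wf_graph_def edge_point_def points_def)

lemma finite_edge_fibre: "finite {x. 0 \<le> x \<and> x \<le> len G e \<and> edge_point G e x = p}"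
proof (rule finite_subset)
  show "{x. 0 \<le> x \<and> x \<le> len G e \<and> edge_point G e x = p} \<subseteq>
      {0, len G e} \<union> (case p of Vertex v \<Rightarrow> {} | Inner e x \<Rightarrow> {x})"
    by (auto simp: edge_point_def split: if_splits)
qed (auto split: point.split)

lemma ord_at_bend:
  "ord_at G f p = (\<Sum>e\<in>edges G. \<Sum>x\<in>{x. 0 \<le> x \<and> x \<le> len G e \<and> edge_point G e x = p}.
     bend_at (len G e) (\<lambda>y. f (edge_point G e y)) x)"
  by (simp add: ord_at_def bend_at_def)

text \<open>
  The linear functional on divisors given by a function on points. Degree and Abel-Jacobi
  invariants are both of this form.
\<close>

definition weight :: "('p \<Rightarrow>\<^sub>0 int) \<Rightarrow> ('p \<Rightarrow> real) \<Rightarrow> real" where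
  "weight D h = (\<Sum>p\<in>keys D. of_int (lookup D p) * h p)"

lemma weight_superset:
  assumes "finite K" "keys D \<subseteq> K"
  shows "weight D h = (\<Sum>p\<in>K. of_int (lookup D p) * h p)"
  unfolding weight_def using assms
  by (intro sum.mono_neutral_left) (auto simp: in_keys_iff)

text \<open>
  Pairing a principal divisor with a function that is affine along edges up to multiples of
  \<open>c\<close>. The multiples are there for a function into the circle \<open>\<real> /
  c\<int>\<close>: represented by real numbers, it jumps by \<open>c\<close> somewhere, and
  since orders are integers the jump contributes a multiple of \<open>c\<close>.
\<close>

lemma weight_principal:
  fixes G :: "('v, 'e) metric_graph" and c :: real
  assumes G: "wf_graph G" and D: "D \<in> divisors G" and f: "rational_function G f"
    and ord: "\<And>p. p \<in> points G \<Longrightarrow> lookup D p = ord_at G f p"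
    and h: "\<And>e x. e \<in> edges G \<Longrightarrow> 0 \<le> x \<Longrightarrow> x \<le> len G e \<Longrightarrow>
      h (edge_point G e x) = \<alpha> e + \<beta> e * x + of_int (n e x) * c"
  shows "\<exists>N::int. weight D h =
    of_int N * c - (\<Sum>e\<in>edges G. \<beta> e * (f (Vertex (tgt G e)) - f (Vertex (src G e))))"
proof -
  let ?\<phi> = "\<lambda>e x. f (edge_point G e x)"
  let ?S = "\<lambda>e p. {x. 0 \<le> x \<and> x \<le> len G e \<and> edge_point G e x = p}"
  let ?j = "\<lambda>e. bend_at (len G e) (?\<phi> e)"
  have fin: "finite (edges G)" and len: "\<And>e. e \<in> edges G \<Longrightarrow> 0 < len G e" using G by (auto simp: wf_graph_def)
  let ?good = "\<lambda>e B. finite B \<and> B \<subseteq> {0..len G e} \<and>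
    (\<forall>X \<alpha> \<beta>. finite X \<longrightarrow> B \<subseteq> X \<longrightarrow> X \<subseteq> {0..len G e} \<longrightarrow>
      (\<Sum>x\<in>X. of_int (?j e x) * (\<alpha> + \<beta> * x)) = - \<beta> * (?\<phi> e (len G e) - ?\<phi> e 0))"
  have "\<forall>e\<in>edges G. \<exists>B. ?good e B"
    using f by (intro ballI sum_bend_affine) (auto simp: rational_function_def len)
  then obtain B where good: "\<forall>e\<in>edges G. ?good e (B e)"
    unfolding bchoice_iff ..
  have B: "finite (B e)" "B e \<subseteq> {0..len G e}"
    "\<And>X \<alpha> \<beta>. finite X \<Longrightarrow> B e \<subseteq> X \<Longrightarrow> X \<subseteq> {0..len G e} \<Longrightarrow>
       (\<Sum>x\<in>X. of_int (?j e x) * (\<alpha> + \<beta> * x)) = - \<beta> * (?\<phi> e (len G e) - ?\<phi> e 0)"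
    if "e \<in> edges G" for e
    using good that by blast+
  define K where "K = keys D \<union> (\<Union>e\<in>edges G. edge_point G e ` B e)"
  have K: "finite K" "keys D \<subseteq> K" using fin B(1) by (auto simp: K_def)
  have Kpoints: "K \<subseteq> points G"
    using D B(2) edge_point_in_points[OF G] unfolding K_def divisors_def by fastforce
  define X where "X e = {x. 0 \<le> x \<and> x \<le> len G e \<and> edge_point G e x \<in> K}" for e
  have X: "finite (X e)" "X e \<subseteq> {0..len G e}" for e
  proof -
    have "X e = (\<Union>p\<in>K. ?S e p)" by (auto simp: X_def)
    then show "finite (X e)" by (simp only: finite_UN_I[OF K(1) finite_edge_fibre])
    show "X e \<subseteq> {0..len G e}" by (auto simp: X_def)
  qed
  have BX: "B e \<subseteq> X e" if "e \<in> edges G" for e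
    using B(2)[OF that] that by (auto simp: X_def K_def)
  have "weight D h = (\<Sum>p\<in>K. of_int (lookup D p) * h p)"
    by (rule weight_superset[OF K])
  also have "\<dots> = (\<Sum>p\<in>K. \<Sum>e\<in>edges G. \<Sum>x\<in>?S e p. of_int (?j e x) * h (edge_point G e x))"
  proof (rule sum.cong[OF refl])
    fix p assume "p \<in> K"
    then have "lookup D p = ord_at G f p" using ord Kpoints by blast
    then show "of_int (lookup D p) * h p =
        (\<Sum>e\<in>edges G. \<Sum>x\<in>?S e p. of_int (?j e x) * h (edge_point G e x))"
      by (simp add: ord_at_bend sum_distrib_right)
  qed
  also have "\<dots> = (\<Sum>e\<in>edges G. \<Sum>p\<in>K. \<Sum>x\<in>?S e p. of_int (?j e x) * h (edge_point G e x))"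
    by (rule sum.swap)
  also have "\<dots> = (\<Sum>e\<in>edges G. \<Sum>x\<in>X e. of_int (?j e x) * h (edge_point G e x))"
  proof (rule sum.cong[OF refl])
    fix e
    have "?S e p = {x\<in>X e. edge_point G e x = p}" if "p \<in> K" for p
      using that by (auto simp: X_def)
    then have "(\<Sum>p\<in>K. \<Sum>x\<in>?S e p. of_int (?j e x) * h (edge_point G e x)) =
        (\<Sum>p\<in>K. \<Sum>x\<in>{x\<in>X e. edge_point G e x = p}. of_int (?j e x) * h (edge_point G e x))"
      by (intro sum.cong) auto
    also have "\<dots> = (\<Sum>x\<in>X e. of_int (?j e x) * h (edge_point G e x))"
      by (rule sum.group) (use X K(1) in \<open>auto simp: X_def\<close>)
    finally show "(\<Sum>p\<in>K. \<Sum>x\<in>?S e p. of_int (?j e x) * h (edge_point G e x)) =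
        (\<Sum>x\<in>X e. of_int (?j e x) * h (edge_point G e x))" .
  qed
  also have "\<dots> = (\<Sum>e\<in>edges G. - \<beta> e * (f (Vertex (tgt G e)) - f (Vertex (src G e))) +
      of_int (\<Sum>x\<in>X e. ?j e x * n e x) * c)"
  proof (rule sum.cong[OF refl])
    fix e assume e: "e \<in> edges G"
    have "(\<Sum>x\<in>X e. of_int (?j e x) * h (edge_point G e x)) =
        (\<Sum>x\<in>X e. of_int (?j e x) * (\<alpha> e + \<beta> e * x) + of_int (?j e x * n e x) * c)"
    proof (rule sum.cong[OF refl])
      fix x assume "x \<in> X e"
      then have "h (edge_point G e x) = \<alpha> e + \<beta> e * x + of_int (n e x) * c" by (intro h[OF e]) (auto simp: X_def)
      then show "of_int (?j e x) * h (edge_point G e x) =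
          of_int (?j e x) * (\<alpha> e + \<beta> e * x) + of_int (?j e x * n e x) * c"
        by (simp add: algebra_simps)
    qed
    also have "\<dots> = (\<Sum>x\<in>X e. of_int (?j e x) * (\<alpha> e + \<beta> e * x)) + of_int (\<Sum>x\<in>X e. ?j e x * n e x) * c"
      by (simp add: sum.distrib sum_distrib_right)
    also have "(\<Sum>x\<in>X e. of_int (?j e x) * (\<alpha> e + \<beta> e * x)) = - \<beta> e * (?\<phi> e (len G e) - ?\<phi> e 0)"
      by (rule B(3)[OF e X(1) BX[OF e] X(2)])
    also have "?\<phi> e (len G e) - ?\<phi> e 0 = f (Vertex (tgt G e)) - f (Vertex (src G e))"
      using len[OF e] by (simp add: edge_point_def)
    finally show "(\<Sum>x\<in>X e. of_int (?j e x) * h (edge_point G e x)) =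
        - \<beta> e * (f (Vertex (tgt G e)) - f (Vertex (src G e))) + of_int (\<Sum>x\<in>X e. ?j e x * n e x) * c" .
  qed
  also have "\<dots> = of_int (\<Sum>e\<in>edges G. \<Sum>x\<in>X e. ?j e x * n e x) * c -
      (\<Sum>e\<in>edges G. \<beta> e * (f (Vertex (tgt G e)) - f (Vertex (src G e))))"
    by (simp add: sum.distrib sum_negf sum_subtractf sum_distrib_right)
  finally show ?thesis by blast
qed

section \<open>Principal divisors from broken lines\<close>

definition broken_line :: "real \<Rightarrow> int \<Rightarrow> real set \<Rightarrow> (real \<Rightarrow> int) \<Rightarrow> real \<Rightarrow> real" where
  "broken_line A B Y w x = A + of_int B * x + (\<Sum>y\<in>Y. of_int (w y) * max 0 (x - y))"

lemma broken_line_piece: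
  assumes "finite Y" "u \<le> v" "\<And>y. y \<in> Y \<Longrightarrow> y \<le> u \<or> v \<le> y"
  shows "broken_line A B Y w v = broken_line A B Y w u + of_int (B + (\<Sum>y\<in>{y\<in>Y. y \<le> u}. w y)) * (v - u)"
proof -
  have "(\<Sum>y\<in>Y. of_int (w y) * max 0 (v - y)) - (\<Sum>y\<in>Y. of_int (w y) * max 0 (u - y)) =
      (\<Sum>y\<in>Y. of_int (w y) * max 0 (v - y) - of_int (w y) * max 0 (u - y))"
    by (simp add: sum_subtractf)
  also have "\<dots> = (\<Sum>y\<in>Y. if y \<le> u then of_int (w y) * (v - u) else 0)"
    using assms(2,3) by (intro sum.cong) (force simp: max_def algebra_simps)+
  also have "\<dots> = (\<Sum>y\<in>{y\<in>Y. y \<le> u}. of_int (w y) * (v - u))"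
    using assms(1) by (simp add: sum.inter_filter)
  also have "\<dots> = of_int (\<Sum>y\<in>{y\<in>Y. y \<le> u}. w y) * (v - u)" by (simp add: sum_distrib_right)
  finally show ?thesis by (simp add: broken_line_def algebra_simps)
qed

lemma right_slope_broken_line:
  assumes "finite Y"
  shows "right_slope (broken_line A B Y w) x = B + (\<Sum>y\<in>{y\<in>Y. y \<le> x}. w y)"
proof -
  define u where "u = Min (insert (x + 1) {y\<in>Y. x < y})"
  have fin: "finite (insert (x + 1) {y\<in>Y. x < y})" using assms by simp
  have u: "x < u" using fin by (simp add: u_def)
  have Y: "y \<le> x \<or> u \<le> y" if "y \<in> Y" for y
    using fin that unfolding u_def by (cases "y \<le> x") auto
  show ?thesis
  proof (rule right_slopeI[OF u])
    fix z assume "x \<le> z" "z \<le> u"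
    then show "broken_line A B Y w z = broken_line A B Y w x + of_int (B + (\<Sum>y\<in>{y\<in>Y. y \<le> x}. w y)) * (z - x)"
      using Y by (intro broken_line_piece[OF assms]) force+
  qed
qed

lemma left_slope_broken_line:
  assumes "finite Y"
  shows "left_slope (broken_line A B Y w) x = B + (\<Sum>y\<in>{y\<in>Y. y < x}. w y)"
proof -
  define u where "u = Max (insert (x - 1) {y\<in>Y. y < x})"
  have fin: "finite (insert (x - 1) {y\<in>Y. y < x})" using assms by simp
  have u: "u < x" using fin by (simp add: u_def)
  have Y: "x \<le> y \<or> y \<le> u" if "y \<in> Y" for y
    using fin that unfolding u_def by (cases "x \<le> y") auto
  show ?thesis
  proof (rule left_slopeI[OF u])
    fix z assume z: "u \<le> z" "z \<le> x"
    show "broken_line A B Y w z = broken_line A B Y w x + of_int (B + (\<Sum>y\<in>{y\<in>Y. y < x}. w y)) * (z - x)"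
    proof (cases "z = x")
      case False
      then have "{y\<in>Y. y \<le> z} = {y\<in>Y. y < x}" using Y z by force
      moreover have "y \<le> z \<or> x \<le> y" if "y \<in> Y" for y using Y[OF that] z by linarith
      ultimately show ?thesis
        using broken_line_piece[OF assms z(2), of A B w] by (simp add: algebra_simps)
    qed simp
  qed
qed

lemma pl_int_on_broken_line:
  assumes "finite Y" "Y \<subseteq> {0<..<L}" "0 < L"
  shows "pl_int_on L (broken_line A B Y w)"
proof -
  define Z where "Z = insert 0 (insert L Y)"
  define xs where "xs = sorted_list_of_set Z"
  have Z: "finite Z" "Z \<subseteq> {0..L}" "0 \<in> Z" "L \<in> Z" "Y \<subseteq> Z" using assms by (auto simp: Z_def)
  have set: "set xs = Z" and sorted: "sorted_wrt (<) xs"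
    using Z(1) by (simp_all add: xs_def)
  have ne: "xs \<noteq> []" using set Z(3) by auto
  have lt: "i < j \<Longrightarrow> j < length xs \<Longrightarrow> xs ! i < xs ! j" for i j
    using sorted by (simp add: sorted_wrt_iff_nth_less)
  have le: "i \<le> j \<Longrightarrow> j < length xs \<Longrightarrow> xs ! i \<le> xs ! j" for i j
    using lt[of i j] by (cases "i = j") auto
  have "xs ! 0 = 0"
  proof -
    obtain i where "i < length xs" "xs ! i = 0" using set Z(3) by (metis in_set_conv_nth)
    moreover have "xs ! 0 \<in> Z" using ne set by (metis length_greater_0_conv nth_mem)
    ultimately show ?thesis using le[of 0 i] Z(2) by auto
  qed
  then have "hd xs = 0" using hd_conv_nth[OF ne] by simp
  have "xs ! (length xs - 1) = L"
  proof -
    obtain i where "i < length xs" "xs ! i = L" using set Z(4) by (metis in_set_conv_nth)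
    moreover have "xs ! (length xs - 1) \<in> Z" using ne set by (metis last_conv_nth last_in_set)
    moreover from calculation have "L \<le> xs ! (length xs - 1)" using le[of i "length xs - 1"] by auto
    ultimately show ?thesis using Z(2) by fastforce
  qed
  then have "last xs = L" using last_conv_nth[OF ne] by simp
  have "\<exists>s::int. \<forall>x\<in>{xs ! i..xs ! Suc i}.
      broken_line A B Y w x = broken_line A B Y w (xs ! i) + of_int s * (x - xs ! i)" if i: "Suc i < length xs" for i
  proof (intro exI ballI)
    fix x assume x: "x \<in> {xs ! i..xs ! Suc i}"
    have "y \<le> xs ! i \<or> xs ! Suc i \<le> y" if "y \<in> Y" for y
    proof -
      have "y \<in> set xs" using that Z(5) set by blast
      then obtain j where "j < length xs" "xs ! j = y" by (auto simp: in_set_conv_nth)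
      then show ?thesis using le[of j i] le[of "Suc i" j] i by (cases "j \<le> i") auto
    qed
    then have "y \<le> xs ! i \<or> x \<le> y" if "y \<in> Y" for y using that x by fastforce
    then show "broken_line A B Y w x = broken_line A B Y w (xs ! i) +
        of_int (B + (\<Sum>y\<in>{y\<in>Y. y \<le> xs ! i}. w y)) * (x - xs ! i)"
      using x by (intro broken_line_piece[OF assms(1)]) simp_all
  qed
  then show ?thesis unfolding pl_int_on_def using ne sorted \<open>hd xs = 0\<close> \<open>last xs = L\<close> by blast
qed

definition inner_support :: "('v, 'e) divisor \<Rightarrow> 'e \<Rightarrow> real set" where
  "inner_support D e = {y. Inner e y \<in> keys D}"

lemma finite_inner_support: "finite (inner_support D e)"
proof -
  have "inner_support D e = (\<lambda>y. Inner e y) -` keys D" by (auto simp: inner_support_def)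
  then show ?thesis by (simp add: finite_vimageI inj_def)
qed

lemma inner_support_range:
  "D \<in> divisors G \<Longrightarrow> inner_support D e \<subseteq> {0<..<len G e}"
  by (auto simp: inner_support_def divisors_def points_def)

abbreviation inner_coeff :: "('v, 'e) divisor \<Rightarrow> 'e \<Rightarrow> real \<Rightarrow> int" where
  "inner_coeff D e y \<equiv> lookup D (Inner e y)"

text \<open>
  A rational function with prescribed divisor, built from the vertex values \<open>V\<close> and
  the initial slopes \<open>B\<close> on the edges: the slope along an edge changes by the
  coefficient of \<open>D\<close> at every point of its support. What remains to be checked is
  continuity at the end of each edge (\<open>rise\<close>) and the order at the vertices
  (\<open>balance\<close>).
\<close>

lemma principalI:
  fixes B :: "'e \<Rightarrow> int" and V :: "'v \<Rightarrow> real"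
  assumes G: "wf_graph G" and D: "D \<in> divisors G"
    and rise: "\<And>e. e \<in> edges G \<Longrightarrow> V (tgt G e) = V (src G e) + of_int (B e) * len G e +
      (\<Sum>y\<in>inner_support D e. of_int (inner_coeff D e y) * (len G e - y))"
    and balance: "\<And>v. v \<in> verts G \<Longrightarrow> lookup D (Vertex v) =
      (\<Sum>e\<in>{e\<in>edges G. src G e = v}. B e) -
      (\<Sum>e\<in>{e\<in>edges G. tgt G e = v}. B e + (\<Sum>y\<in>inner_support D e. inner_coeff D e y))"
  shows "principal G D"
proof -
  let ?Y = "inner_support D" and ?w = "inner_coeff D"
  define \<phi> where "\<phi> e = broken_line (V (src G e)) (B e) (?Y e) (?w e)" for e
  define f where "f p = (case p of Vertex v \<Rightarrow> V v | Inner e x \<Rightarrow> \<phi> e x)" for p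
  have len: "0 < len G e" if "e \<in> edges G" for e using G that by (simp add: wf_graph_def)
  have fin: "finite (edges G)" using G by (simp add: wf_graph_def)
  have Y: "finite (?Y e)" "?Y e \<subseteq> {0<..<len G e}" for e
    using finite_inner_support inner_support_range[OF D] by auto
  have f: "(\<lambda>x. f (edge_point G e x)) = \<phi> e" if e: "e \<in> edges G" for e
  proof
    fix x
    have "\<phi> e 0 = V (src G e)"
      using Y(2)[of e] by (auto simp: \<phi>_def broken_line_def intro!: sum.neutral)
    moreover have "\<phi> e (len G e) = V (tgt G e)"
      unfolding rise[OF e] \<phi>_def broken_line_def using Y(2)[of e]
      by (auto intro!: sum.cong)
    ultimately show "f (edge_point G e x) = \<phi> e x" by (simp add: edge_point_def f_def)
  qed
  have "rational_function G f"
    unfolding rational_function_def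
  proof
    fix e assume e: "e \<in> edges G"
    show "pl_int_on (len G e) (\<lambda>x. f (edge_point G e x))"
      unfolding f[OF e] \<phi>_def by (rule pl_int_on_broken_line[OF Y len[OF e]])
  qed
  moreover have "lookup D p = ord_at G f p" if p: "p \<in> points G" for p
  proof -
    let ?S = "\<lambda>e. {x. 0 \<le> x \<and> x \<le> len G e \<and> edge_point G e x = p}"
    have ord: "ord_at G f p = (\<Sum>e\<in>edges G. \<Sum>x\<in>?S e. bend_at (len G e) (\<phi> e) x)"
      unfolding ord_at_bend using f by simp
    have bend0: "bend_at (len G e) (\<phi> e) 0 = B e" if "e \<in> edges G" for e
    proof -
      have "sum (?w e) {y\<in>?Y e. y \<le> 0} = 0" using Y(2)[of e] by (intro sum.neutral) auto
      then show ?thesis using len[OF that]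
        by (simp add: bend_at_def \<phi>_def right_slope_broken_line[OF Y(1)])
    qed
    have bendL: "bend_at (len G e) (\<phi> e) (len G e) = - (B e + sum (?w e) (?Y e))" if "e \<in> edges G" for e
    proof -
      have "{y\<in>?Y e. y < len G e} = ?Y e" using Y(2)[of e] by auto
      then show ?thesis using len[OF that]
        by (simp add: bend_at_def \<phi>_def left_slope_broken_line[OF Y(1)])
    qed
    have bend: "bend_at (len G e) (\<phi> e) x = ?w e x" if "e \<in> edges G" "0 < x" "x < len G e" for e x
    proof -
      have "sum (?w e) {y\<in>?Y e. y \<le> x} = sum (?w e) (insert x {y\<in>?Y e. y < x})"
        using Y(1) by (intro sum.mono_neutral_left) (auto simp: inner_support_def in_keys_iff)
      also have "\<dots> = ?w e x + sum (?w e) {y\<in>?Y e. y < x}" using Y(1) by simp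
      finally show ?thesis using that
        by (simp add: bend_at_def \<phi>_def left_slope_broken_line[OF Y(1)] right_slope_broken_line[OF Y(1)])
    qed
    show ?thesis
    proof (cases p)
      case (Inner e x)
      then have e: "e \<in> edges G" "0 < x" "x < len G e" using p by (auto simp: points_def)
      have "?S e' = (if e' = e then {x} else {})" if "e' \<in> edges G" for e'
        using e Inner by (auto simp: edge_point_def split: if_splits)
      then have "ord_at G f p = (\<Sum>e'\<in>edges G. if e' = e then bend_at (len G e) (\<phi> e) x else 0)"
        unfolding ord by (intro sum.cong) auto
      also have "\<dots> = ?w e x" using fin e bend by simp
      finally show ?thesis using Inner by simp
    next
      case (Vertex v)
      then have v: "v \<in> verts G" using p by (auto simp: points_def)
      have "(\<Sum>x\<in>?S e. bend_at (len G e) (\<phi> e) x) =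
          (if src G e = v then B e else 0) - (if tgt G e = v then B e + sum (?w e) (?Y e) else 0)"
        if e: "e \<in> edges G" for e
      proof -
        have "?S e = (if src G e = v then {0} else {}) \<union> (if tgt G e = v then {len G e} else {})"
          using Vertex len[OF e] by (auto simp: edge_point_def split: if_splits)
        then show ?thesis using len[OF e] bend0[OF e] bendL[OF e] by auto
      qed
      then have "ord_at G f p = (\<Sum>e\<in>edges G. if src G e = v then B e else 0) -
          (\<Sum>e\<in>edges G. if tgt G e = v then B e + sum (?w e) (?Y e) else 0)"
        unfolding ord by (simp add: sum_subtractf)
      also have "\<dots> = lookup D (Vertex v)"
        unfolding balance[OF v] using fin by (simp add: sum.inter_filter)
      finally show ?thesis using Vertex by simp
    qed
  qed
  ultimately show ?thesis unfolding principal_def using D by blast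
qed

section \<open>The Abel-Jacobi theorem for a chain of loops\<close>

lemma weight_add: "weight (D + E) h = weight D h + weight E h"
proof -
  let ?K = "keys D \<union> keys E"
  have "keys (D + E) \<subseteq> ?K" by (rule Poly_Mapping.keys_add)
  then show ?thesis
    using weight_superset[of ?K D h] weight_superset[of ?K E h] weight_superset[of ?K "D + E" h]
    by (simp add: lookup_add algebra_simps sum.distrib)
qed

lemma weight_cmul: "weight (frag_cmul c D) h = of_int c * weight D h"
proof -
  have "keys (frag_cmul c D) \<subseteq> keys D" by (rule keys_cmul)
  then show ?thesis
    using weight_superset[of "keys D" "frag_cmul c D" h]
    by (simp add: weight_def sum_distrib_left algebra_simps)
qed

lemma weight_frag_of [simp]: "weight (frag_of p) h = h p"
  by (simp add: weight_def)

lemma weight_zero [simp]: "weight 0 h = 0"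
  by (simp add: weight_def)

lemma weight_minus: "weight (D - E) h = weight D h - weight E h"
  using weight_add[of "D - E" E h] by simp

lemma weight_sum: "weight (\<Sum>i\<in>I. D i) h = (\<Sum>i\<in>I. weight (D i) h)"
  by (induction I rule: infinite_finite_induct) (simp_all add: weight_add)

lemma div_deg_weight: "of_int (div_deg D) = weight D (\<lambda>_. 1)"
  by (simp add: div_deg_def weight_def)

lemma div_deg_add: "div_deg (D + E) = div_deg D + div_deg E"
  using weight_add[of D E "\<lambda>_. 1"] unfolding div_deg_weight[symmetric]
  by (metis of_int_add of_int_eq_iff)

lemma div_deg_minus: "div_deg (D - E) = div_deg D - div_deg E"
  using div_deg_add[of "D - E" E] by simp

lemma div_deg_frag_of [simp]: "div_deg (frag_of p) = 1"
  by (simp add: div_deg_def)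

lemma div_deg_cmul: "div_deg (frag_cmul c D) = c * div_deg D"
  using weight_cmul[of c D "\<lambda>_. 1"] unfolding div_deg_weight[symmetric]
  by (metis of_int_mult of_int_eq_iff)

lemma div_deg_sum: "div_deg (\<Sum>i\<in>I. D i) = (\<Sum>i\<in>I. div_deg (D i))"
  by (induction I rule: infinite_finite_induct) (simp_all add: div_deg_add, simp_all add: div_deg_def)

lemma sum_up_to:
  fixes f :: "nat \<Rightarrow> real"
  assumes "j \<in> {1..g}" "\<And>i. i \<in> {j<..g} \<Longrightarrow> f i = 0"
  shows "(\<Sum>i\<in>{1..g}. f i) = (\<Sum>i\<in>{1..<j}. f i) + f j"
proof -
  have "(\<Sum>i\<in>{1..g}. f i) = (\<Sum>i\<in>{1..<Suc j}. f i)"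
    using assms by (intro sum.mono_neutral_right) auto
  then show ?thesis using assms(1) by simp
qed

lemma divisors_closed:
  "D \<in> divisors G \<Longrightarrow> E \<in> divisors G \<Longrightarrow> D + E \<in> divisors G"
  "D \<in> divisors G \<Longrightarrow> E \<in> divisors G \<Longrightarrow> D - E \<in> divisors G"
  "D \<in> divisors G \<Longrightarrow> frag_cmul c D \<in> divisors G"
  "p \<in> points G \<Longrightarrow> frag_of p \<in> divisors G"
  "0 \<in> divisors G"
  using Poly_Mapping.keys_add[of D E] keys_diff[of D E] keys_cmul[of c D]
  by (auto simp: divisors_def)

lemma divisors_sum: "(\<And>i. i \<in> I \<Longrightarrow> D i \<in> divisors G) \<Longrightarrow> (\<Sum>i\<in>I. D i) \<in> divisors G"
  by (induction I rule: infinite_finite_induct) (auto intro: divisors_closed)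

text \<open>
  Interior points of the bridge after loop \<open>j\<close> are counted with loop
  \<open>j\<close>; its righthand vertex is the point of the loop to which they retract.
\<close>

fun loop_of :: "(chain_vertex, chain_edge) point \<Rightarrow> nat" where
  "loop_of (Vertex (Lefthand j)) = j"
| "loop_of (Vertex (Righthand j)) = j"
| "loop_of (Inner (Top j) x) = j"
| "loop_of (Inner (Bottom j) x) = j"
| "loop_of (Inner (Bridge j) x) = j"

text \<open>
  The distance from the righthand vertex in the counterclockwise direction; the lefthand vertex
  is at \<open>top_len \<Gamma> j\<close>, since the top edge comes first.
\<close>

fun place :: "loop_chain \<Rightarrow> (chain_vertex, chain_edge) point \<Rightarrow> real" where
  "place \<Gamma> (Vertex (Lefthand j)) = top_len \<Gamma> j"
| "place \<Gamma> (Vertex (Righthand j)) = 0"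
| "place \<Gamma> (Inner (Top j) x) = x"
| "place \<Gamma> (Inner (Bottom j) x) = top_len \<Gamma> j + x"
| "place \<Gamma> (Inner (Bridge j) x) = 0"

definition retract :: "loop_chain \<Rightarrow> nat \<Rightarrow> (chain_vertex, chain_edge) point \<Rightarrow> real" where
  "retract \<Gamma> j p = (if loop_of p < j then top_len \<Gamma> j else if j < loop_of p then 0 else place \<Gamma> p)"

abbreviation circ :: "loop_chain \<Rightarrow> nat \<Rightarrow> real" where
  "circ \<Gamma> j \<equiv> top_len \<Gamma> j + bottom_len \<Gamma> j"

text \<open>
  The component at loop \<open>j\<close> of the Abel-Jacobi map; it is meaningful modulo
  \<open>circ \<Gamma> j\<close> only.
\<close>

definition jacobian :: "loop_chain \<Rightarrow> nat \<Rightarrow> (chain_vertex, chain_edge) divisor \<Rightarrow> real" where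
  "jacobian \<Gamma> j D = weight D (retract \<Gamma> j)"

lemma chain_graph_simps [simp]:
  "src (chain_graph \<Gamma>) = chain_src" "tgt (chain_graph \<Gamma>) = chain_tgt" "len (chain_graph \<Gamma>) = chain_len \<Gamma>"
  "edges (chain_graph \<Gamma>) = Top ` {1..genus \<Gamma>} \<union> Bottom ` {1..genus \<Gamma>} \<union> Bridge ` {1..<genus \<Gamma>}"
  "verts (chain_graph \<Gamma>) = Lefthand ` {1..genus \<Gamma>} \<union> Righthand ` {1..genus \<Gamma>}"
  by (simp_all add: chain_graph_def)

locale chain =
  fixes \<Gamma> :: loop_chain
  assumes chain: "chain_of_loops \<Gamma>"
begin

abbreviation "g \<equiv> genus \<Gamma>"
abbreviation "G \<equiv> chain_graph \<Gamma>"
abbreviation "\<sigma> \<equiv> top_len \<Gamma>"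
abbreviation "\<mu> \<equiv> bottom_len \<Gamma>"
abbreviation "J \<equiv> jacobian \<Gamma>"

lemma lens: "j \<in> {1..g} \<Longrightarrow> 0 < \<sigma> j" "j \<in> {1..g} \<Longrightarrow> 0 < \<mu> j"
  "j \<in> {1..<g} \<Longrightarrow> 0 < bridge_len \<Gamma> j"
  using chain by (simp_all add: chain_of_loops_def)

lemma wf: "wf_graph G"
  unfolding wf_graph_def by (auto simp: lens)

lemma retract_edge:
  assumes "e \<in> edges G" "0 \<le> x" "x \<le> len G e" and j: "j \<in> {1..g}"
  shows "retract \<Gamma> j (edge_point G e x) =
    (if loop_of (Inner e 0) < j \<or> e = Bottom j then \<sigma> j else 0) +
    (if e = Top j \<or> e = Bottom j then 1 else 0) * x +
    of_int (if e = Bottom j \<and> x = \<mu> j then - 1 else 0) * circ \<Gamma> j"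
proof (cases e)
  case (Bridge i)
  then have i: "1 \<le> i" "i < g" "0 < bridge_len \<Gamma> i" using assms(1) lens(3)[of i] by auto
  consider "Suc i < j" | "Suc i = j" | "j \<le> i" by linarith
  then show ?thesis using Bridge i by cases (auto simp: edge_point_def retract_def)
qed (use assms lens(1,2)[OF j] in \<open>auto simp: edge_point_def retract_def\<close>)

text \<open>
  The retraction has slope \<open>1\<close> along the two edges of loop \<open>j\<close> and is
  constant on all others, so the pairing with the divisor of \<open>f\<close> is the total
  increment of \<open>f\<close> around the loop, which is \<open>0\<close>.
\<close>

lemma principal_jacobian:
  assumes "principal G D" and j: "j \<in> {1..g}"
  shows "[J j D = 0] (rmod circ \<Gamma> j)"
proof -
  obtain f where D: "D \<in> divisors G" and f: "rational_function G f"
    and ord: "\<And>p. p \<in> points G \<Longrightarrow> lookup D p = ord_at G f p"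
    using assms(1) unfolding principal_def by blast
  let ?\<beta> = "\<lambda>e. if e = Top j \<or> e = Bottom j then 1 else 0 :: real"
  let ?\<Delta> = "\<lambda>e. f (Vertex (tgt G e)) - f (Vertex (src G e))"
  obtain N :: int where "weight D (retract \<Gamma> j) = of_int N * circ \<Gamma> j - (\<Sum>e\<in>edges G. ?\<beta> e * ?\<Delta> e)"
    using weight_principal[OF wf D f ord retract_edge[OF _ _ _ j]] by blast
  moreover have "(\<Sum>e\<in>edges G. ?\<beta> e * ?\<Delta> e) = (\<Sum>e\<in>{Top j, Bottom j}. ?\<beta> e * ?\<Delta> e)"
    using j by (intro sum.mono_neutral_right) auto
  moreover have "\<dots> = 0" by simp
  ultimately have "0 = J j D + of_int (- N) * circ \<Gamma> j" by (simp add: jacobian_def)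
  then show ?thesis unfolding rcong_altdef by blast
qed

lemma principal_degree:
  assumes "principal G D" shows "div_deg D = 0"
proof -
  obtain f where D: "D \<in> divisors G" and f: "rational_function G f"
    and ord: "\<And>p. p \<in> points G \<Longrightarrow> lookup D p = ord_at G f p"
    using assms(1) unfolding principal_def by blast
  have "\<exists>N::int. weight D (\<lambda>_. 1) = of_int N * 0 - (\<Sum>e\<in>edges G. 0 * (f (Vertex (tgt G e)) - f (Vertex (src G e))))"
    by (rule weight_principal[OF wf D f ord, where \<alpha> = "\<lambda>_. 1" and n = "\<lambda>_ _. 0"]) auto
  then show ?thesis unfolding div_deg_weight[symmetric] by simp
qed

definition local_weight :: "(chain_vertex, chain_edge) divisor \<Rightarrow> nat \<Rightarrow> ((chain_vertex, chain_edge) point \<Rightarrow> real) \<Rightarrow> real" where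
  "local_weight D i h =
     of_int (lookup D (Vertex (Lefthand i))) * h (Vertex (Lefthand i)) +
     of_int (lookup D (Vertex (Righthand i))) * h (Vertex (Righthand i)) +
     (\<Sum>y\<in>inner_support D (Top i). of_int (inner_coeff D (Top i) y) * h (Inner (Top i) y)) +
     (\<Sum>y\<in>inner_support D (Bottom i). of_int (inner_coeff D (Bottom i) y) * h (Inner (Bottom i) y)) +
     (\<Sum>y\<in>inner_support D (Bridge i). of_int (inner_coeff D (Bridge i) y) * h (Inner (Bridge i) y))"

lemma loop_of_range: "p \<in> points G \<Longrightarrow> loop_of p \<in> {1..g}"
  by (auto simp: points_def)

lemma weight_local:
  assumes D: "D \<in> divisors G"
  shows "weight D h = (\<Sum>i\<in>{1..g}. local_weight D i h)"
proof -
  let ?t = "\<lambda>p. of_int (lookup D p) * h p"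
  have "weight D h = (\<Sum>i\<in>{1..g}. \<Sum>p\<in>{p\<in>keys D. loop_of p = i}. ?t p)"
    unfolding weight_def
    by (rule sum.group[symmetric]) (use D loop_of_range in \<open>auto simp: divisors_def\<close>)
  also have "\<dots> = (\<Sum>i\<in>{1..g}. local_weight D i h)"
  proof (rule sum.cong[OF refl])
    fix i
    let ?V = "{Vertex (Lefthand i), Vertex (Righthand i)} :: (chain_vertex, chain_edge) point set"
    let ?I = "\<lambda>e. Inner e ` inner_support D e"
    let ?K = "?V \<union> (?I (Top i) \<union> (?I (Bottom i) \<union> ?I (Bridge i)))"
    have sub: "{p\<in>keys D. loop_of p = i} \<subseteq> ?K"
    proof
      fix p assume p: "p \<in> {p\<in>keys D. loop_of p = i}"
      show "p \<in> ?K"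
      proof (cases p)
        case (Vertex v) then show ?thesis using p by (cases v) auto
      next
        case (Inner e x) then show ?thesis using p by (cases e) (auto simp: inner_support_def)
      qed
    qed
    have fin: "finite (?I e)" for e by (simp add: finite_inner_support)
    have loop: "loop_of p = i" if "p \<in> ?K" for p using that by auto
    have "(\<Sum>p\<in>{p\<in>keys D. loop_of p = i}. ?t p) = sum ?t ?K"
      using sub loop fin by (intro sum.mono_neutral_left) (auto simp: in_keys_iff)
    also have "\<dots> = sum ?t ?V + (sum ?t (?I (Top i)) + (sum ?t (?I (Bottom i)) + sum ?t (?I (Bridge i))))"
      using fin by (subst sum.union_disjoint, force, force, force)+ simp
    also have "\<dots> = local_weight D i h"
      by (simp add: local_weight_def sum.reindex inj_on_def)
    finally show "(\<Sum>p\<in>{p\<in>keys D. loop_of p = i}. ?t p) = local_weight D i h" .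
  qed
  finally show ?thesis .
qed

text \<open>
  The converse half of the Abel-Jacobi theorem. The balance conditions fix the slopes of a
  function with divisor \<open>D\<close> on the bridges (the degree of \<open>D\<close> to the
  left of the point) and fix those on loop \<open>j\<close> up to one integer. The function
  closes up around the loop for exactly one real value of this parameter, and that value is an
  integer because \<open>jacobian \<Gamma> j D\<close> is a multiple of the circumference.
\<close>

theorem principal_if_jacobian:
  assumes D: "D \<in> divisors G" and deg: "div_deg D = 0"
    and jac: "\<And>j. j \<in> {1..g} \<Longrightarrow> [J j D = 0] (rmod circ \<Gamma> j)"
  shows "principal G D"
proof -
  let ?Y = "inner_support D" and ?w = "inner_coeff D"
  let ?L = "\<lambda>j. lookup D (Vertex (Lefthand j))"
  let ?R = "\<lambda>j. lookup D (Vertex (Righthand j))"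
  define W where "W e = (\<Sum>y\<in>?Y e. ?w e y)" for e
  define S where "S e = (\<Sum>y\<in>?Y e. of_int (?w e y) * y)" for e
  define l where "l i = ?L i + ?R i + W (Top i) + W (Bottom i) + W (Bridge i)" for i
  define N where "N j = (\<Sum>i\<in>{1..<j}. l i)" for j
  have rW: "(\<Sum>y\<in>?Y e. of_int (?w e y)) = real_of_int (W e)" for e by (simp add: W_def)
  have l1: "local_weight D i (\<lambda>_. 1) = of_int (l i)" for i
    by (simp add: local_weight_def l_def rW)
  have Ntotal: "N (Suc g) = 0"
  proof -
    have "real_of_int (N (Suc g)) = weight D (\<lambda>_. 1)"
      unfolding weight_local[OF D] l1 N_def by (simp add: atLeastLessThanSuc_atLeastAtMost)
    then show ?thesis using deg unfolding div_deg_weight[symmetric] by simp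
  qed
  have NSuc: "N (Suc j) = N j + l j" if "1 \<le> j" for j
    using that by (simp add: N_def)
  have jacval: "J j D = of_int (N j + ?L j + W (Bottom j)) * \<sigma> j + S (Top j) + S (Bottom j)"
    if j: "j \<in> {1..g}" for j
  proof -
    have before: "local_weight D i (retract \<Gamma> j) = of_int (l i) * \<sigma> j" if "i < j" for i
    proof -
      have "local_weight D i (retract \<Gamma> j) = local_weight D i (\<lambda>_. 1) * \<sigma> j"
        using that by (simp add: local_weight_def retract_def sum_distrib_right distrib_right)
      then show ?thesis by (simp add: l1)
    qed
    have after: "local_weight D i (retract \<Gamma> j) = 0" if "j < i" for i
      using that by (simp add: local_weight_def retract_def)
    have at: "local_weight D j (retract \<Gamma> j) =
        of_int (?L j + W (Bottom j)) * \<sigma> j + S (Top j) + S (Bottom j)"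
      by (simp add: local_weight_def retract_def S_def sum.distrib distrib_left distrib_right
          rW[symmetric] sum_distrib_right)
    have "J j D = (\<Sum>i\<in>{1..<j}. local_weight D i (retract \<Gamma> j)) + local_weight D j (retract \<Gamma> j)"
      unfolding jacobian_def weight_local[OF D] using after by (intro sum_up_to[OF j]) auto
    also have "(\<Sum>i\<in>{1..<j}. local_weight D i (retract \<Gamma> j)) = (\<Sum>i\<in>{1..<j}. of_int (l i) * \<sigma> j)"
      using before by (intro sum.cong) auto
    also have "(\<Sum>i\<in>{1..<j}. of_int (l i) * \<sigma> j) = of_int (N j) * \<sigma> j"
      by (simp add: N_def sum_distrib_right)
    finally show ?thesis using at by (simp add: algebra_simps)
  qed
  have "\<exists>n::int. J j D = of_int n * circ \<Gamma> j" if "j \<in> {1..g}" for j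
  proof -
    from jac[OF that] obtain n :: int where "0 = J j D + of_int n * circ \<Gamma> j"
      unfolding rcong_altdef by blast
    then have "J j D = of_int (- n) * circ \<Gamma> j" by simp
    then show ?thesis by blast
  qed
  then obtain n :: "nat \<Rightarrow> int" where n: "\<And>j. j \<in> {1..g} \<Longrightarrow> J j D = of_int (n j) * circ \<Gamma> j"
    by metis
  \<comment> \<open>The slopes at the start of the edges. The multiple \<open>n j\<close> is what makes the increments along the
    two edges of loop \<open>j\<close> cancel.\<close>
  define B where "B e = (case e of Top j \<Rightarrow> n j - (W (Top j) + ?L j + N j + W (Bottom j))
    | Bottom j \<Rightarrow> n j - W (Bottom j) | Bridge j \<Rightarrow> N (Suc j) - W (Bridge j))" for e
  define \<Delta> where "\<Delta> e = of_int (B e) * chain_len \<Gamma> e + (\<Sum>y\<in>?Y e. of_int (?w e y) * (chain_len \<Gamma> e - y))" for e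
  have \<Delta>: "\<Delta> e = of_int (B e + W e) * chain_len \<Gamma> e - S e" for e
    by (simp add: \<Delta>_def S_def rW[symmetric] right_diff_distrib sum_subtractf sum_distrib_right distrib_right)
  define P where "P j = (\<Sum>i\<in>{1..<j}. \<Delta> (Bottom i) + \<Delta> (Bridge i))" for j
  define V where "V v = (case v of Lefthand j \<Rightarrow> P j | Righthand j \<Rightarrow> P j + \<Delta> (Bottom j))" for v
  have closed: "\<Delta> (Top j) + \<Delta> (Bottom j) = 0" if "j \<in> {1..g}" for j
    using jacval[OF that] n[OF that] by (simp add: \<Delta> B_def algebra_simps)
  \<comment> \<open>There is no bridge after the last loop, so there the degree of \<open>D\<close> has to provide the balance.\<close>
  have no_last: "W (Bridge g) = 0"
  proof -
    have "?Y (Bridge g) = {}" using D by (auto simp: inner_support_def divisors_def points_def)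
    then show ?thesis by (simp add: W_def)
  qed
  show ?thesis
  proof (rule principalI[OF wf D, where B = B and V = V])
    fix e assume "e \<in> edges G"
    then show "V (tgt G e) = V (src G e) + of_int (B e) * len G e +
        (\<Sum>y\<in>?Y e. of_int (?w e y) * (len G e - y))"
      using closed by (auto simp: V_def P_def \<Delta>_def[symmetric] algebra_simps) (simp_all add: \<Delta>_def algebra_simps)
  next
    fix v assume "v \<in> verts G"
    then consider j where "j \<in> {1..g}" "v = Righthand j" | j where "j \<in> {1..g}" "v = Lefthand j" by auto
    then show "lookup D (Vertex v) = (\<Sum>e\<in>{e\<in>edges G. src G e = v}. B e) -
        (\<Sum>e\<in>{e\<in>edges G. tgt G e = v}. B e + (\<Sum>y\<in>?Y e. ?w e y))"
    proof cases
      case 1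
      have out: "{e\<in>edges G. src G e = v} = insert (Top j) (if j < g then {Bridge j} else {})"
        using 1 by auto
      have inn: "{e\<in>edges G. tgt G e = v} = {Bottom j}" using 1 by auto
      show ?thesis
      proof (cases "j < g")
        case True
        then show ?thesis unfolding out inn W_def[symmetric] using 1 NSuc[of j] by (simp add: B_def l_def)
      next
        case False
        then have "j = g" using 1 by simp
        then show ?thesis unfolding out inn W_def[symmetric] using 1 NSuc[of g] Ntotal no_last by (simp add: B_def l_def)
      qed
    next
      case 2
      have out: "{e\<in>edges G. src G e = v} = {Bottom j}" using 2 by auto
      show ?thesis
      proof (cases "j = 1")
        case True
        have inn: "{e\<in>edges G. tgt G e = v} = {Top j}" using 2 True by auto
        show ?thesis unfolding out inn W_def[symmetric] using 2 True by (simp add: B_def N_def)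
      next
        case False
        then obtain i where i: "j = Suc i" "1 \<le> i" using 2 by (cases j) auto
        have inn: "{e\<in>edges G. tgt G e = v} = {Top j, Bridge i}" using 2 i by auto
        show ?thesis unfolding out inn W_def[symmetric] using 2 i by (simp add: B_def)
      qed
    qed
  qed
qed

theorem lin_equiv_iff:
  "(D, E) \<in> lin_equiv G \<longleftrightarrow> D \<in> divisors G \<and> E \<in> divisors G \<and> div_deg D = div_deg E \<and>
     (\<forall>j\<in>{1..g}. [J j D = J j E] (rmod circ \<Gamma> j))"
proof -
  have diff: "[J j (D - E) = 0] (rmod circ \<Gamma> j) \<longleftrightarrow> [J j D = J j E] (rmod circ \<Gamma> j)" for j
    by (simp add: rcong_conv_diff_rmod_eq_0 jacobian_def weight_minus)
  show ?thesis
  proof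
    assume "(D, E) \<in> lin_equiv G"
    then have *: "D \<in> divisors G" "E \<in> divisors G" "principal G (D - E)" by (auto simp: lin_equiv_def)
    then show "D \<in> divisors G \<and> E \<in> divisors G \<and> div_deg D = div_deg E \<and>
     (\<forall>j\<in>{1..g}. [J j D = J j E] (rmod circ \<Gamma> j))"
      using principal_degree[OF *(3)] principal_jacobian[OF *(3)] diff by (simp add: div_deg_minus)
  next
    assume *: "D \<in> divisors G \<and> E \<in> divisors G \<and> div_deg D = div_deg E \<and>
     (\<forall>j\<in>{1..g}. [J j D = J j E] (rmod circ \<Gamma> j))"
    then have "principal G (D - E)"
      by (intro principal_if_jacobian) (auto simp: div_deg_minus divisors_closed diff)
    then show "(D, E) \<in> lin_equiv G" using * by (simp add: lin_equiv_def)
  qed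
qed

lemma circ_pos: "j \<in> {1..g} \<Longrightarrow> 0 < circ \<Gamma> j"
  using lens[of j] by simp

lemma loop_point:
  assumes j: "j \<in> {1..g}"
  shows "loop_point \<Gamma> j \<xi> \<in> points G" "loop_of (loop_point \<Gamma> j \<xi>) = j"
    "place \<Gamma> (loop_point \<Gamma> j \<xi>) = (\<xi> * \<mu> j) rmod circ \<Gamma> j"
proof -
  define s where "s = (\<xi> * \<mu> j) rmod circ \<Gamma> j"
  have s: "circ \<Gamma> j * frac (\<xi> * \<mu> j / circ \<Gamma> j) = s"
    using circ_pos[OF j] by (simp add: s_def rmod_conv_frac)
  have r: "0 \<le> s" "s < circ \<Gamma> j" using circ_pos[OF j] by (simp_all add: s_def rmod_nonneg rmod_less)
  have p: "loop_point \<Gamma> j \<xi> = (if s < \<sigma> j then edge_point G (Top j) s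
      else edge_point G (Bottom j) (s - \<sigma> j))"
    unfolding loop_point_def Let_def s ..
  show "loop_point \<Gamma> j \<xi> \<in> points G"
    unfolding p using r j by (auto intro!: edge_point_in_points[OF wf])
  show "loop_of (loop_point \<Gamma> j \<xi>) = j"
    unfolding p by (simp add: edge_point_def)
  show "place \<Gamma> (loop_point \<Gamma> j \<xi>) = (\<xi> * \<mu> j) rmod circ \<Gamma> j"
    unfolding p s_def[symmetric] using r lens(1,2)[OF j] by (simp add: edge_point_def)
qed

lemma loop_point_eq_iff:
  assumes j: "j \<in> {1..g}"
  shows "loop_point \<Gamma> j \<xi> = loop_point \<Gamma> j \<eta> \<longleftrightarrow>
    [\<xi> * \<mu> j = \<eta> * \<mu> j] (rmod circ \<Gamma> j)"
proof
  assume "loop_point \<Gamma> j \<xi> = loop_point \<Gamma> j \<eta>"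
  then show "[\<xi> * \<mu> j = \<eta> * \<mu> j] (rmod circ \<Gamma> j)"
    using loop_point(3)[OF j] by (metis rcong_def)
next
  assume "[\<xi> * \<mu> j = \<eta> * \<mu> j] (rmod circ \<Gamma> j)"
  then have "frac (\<xi> * \<mu> j / circ \<Gamma> j) = frac (\<eta> * \<mu> j / circ \<Gamma> j)"
    using circ_pos[OF j] by (simp add: rcong_def rmod_conv_frac)
  then show "loop_point \<Gamma> j \<xi> = loop_point \<Gamma> j \<eta>" by (simp add: loop_point_def)
qed

lemma retract_loop_point:
  assumes "i \<in> {1..g}"
  shows "i < j \<Longrightarrow> retract \<Gamma> j (loop_point \<Gamma> i \<xi>) = \<sigma> j"
    "j < i \<Longrightarrow> retract \<Gamma> j (loop_point \<Gamma> i \<xi>) = 0"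
    "[retract \<Gamma> i (loop_point \<Gamma> i \<xi>) = \<xi> * \<mu> i] (rmod circ \<Gamma> i)"
  using loop_point[OF assms] by (simp_all add: retract_def rcong_def)

text \<open>
  The integers \<open>n\<close> for which \<open>n\<close> times the bottom length is a multiple
  of the circumference form a subgroup, generated by the torsion order; for an irrational ratio
  it is trivial, in accordance with congruence modulo \<open>0\<close> being equality.
\<close>

lemma torsion:
  assumes j: "j \<in> {1..g}"
  shows "[of_int u * \<mu> j = of_int v * \<mu> j] (rmod circ \<Gamma> j) \<longleftrightarrow>
    [u = v] (mod int (torsion_order \<Gamma> j))"
proof -
  let ?m = "\<mu> j" and ?c = "circ \<Gamma> j" and ?\<tau> = "torsion_order \<Gamma> j"
  have pos: "0 < ?m" "0 < ?c" using lens(1,2)[OF j] by simp_all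
  have key: "(\<exists>n::int. of_int z * ?m = of_int n * ?c) \<longleftrightarrow> int ?\<tau> dvd z" for z
  proof (cases "?c / ?m \<in> \<rat>")
    case False
    then have "?\<tau> = 0" by (simp add: torsion_order_def)
    moreover have "z = 0" if "of_int z * ?m = of_int n * ?c" for n :: int
    proof (rule ccontr)
      assume "z \<noteq> 0"
      then have "n \<noteq> 0" using that pos by auto
      then have "?c / ?m = of_int z / of_int n" using that pos by (simp add: field_simps)
      then show False using False by simp
    qed
    ultimately show ?thesis by auto
  next
    case True
    let ?P = "\<lambda>\<tau>::nat. 0 < \<tau> \<and> (\<exists>n::int. of_nat \<tau> * ?m = of_int n * ?c)"
    have \<tau>: "?\<tau> = (LEAST \<tau>. ?P \<tau>)" using True by (simp add: torsion_order_def)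
    obtain p q :: int where pq: "q > 0" "?c / ?m = of_int p / of_int q"
      using True by (metis Rats_cases')
    then have "p > 0" using pos by (metis divide_pos_pos of_int_0_less_iff zero_less_divide_iff not_less_iff_gr_or_eq)
    have "of_int p * ?m = of_int q * ?c" using pq pos by (simp add: field_simps)
    then have "?P (nat p)" using \<open>p > 0\<close> by auto
    then have P: "?P ?\<tau>" unfolding \<tau> by (rule LeastI)
    then obtain n0 :: int where n0: "of_nat ?\<tau> * ?m = of_int n0 * ?c" by blast
    show ?thesis
    proof
      assume "\<exists>n::int. of_int z * ?m = of_int n * ?c"
      then obtain n :: int where n: "of_int z * ?m = of_int n * ?c" by blast
      define r where "r = nat (z mod int ?\<tau>)"
      have r: "int r = z mod int ?\<tau>" using P by (simp add: r_def)
      have z: "z = (z div int ?\<tau>) * int ?\<tau> + int r" by (simp add: r)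
      have "real_of_int z = of_int (z div int ?\<tau>) * of_nat ?\<tau> + of_nat r"
        by (subst z) simp
      then have "of_nat r * ?m = of_int z * ?m - of_int (z div int ?\<tau>) * (of_nat ?\<tau> * ?m)"
        by (simp add: algebra_simps)
      also have "\<dots> = of_int (n - z div int ?\<tau> * n0) * ?c"
        unfolding n n0 by (simp add: algebra_simps)
      finally have "\<exists>n::int. of_nat r * ?m = of_int n * ?c" by blast
      moreover have "r < ?\<tau>"
      proof -
        have "int r < int ?\<tau>" unfolding r using P by (intro pos_mod_bound) simp
        then show ?thesis by simp
      qed
      ultimately have "r = 0" using not_less_Least[of r ?P] unfolding \<tau>[symmetric] by auto
      then show "int ?\<tau> dvd z" using r by (simp add: dvd_eq_mod_eq_0)
    next
      assume "int ?\<tau> dvd z"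
      then obtain q where "z = int ?\<tau> * q" by blast
      then have "of_int z * ?m = of_int (q * n0) * ?c" using n0 by (simp add: algebra_simps)
      then show "\<exists>n::int. of_int z * ?m = of_int n * ?c" by blast
    qed
  qed
  have "[of_int u * ?m = of_int v * ?m] (rmod ?c) \<longleftrightarrow> (\<exists>n::int. of_int v * ?m = of_int u * ?m + of_int n * ?c)"
    by (rule rcong_altdef)
  also have "\<dots> \<longleftrightarrow> (\<exists>n::int. of_int (v - u) * ?m = of_int n * ?c)"
    by (simp add: algebra_simps)
  also have "\<dots> \<longleftrightarrow> [v = u] (mod int ?\<tau>)" unfolding key cong_iff_dvd_diff ..
  finally show ?thesis by (simp add: cong_sym_eq)
qed

end

section \<open>Young diagrams as height functions\<close>

text \<open>
  A Young diagram, or more generally a lower set of boxes of the plane, is encoded by its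
  heights along the diagonals: the box \<open>(x, y)\<close> belongs to it iff \<open>x \<le> h
  (y - x)\<close>. Lower sets, other than the empty set and the whole plane, correspond to the
  functions that stay or drop by \<open>1\<close> at every step. In this encoding containment is
  the pointwise order, and the values \<open>h (D - 1) - h D\<close> form the bead sequence of
  the diagram.
\<close>

definition profile :: "(int \<Rightarrow> int) \<Rightarrow> bool" where
  "profile h \<longleftrightarrow> (\<forall>D. h (D + 1) \<le> h D \<and> h D \<le> h (D + 1) + 1)"

text \<open>
  Adding a box on each diagonal in \<open>A\<close> that admits one. A diagonal \<open>D\<close>
  admits one iff \<open>h (D - 1) = h D + 1\<close> and \<open>h (D + 1) = h D\<close>, and for
  a profile the minimum says the same without a case distinction. Dually, \<open>shrink\<close>
  below removes the removable boxes.
\<close>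

definition grow :: "(int \<Rightarrow> bool) \<Rightarrow> (int \<Rightarrow> int) \<Rightarrow> int \<Rightarrow> int" where
  "grow A h D = (if A D then min (h (D - 1)) (h (D + 1) + 1) else h D)"

definition shrink :: "(int \<Rightarrow> bool) \<Rightarrow> (int \<Rightarrow> int) \<Rightarrow> int \<Rightarrow> int" where
  "shrink A h D = (if A D then max (h (D - 1) - 1) (h (D + 1)) else h D)"

text \<open>
  The initial function encodes the empty diagram in the quadrant of boxes with positive
  coordinates: \<open>x \<le> max 0 (x - y)\<close> fails iff both are positive.
\<close>

fun grown :: "(nat \<Rightarrow> int \<Rightarrow> bool) \<Rightarrow> nat \<Rightarrow> int \<Rightarrow> int" where
  "grown A 0 = (\<lambda>D. max 0 (- D))"
| "grown A (Suc j) = grow (A (Suc j)) (grown A j)"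

lemma profileD:
  assumes "profile h"
  shows "h (D + 1) \<le> h D" "h D \<le> h (D + 1) + 1" "h D \<le> h (D - 1)" "h (D - 1) \<le> h D + 1"
  using assms[unfolded profile_def, rule_format, of D] assms[unfolded profile_def, rule_format, of "D - 1"]
  by auto

lemma profile_shift:
  assumes "profile h"
  shows "h D \<le> h (D - int n)" "h (D - int n) \<le> h D + int n"
proof -
  have "h D \<le> h (D - int n) \<and> h (D - int n) \<le> h D + int n"
  proof (induction n)
    case (Suc n)
    have "D - int (Suc n) = D - int n - 1" by simp
    then show ?case using Suc profileD(3,4)[OF assms, of "D - int n"] by (auto simp: algebra_simps)
  qed simp
  then show "h D \<le> h (D - int n)" "h (D - int n) \<le> h D + int n" by auto
qed

lemma profile_antimono: "profile h \<Longrightarrow> D \<le> E \<Longrightarrow> h E \<le> h D"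
  using profile_shift(1)[of h E "nat (E - D)"] by simp

lemma profile_grow:
  assumes "profile h" shows "profile (grow A h)"
  unfolding profile_def
proof
  fix D :: int
  have "D + 1 + 1 = D + 2" "D + 1 - 1 = D" "D + 2 - 1 = D + 1" by simp_all
  then show "grow A h (D + 1) \<le> grow A h D \<and> grow A h D \<le> grow A h (D + 1) + 1"
    using profileD[OF assms, of D] profileD[OF assms, of "D + 1"]
    by (auto simp: grow_def)
qed

lemma profile_shrink:
  assumes "profile h" shows "profile (shrink A h)"
  unfolding profile_def
proof
  fix D :: int
  have "D + 1 + 1 = D + 2" "D + 1 - 1 = D" "D + 2 - 1 = D + 1" by simp_all
  then show "shrink A h (D + 1) \<le> shrink A h D \<and> shrink A h D \<le> shrink A h (D + 1) + 1"
    using profileD[OF assms, of D] profileD[OF assms, of "D + 1"]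
    by (auto simp: shrink_def)
qed

lemma le_grow: "profile h \<Longrightarrow> h D \<le> grow A h D"
  using profileD[of h D] by (auto simp: grow_def)

lemma profile_grown: "profile (grown A j)"
proof (induction j)
  case 0
  then show ?case by (auto simp: profile_def)
next
  case (Suc j)
  then show ?case by (simp add: profile_grow)
qed

lemma grown_mono: "i \<le> j \<Longrightarrow> grown A i D \<le> grown A j D"
proof (induction j rule: dec_induct)
  case (step n)
  then show ?case using le_grow[OF profile_grown, of A n D "A (Suc n)"] by simp
qed simp

lemma grown_lower: "0 \<le> grown A j D" "- D \<le> grown A j D"
  using grown_mono[of 0 j A D] by simp_all

lemma grown_far:
  "int j \<le> D \<Longrightarrow> grown A j D = 0"
  "D \<le> - int j \<Longrightarrow> grown A j D = - D"
proof (induction j arbitrary: D)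
  case (Suc j)
  { case 1
    then show ?case using Suc.IH(1)[of D] Suc.IH(1)[of "D - 1"] Suc.IH(1)[of "D + 1"]
      by (auto simp: grow_def) }
  { case 2
    then show ?case using Suc.IH(2)[of D] Suc.IH(2)[of "D - 1"] Suc.IH(2)[of "D + 1"]
      by (auto simp: grow_def) }
qed auto

text \<open>
  Growing is greedy: when the entry \<open>t x y\<close> is reached, the boxes to the left of
  and below \<open>(x, y)\<close> are present by induction, hence \<open>(x, y)\<close> is
  present already or is addable.
\<close>

lemma tableau_le_grown:
  assumes t: "tableau a b g t"
    and A: "\<And>x y. x \<in> {1..a} \<Longrightarrow> y \<in> {1..b} \<Longrightarrow> A (t x y) (int y - int x)"
    and "x \<in> {1..a}" "y \<in> {1..b}" "t x y \<le> j"
  shows "int x \<le> grown A j (int y - int x)"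
  using assms(3-5)
proof (induction j arbitrary: x y)
  case 0
  then have "t x y \<in> {1..g}" using t unfolding tableau_def by blast
  then show ?case using 0 by simp
next
  case (Suc j)
  let ?h = "grown A j" and ?D = "int y - int x"
  show ?case
  proof (cases "t x y \<le> j")
    case True
    then show ?thesis using Suc grown_mono[of j "Suc j" A ?D] by fastforce
  next
    case False
    then have j: "t x y = Suc j" using Suc by simp
    have "int x \<le> ?h (?D - 1)"
    proof (cases "y = 1")
      case True
      then show ?thesis using grown_lower(2)[of "?D - 1" A j] by simp
    next
      case False
      then have "y - 1 \<in> {1..b}" "y = Suc (y - 1)" using Suc.prems by auto
      moreover from this have "t x (y - 1) < t x y"
        using t Suc.prems unfolding tableau_def by (metis Suc_le_lessD atLeastAtMost_iff)
      ultimately have "int x \<le> ?h (int (y - 1) - int x)"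
        using Suc.IH[of x "y - 1"] Suc.prems j by simp
      moreover have "int (y - 1) - int x = ?D - 1" using \<open>y = Suc (y - 1)\<close> by linarith
      ultimately show ?thesis by metis
    qed
    moreover have "int x \<le> ?h (?D + 1) + 1"
    proof (cases "x = 1")
      case True
      then show ?thesis using grown_lower(1)[of A j "?D + 1"] by simp
    next
      case False
      then have "x - 1 \<in> {1..a}" "x = Suc (x - 1)" using Suc.prems by auto
      moreover from this have "t (x - 1) y < t x y"
        using t Suc.prems unfolding tableau_def by (metis Suc_le_lessD atLeastAtMost_iff)
      ultimately have "int (x - 1) \<le> ?h (int y - int (x - 1))"
        using Suc.IH[of "x - 1" y] Suc.prems j by simp
      moreover have "int y - int (x - 1) = ?D + 1" "int x = int (x - 1) + 1"
        using \<open>x = Suc (x - 1)\<close> by linarith+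
      ultimately show ?thesis by (metis add_right_mono)
    qed
    moreover have "A (Suc j) ?D" using A[OF Suc.prems(1,2)] j by simp
    ultimately show ?thesis by (simp add: grow_def)
  qed
qed

definition entry_time :: "(nat \<Rightarrow> int \<Rightarrow> int) \<Rightarrow> nat \<Rightarrow> nat \<Rightarrow> nat" where
  "entry_time h x y = (LEAST j. int x \<le> h j (int y - int x))"

lemma profile_box:
  assumes "profile h" "int x0 \<le> h (int y0 - int x0)" "x \<le> x0" "y \<le> y0"
  shows "int x \<le> h (int y - int x)"
proof -
  define n where "n = x0 - x"
  have x0: "int x0 = int x + int n" using assms(3) by (simp add: n_def)
  have "int x \<le> h (int y0 - int x0) - int n" using assms(2) x0 by simp
  also have "\<dots> \<le> h (int y0 - int x0 + int n)"
    using profile_shift(2)[OF assms(1), of "int y0 - int x0 + int n" n] by simp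
  also have "\<dots> \<le> h (int y - int x)"
    using assms(4) x0 by (intro profile_antimono[OF assms(1)]) linarith
  finally show ?thesis .
qed

text \<open>
  A sequence of lower sets, empty in the positive quadrant at time \<open>0\<close> and
  containing the rectangle at time \<open>g\<close>, in which a box enters only on an allowed
  diagonal and only after its two predecessors. The entry times of the boxes form a tableau.
  Both directions of growth are instances: adding boxes greedily forwards and removing them
  greedily backwards.
\<close>

locale growth =
  fixes h :: "nat \<Rightarrow> int \<Rightarrow> int" and A :: "nat \<Rightarrow> int \<Rightarrow> bool" and a b g :: nat
  assumes profile: "\<And>j. profile (h j)"
    and initial: "\<And>D. h 0 D \<le> max 0 (- D)"
    and final: "int a \<le> h g (int b - int a)"
    and step: "\<And>j D x. j < g \<Longrightarrow> h j D < x \<Longrightarrow> x \<le> h (Suc j) D \<Longrightarrow>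
      A (Suc j) D \<and> x \<le> h j (D - 1) \<and> x - 1 \<le> h j (D + 1)"
begin

lemma entry:
  assumes "x \<in> {1..a}" "y \<in> {1..b}"
  obtains j where "entry_time h x y = Suc j" "j < g"
    "h j (int y - int x) < int x" "int x \<le> h (Suc j) (int y - int x)"
proof -
  let ?P = "\<lambda>j. int x \<le> h j (int y - int x)"
  have g: "?P g" by (rule profile_box[OF profile final]) (use assms in auto)
  have 0: "\<not> ?P 0" using initial[of "int y - int x"] assms by auto
  have P: "?P (entry_time h x y)" unfolding entry_time_def by (rule LeastI[of ?P, OF g])
  then obtain j where j: "entry_time h x y = Suc j" using 0 by (cases "entry_time h x y") auto
  have "entry_time h x y \<le> g" unfolding entry_time_def by (rule Least_le[of ?P, OF g])
  then have jg: "j < g" using j by simp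
  have "\<not> ?P j"
  proof
    assume "?P j"
    then have "entry_time h x y \<le> j" unfolding entry_time_def by (rule Least_le)
    then show False using j by simp
  qed
  then have lt: "h j (int y - int x) < int x" by (rule not_le_imp_less)
  have "?P (Suc j)" using P unfolding j .
  from that[OF j jg lt this] show ?thesis .
qed

lemma entry_le: "int x \<le> h j (int y - int x) \<Longrightarrow> entry_time h x y \<le> j"
  unfolding entry_time_def by (rule Least_le[where P = "\<lambda>j. int x \<le> h j (int y - int x)"])

lemma entry_label:
  assumes "x \<in> {1..a}" "y \<in> {1..b}"
  shows "A (entry_time h x y) (int y - int x)"
proof -
  obtain j where j: "entry_time h x y = Suc j" "j < g"
    "h j (int y - int x) < int x" "int x \<le> h (Suc j) (int y - int x)"
    by (rule entry[OF assms])
  then show ?thesis using step[OF j(2-4)] by simp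
qed

lemma tableau_entry_time: "tableau a b g (entry_time h)"
  unfolding tableau_def
proof (intro ballI conjI impI)
  fix x y assume xy: "x \<in> {1..a}" "y \<in> {1..b}"
  show "entry_time h x y \<in> {1..g}" by (rule entry[OF xy]) simp
  {
    assume "y < b"
    then have "Suc y \<in> {1..b}" by simp
    then obtain j where j: "entry_time h x (Suc y) = Suc j" "j < g"
      "h j (int (Suc y) - int x) < int x" "int x \<le> h (Suc j) (int (Suc y) - int x)"
      by (rule entry[OF xy(1)])
    from step[OF j(2-4)] have "entry_time h x y \<le> j" by (intro entry_le) simp
    then show "entry_time h x y < entry_time h x (Suc y)" using j by simp
  }
  {
    assume "x < a"
    then have "Suc x \<in> {1..a}" by simp
    then obtain j where j: "entry_time h (Suc x) y = Suc j" "j < g"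
      "h j (int y - int (Suc x)) < int (Suc x)" "int (Suc x) \<le> h (Suc j) (int y - int (Suc x))"
      by (rule entry[OF _ xy(2)])
    from step[OF j(2-4)] have "entry_time h x y \<le> j"
      by (intro entry_le) (simp add: algebra_simps)
    then show "entry_time h x y < entry_time h (Suc x) y" using j by simp
  }
qed

end

lemma growth_grown:
  assumes "int a \<le> grown A g (int b - int a)"
  shows "growth (grown A) A a b g"
proof
  show "profile (grown A j)" for j by (rule profile_grown)
  show "A (Suc j) D \<and> x \<le> grown A j (D - 1) \<and> x - 1 \<le> grown A j (D + 1)"
    if "grown A j D < x" "x \<le> grown A (Suc j) D" for j D x
    using that by (auto simp: grow_def split: if_splits)
qed (use assms in auto)

section \<open>Peeling, cores and periodic staircases\<close>

text \<open>
  The step that makes peeling work: if \<open>H\<close> lies below \<open>h\<close> after some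
  boxes were added to \<open>h\<close>, then a box of \<open>H\<close> outside \<open>h\<close>
  was just added, so it is a corner of the larger diagram and a fortiori of \<open>H\<close>,
  and removing all corners of \<open>H\<close> on the diagonals in question removes it.
\<close>

lemma shrink_le_if_le_grow:
  assumes "profile h" and A: "\<And>D. A D \<Longrightarrow> \<not> A (D + 1)"
    and le: "\<And>D. H D \<le> grow A h D"
  shows "shrink A H D \<le> h D"
proof (cases "A D")
  case True
  then have "\<not> A (D + 1)" "\<not> A (D - 1)" using A[of D] A[of "D - 1"] by auto
  then have "H (D + 1) \<le> h (D + 1)" "H (D - 1) \<le> h (D - 1)"
    using le[of "D + 1"] le[of "D - 1"] by (auto simp: grow_def)
  then show ?thesis using True profileD[OF assms(1), of D] by (simp add: shrink_def)
next
  case False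
  then show ?thesis using le[of D] by (simp add: shrink_def grow_def)
qed

text \<open>
  \<open>k\<close>-cores: if there is a bead at \<open>D\<close>, then there is one at \<open>D
  - k\<close>.
\<close>

definition core :: "nat \<Rightarrow> (int \<Rightarrow> int) \<Rightarrow> bool" where
  "core k h \<longleftrightarrow> (\<forall>D. h (D - 1) - h D \<le> h (D - 1 - int k) - h (D - int k))"

text \<open>
  Adding all addable boxes of one residue modulo \<open>k\<close> moves beads from one residue
  class to the next wherever the target is free, which keeps both classes closed under
  subtraction of \<open>k\<close>.
\<close>

lemma core_grow:
  assumes "profile h" "core k h" and per: "\<And>D. A (D - int k) \<longleftrightarrow> A D"
    and A: "\<And>D. A D \<Longrightarrow> \<not> A (D + 1)"
  shows "core k (grow A h)"
  unfolding core_def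
proof
  fix D :: int
  let ?E = "D - int k"
  have s: "D - 1 - 1 = D - 2" "D - 1 + 1 = D" "?E - 1 - 1 = ?E - 2" "?E - 1 + 1 = ?E"
    "D - 1 - int k = ?E - 1" "D - 2 - int k = ?E - 2" "D + 1 - int k = ?E + 1" by auto
  have c: "h (D - 1) - h D \<le> h (?E - 1) - h ?E"
    "h (D - 2) - h (D - 1) \<le> h (?E - 2) - h (?E - 1)"
    "h D - h (D + 1) \<le> h ?E - h (?E + 1)"
    using assms(2)[unfolded core_def, rule_format, of D]
      assms(2)[unfolded core_def, rule_format, of "D - 1"]
      assms(2)[unfolded core_def, rule_format, of "D + 1"] s by simp_all
  have p: "h D \<le> h (D - 1)" "h (D - 1) \<le> h D + 1" "h (D + 1) \<le> h D" "h D \<le> h (D + 1) + 1"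
     "h (D - 1) \<le> h (D - 2)" "h (D - 2) \<le> h (D - 1) + 1"
    using profileD[OF assms(1), of D] profileD[OF assms(1), of "D - 1"] s by simp_all
  have q: "h ?E \<le> h (?E - 1)" "h (?E - 1) \<le> h ?E + 1" "h (?E + 1) \<le> h ?E" "h ?E \<le> h (?E + 1) + 1"
     "h (?E - 1) \<le> h (?E - 2)" "h (?E - 2) \<le> h (?E - 1) + 1"
    using profileD[OF assms(1), of ?E] profileD[OF assms(1), of "?E - 1"] s by simp_all
  have nA: "\<not> (A D \<and> A (D - 1))" using A[of "D - 1"] by auto
  show "grow A h (D - 1) - grow A h D \<le> grow A h (D - 1 - int k) - grow A h (D - int k)"
  proof (cases "A D")
    case True
    then have A': "\<not> A (D - 1)" "A ?E" "\<not> A (?E - 1)" using nA per[of D] per[of "D - 1"] s by simp_all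
    have "h (D - 1) - min (h (D - 1)) (h (D + 1) + 1) \<le> h (?E - 1) - min (h (?E - 1)) (h (?E + 1) + 1)"
      using c(1,3) p(1-4) q(1-4) by linarith
    then show ?thesis using True A' by (simp add: grow_def s)
  next
    case nD: False
    show ?thesis
    proof (cases "A (D - 1)")
      case True
      then have A': "\<not> A D" "\<not> A ?E" "A (?E - 1)" using nA per[of D] per[of "D - 1"] s by simp_all
      have "min (h (D - 2)) (h D + 1) - h D \<le> min (h (?E - 2)) (h ?E + 1) - h ?E"
        using c(1,2) p(1,2,5,6) q(1,2,5,6) by linarith
      then show ?thesis using True A' by (simp add: grow_def s)
    next
      case False
      then have "\<not> A ?E" "\<not> A (?E - 1)" using nD per[of D] per[of "D - 1"] s by simp_all
      then show ?thesis using False nD c(1) by (simp add: grow_def s)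
    qed
  qed
qed

lemma core_initial: "core k (\<lambda>D. max 0 (- D))"
  by (auto simp: core_def max_def)

lemma core_shift:
  assumes "core k h"
  shows "h (D - int n) - h D \<le> h (D - int n - int k) - h (D - int k)"
proof (induction n)
  case (Suc n)
  then show ?case using assms[unfolded core_def, rule_format, of "D - int n"]
    by (simp add: algebra_simps)
qed simp

text \<open>
  For a core, the gain in height over one period increases towards the left.
\<close>

lemma core_periods:
  assumes "core k h"
  defines "\<alpha> \<equiv> \<lambda>D. h (D - int k) - h D"
  shows "h D + int q * \<alpha> (D + int k) \<le> h (D - int q * int k)"
    and "h D - int q * \<alpha> (D + int k) \<le> h (D + int q * int k)"
proof -
  have dec: "\<alpha> E \<le> \<alpha> D'" if "D' \<le> E" for D' E
    using core_shift[OF assms(1), of E "nat (E - D')"] that by (simp add: \<alpha>_def algebra_simps)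
  show "h D + int q * \<alpha> (D + int k) \<le> h (D - int q * int k)"
  proof (induction q)
    case (Suc q)
    have "0 \<le> int q * int k" by simp
    then have "\<alpha> (D + int k) \<le> \<alpha> (D - int q * int k)" by (intro dec) linarith
    moreover have "D - int (Suc q) * int k = D - int q * int k - int k" by (simp add: algebra_simps)
    ultimately show ?case using Suc by (simp add: \<alpha>_def algebra_simps)
  qed simp
  show "h D - int q * \<alpha> (D + int k) \<le> h (D + int q * int k)"
  proof (induction q)
    case (Suc q)
    have "0 \<le> int q * int k" by simp
    then have "\<alpha> (D + int q * int k + int k) \<le> \<alpha> (D + int k)" by (intro dec) linarith
    moreover have "D + int (Suc q) * int k = D + int q * int k + int k" by (simp add: algebra_simps)
    ultimately show ?case using Suc by (simp add: \<alpha>_def algebra_simps)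
  qed simp
qed

text \<open>
  Let \<open>\<beta>\<close> be the number of residue classes with a bead beyond the corner
  \<open>(a, b)\<close>. A core gains at least \<open>\<beta>\<close> in height for each
  \<open>k\<close> steps to the left of the corner diagonal and loses at most
  \<open>\<beta>\<close> for each \<open>k\<close> steps to the right. Since far away the
  diagram agrees with the empty one, \<open>0 < \<beta> < k\<close>. If \<open>\<beta>\<close>
  violates the constraints on \<open>\<alpha>\<close>, it is replaced by the bound that it
  violates; the estimates that are lost in this way concern boxes with a nonpositive coordinate.
\<close>

lemma core_contains_staircase:
  fixes a b k g :: nat
  assumes "0 < a" "0 < b" "0 < k"
    and h: "profile h" "core k h" "int a \<le> h (int b - int a)"
    and low: "\<And>D. 0 \<le> h D" "\<And>D. - D \<le> h D"
    and far: "\<And>D. int g \<le> D \<Longrightarrow> h D = 0" "\<And>D. D \<le> - int g \<Longrightarrow> h D = - D"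
  obtains \<alpha> :: nat where "0 < \<alpha>" "\<alpha> \<le> min a (k - 1)" "k \<le> \<alpha> + b \<or> \<alpha> = a"
    "\<And>q::int. int a + q * int \<alpha> \<le> h (int b - int a - q * int k)"
proof -
  let ?D = "int b - int a"
  define \<beta> where "\<beta> = h ?D - h (?D + int k)"
  have up: "h ?D + int q * \<beta> \<le> h (?D - int q * int k)"
    and down: "h ?D - int q * \<beta> \<le> h (?D + int q * int k)" for q
    using core_periods[OF h(2), where D = ?D and q = q] by (simp_all add: \<beta>_def)
  have "\<beta> > 0"
  proof (rule ccontr)
    assume "\<not> \<beta> > 0"
    then have "int (a + g) * \<beta> \<le> 0" by (simp add: mult_nonneg_nonpos)
    then have "0 < h (?D + int (a + g) * int k)" using down[of "a + g"] h(3) assms(1) by linarith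
    moreover have "int (a + g) * 1 \<le> int (a + g) * int k" using assms(3) by (intro mult_left_mono) auto
    ultimately show False using far(1)[of "?D + int (a + g) * int k"] by simp
  qed
  have "\<beta> < int k"
  proof (rule ccontr)
    assume "\<not> \<beta> < int k"
    define P where "P = int (b + g) * int k"
    have "P \<le> int (b + g) * \<beta>"
      unfolding P_def using \<open>\<not> \<beta> < int k\<close> by (intro mult_left_mono) auto
    then have "h ?D + P \<le> h (?D - P)" using up[of "b + g"] by (simp add: P_def)
    moreover have "int (b + g) * 1 \<le> P" unfolding P_def using assms(3) by (intro mult_left_mono) auto
    then have "h (?D - P) = - (?D - P)" by (intro far(2)) simp
    ultimately show False using h(3) assms(2) by simp
  qed
  define \<alpha> where "\<alpha> = nat (min (int a) (max \<beta> (int k - int b)))"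
  have \<alpha>: "int \<alpha> = min (int a) (max \<beta> (int k - int b))" using \<open>\<beta> > 0\<close> by (simp add: \<alpha>_def)
  have bounds: "0 < \<alpha>" "\<alpha> \<le> min a (k - 1)" "k \<le> \<alpha> + b \<or> \<alpha> = a"
    using \<alpha> \<open>\<beta> > 0\<close> \<open>\<beta> < int k\<close> assms(1-3) by linarith+
  have "int a + q * int \<alpha> \<le> h (?D - q * int k)" for q
  proof (cases "q \<ge> 1")
    case True
    then obtain n where n: "q = int n" using zero_le_imp_eq_int[of q] by auto
    show ?thesis
    proof (cases "int \<alpha> \<le> \<beta>")
      case True
      then have "q * int \<alpha> \<le> q * \<beta>" using n by (simp add: mult_left_mono)
      then show ?thesis using up[of n] h(3) n by simp
    next
      case False
      then have "int b \<le> 1 * (int k - int \<alpha>)"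
        using \<alpha> by (auto simp: min_def max_def split: if_splits)
      also have "\<dots> \<le> q * (int k - int \<alpha>)"
        using \<open>q \<ge> 1\<close> bounds by (intro mult_right_mono) linarith+
      finally show ?thesis using low(2)[of "?D - q * int k"] by (simp add: algebra_simps)
    qed
  next
    case False
    then obtain n where "- q = int n" using zero_le_imp_eq_int[of "- q"] by auto
    then have n: "q = - int n" by simp
    show ?thesis
    proof (cases "\<beta> \<le> int \<alpha> \<or> n = 0")
      case True
      then have "int n * \<beta> \<le> int n * int \<alpha>" by (auto intro: mult_left_mono)
      then show ?thesis using down[of n] h(3) n by simp
    next
      case False
      then have "\<alpha> = a" "n \<ge> 1" using \<alpha> by (auto simp: min_def max_def split: if_splits)
      then have "a \<le> n * a" by simp
      then have "int a \<le> int n * int a" by (metis of_nat_le_iff of_nat_mult)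
      then show ?thesis using low(1)[of "?D - q * int k"] n \<open>\<alpha> = a\<close> by simp
    qed
  qed
  then show ?thesis using that[OF bounds] by blast
qed

abbreviation "k_uniform \<equiv> k_uniform_displacement_tableau"

text \<open>
  The combinatorial form of the containment of the torus of \<open>t\<close> in that of
  \<open>t'\<close>: each condition imposed by \<open>t'\<close> is imposed by \<open>t\<close>.
\<close>

definition draws_from :: "nat \<Rightarrow> nat \<Rightarrow> nat \<Rightarrow> (nat \<Rightarrow> nat \<Rightarrow> nat) \<Rightarrow> (nat \<Rightarrow> nat \<Rightarrow> nat) \<Rightarrow> bool" where
  "draws_from k a b t' t \<longleftrightarrow> (\<forall>x\<in>{1..a}. \<forall>y\<in>{1..b}. \<exists>x0\<in>{1..a}. \<exists>y0\<in>{1..b}.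
     t x0 y0 = t' x y \<and> [int y0 - int x0 = int y - int x] (mod int k))"

text \<open>
  The lower set generated by the translates of \<open>(a, b)\<close> by multiples of
  \<open>(\<alpha>, \<alpha> - k)\<close>. Passing through the diagonals in decreasing order
  from a corner, the boundary has \<open>k - \<alpha>\<close> steps at constant \<open>x\<close>
  and then \<open>\<alpha>\<close> steps at constant \<open>y\<close>.
\<close>

definition staircase :: "nat \<Rightarrow> nat \<Rightarrow> nat \<Rightarrow> nat \<Rightarrow> int \<Rightarrow> int" where
  "staircase k \<alpha> a b D =
     (let n = int b - int a - D
      in int a + n div int k * int \<alpha> + max 0 (n mod int k - (int k - int \<alpha>)))"

lemma staircase_period:
  assumes "0 < k" shows "staircase k \<alpha> a b (D - int k) = staircase k \<alpha> a b D + int \<alpha>"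
proof -
  define n where "n = int b - int a - D"
  have n: "int b - int a - (D - int k) = n + int k" by (simp add: n_def)
  have "(n + int k) div int k = n div int k + 1" using assms by simp
  then show ?thesis unfolding staircase_def Let_def n n_def[symmetric] by (simp add: algebra_simps)
qed

lemma staircase_corner: "0 < k \<Longrightarrow> \<alpha> \<le> k \<Longrightarrow> staircase k \<alpha> a b (int b - int a) = int a"
  by (simp add: staircase_def)

lemma profile_staircase:
  assumes "0 < k" "\<alpha> < k" shows "profile (staircase k \<alpha> a b)"
  unfolding profile_def
proof
  fix D :: int
  define n where "n = int b - int a - (D + 1)"
  have n: "int b - int a - D = n + 1" by (simp add: n_def)
  define q s where "q = n div int k" and "s = n mod int k"
  have s: "0 \<le> s" "s < int k" using assms by (simp_all add: s_def)
  have nqs: "n = q * int k + s" by (simp add: q_def s_def)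
  have "(n + 1) div int k * int \<alpha> + max 0 ((n + 1) mod int k - (int k - int \<alpha>)) =
    q * int \<alpha> + max 0 (s + 1 - (int k - int \<alpha>))"
  proof (cases "s + 1 = int k")
    case True
    then have "n + 1 = (q + 1) * int k" using nqs by (simp add: algebra_simps)
    then have "(n + 1) div int k = q + 1" "(n + 1) mod int k = 0" using assms by simp_all
    then show ?thesis using True assms by (simp add: algebra_simps)
  next
    case False
    have "(n + 1) div int k = q" "(n + 1) mod int k = s + 1"
      using nqs s False int_div_pos_eq[of "n + 1" "int k" q "s + 1"]
        int_mod_pos_eq[of "n + 1" "int k" q "s + 1"]
      by (simp_all add: algebra_simps)
    then show ?thesis by simp
  qed
  then show "staircase k \<alpha> a b (D + 1) \<le> staircase k \<alpha> a b D \<and>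
     staircase k \<alpha> a b D \<le> staircase k \<alpha> a b (D + 1) + 1"
    unfolding staircase_def Let_def n n_def[symmetric] q_def[symmetric] s_def[symmetric] by auto
qed

lemma staircase_least:
  assumes "profile h" "0 < k" "\<And>q::int. int a + q * int \<alpha> \<le> h (int b - int a - q * int k)"
  shows "staircase k \<alpha> a b D \<le> h D"
proof -
  define n where "n = int b - int a - D"
  define q s where "q = n div int k" and "s = n mod int k"
  have s: "0 \<le> s" "s < int k" using assms by (simp_all add: s_def)
  have "n = q * int k + s" by (simp add: q_def s_def)
  then have D: "D = int b - int a - q * int k - s" by (simp add: n_def)
  have "int a + q * int \<alpha> \<le> h D"
    using assms(3)[of q] profile_shift(1)[OF assms(1), of "int b - int a - q * int k" "nat s"] s D
    by simp
  moreover have "int a + q * int \<alpha> + (s - (int k - int \<alpha>)) \<le> h D"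
  proof -
    have "int b - int a - (q + 1) * int k = D - int (nat (int k - s))"
      using s D by (simp add: algebra_simps)
    then have "int a + (q + 1) * int \<alpha> \<le> h (D - int (nat (int k - s)))" using assms(3)[of "q + 1"] by simp
    also have "\<dots> \<le> h D + (int k - s)"
      using profile_shift(2)[OF assms(1), of D "nat (int k - s)"] s by simp
    finally show ?thesis by (simp add: algebra_simps)
  qed
  ultimately show ?thesis
    unfolding staircase_def Let_def n_def[symmetric] q_def[symmetric] s_def[symmetric] by simp
qed

text \<open>
  Peeling goes backwards in time: \<open>peeled A g H (g - j)\<close> is what remains of
  \<open>H\<close> at time \<open>j\<close>.
\<close>

fun peeled :: "(nat \<Rightarrow> int \<Rightarrow> bool) \<Rightarrow> nat \<Rightarrow> (int \<Rightarrow> int) \<Rightarrow> nat \<Rightarrow> int \<Rightarrow> int" where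
  "peeled A g H 0 = H"
| "peeled A g H (Suc i) = shrink (A (g - i)) (peeled A g H i)"

lemma peeled_Suc:
  assumes "j < g"
  shows "peeled A g H (g - j) = shrink (A (Suc j)) (peeled A g H (g - Suc j))"
proof -
  have "g - j = Suc (g - Suc j)" "g - (g - Suc j) = Suc j" using assms by simp_all
  then show ?thesis by simp
qed

lemma profile_peeled: "profile H \<Longrightarrow> profile (peeled A g H i)"
  by (induction i) (auto intro: profile_shrink)

lemma peeled_period:
  assumes "\<And>D. H (D - int k) = H D + c" and per: "\<And>j D. A j (D - int k) \<longleftrightarrow> A j D"
  shows "peeled A g H i (D - int k) = peeled A g H i D + c"
proof (induction i arbitrary: D)
  case (Suc i)
  have "peeled A g H i (D - int k + 1) = peeled A g H i (D + 1) + c"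
    "peeled A g H i (D - int k - 1) = peeled A g H i (D - 1) + c"
    using Suc[of "D + 1"] Suc[of "D - 1"] by (simp_all add: algebra_simps)
  then show ?case using Suc[of D] per[of "g - i" D] by (auto simp: shrink_def max_def)
qed (use assms in simp)

lemma peeled_le_grown:
  assumes A: "\<And>j D. A j D \<Longrightarrow> \<not> A j (D + 1)" and "\<And>D. H D \<le> grown A g D" "j \<le> g"
  shows "peeled A g H (g - j) D \<le> grown A j D"
  using assms(3)
proof (induction j arbitrary: D rule: inc_induct)
  case base
  then show ?case using assms(2) by simp
next
  case (step n)
  have "peeled A g H (g - n) D = shrink (A (Suc n)) (peeled A g H (g - Suc n)) D"
    using peeled_Suc step by metis
  also have "\<dots> \<le> grown A n D"
    using step.IH by (intro shrink_le_if_le_grow profile_grown A) auto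
  finally show ?case .
qed

lemma growth_peeled:
  assumes H: "profile H" "int a \<le> H (int b - int a)" "\<And>D. H D \<le> grown A g D"
    and A: "\<And>j D. A j D \<Longrightarrow> \<not> A j (D + 1)"
  shows "growth (\<lambda>j. peeled A g H (g - j)) A a b g"
proof
  show prof: "profile (peeled A g H (g - j))" for j using H(1) by (rule profile_peeled)
  show "peeled A g H (g - 0) D \<le> max 0 (- D)" for D
    using peeled_le_grown[OF A H(3), of 0 D] by simp
  show "int a \<le> peeled A g H (g - g) (int b - int a)" using H(2) by simp
  fix j D x assume *: "j < g" "peeled A g H (g - j) D < x" "x \<le> peeled A g H (g - Suc j) D"
  let ?H = "peeled A g H (g - Suc j)"
  have AD: "A (Suc j) D" using * peeled_Suc[OF *(1), of A H] by (auto simp: shrink_def split: if_splits)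
  then have "\<not> A (Suc j) (D + 1)" "\<not> A (Suc j) (D - 1)" using A[of "Suc j" "D - 1"] A by auto
  then have "peeled A g H (g - j) (D + 1) = ?H (D + 1)" "peeled A g H (g - j) (D - 1) = ?H (D - 1)"
    using peeled_Suc[OF *(1), of A H] by (auto simp: shrink_def)
  then show "A (Suc j) D \<and> x \<le> peeled A g H (g - j) (D - 1) \<and> x - 1 \<le> peeled A g H (g - j) (D + 1)"
    using AD *(3) profileD[OF prof[of "Suc j"], of D] by auto
qed

lemma core_grown:
  assumes per: "\<And>j D. A j (D - int k) \<longleftrightarrow> A j D" and A: "\<And>j D. A j D \<Longrightarrow> \<not> A j (D + 1)"
  shows "core k (grown A j)"
  by (induction j) (auto intro!: core_initial core_grow[OF profile_grown] assms)

lemma k_uniformD: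
  assumes "k_uniform k a b g t" "x \<in> {1..a}" "y \<in> {1..b}" "x' \<in> {1..a}" "y' \<in> {1..b}"
    and "t x y = t x' y'"
  shows "[int y - int x = int y' - int x'] (mod int k)"
proof -
  have "[int x - int y = int x' - int y'] (mod int k)"
    using assms unfolding k_uniform_displacement_tableau_def by blast
  then have "[- (int x - int y) = - (int x' - int y')] (mod int k)" by (simp only: cong_minus_minus_iff)
  then show ?thesis by simp
qed

definition labels :: "nat \<Rightarrow> nat \<Rightarrow> nat \<Rightarrow> (nat \<Rightarrow> nat \<Rightarrow> nat) \<Rightarrow> nat \<Rightarrow> int \<Rightarrow> bool" where
  "labels k a b t j D \<longleftrightarrow>
     (\<exists>x\<in>{1..a}. \<exists>y\<in>{1..b}. t x y = j \<and> [int y - int x = D] (mod int k))"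

lemma labels_period: "labels k a b t j (D - int k) \<longleftrightarrow> labels k a b t j D"
  by (simp add: labels_def cong_def)

lemma labels_cong:
  assumes "k_uniform k a b g t" "labels k a b t j D" "labels k a b t j E"
  shows "[D = E] (mod int k)"
proof -
  obtain x y x' y' where *: "x \<in> {1..a}" "y \<in> {1..b}" "x' \<in> {1..a}" "y' \<in> {1..b}"
    "t x y = j" "t x' y' = j"
    "[int y - int x = D] (mod int k)" "[int y' - int x' = E] (mod int k)"
    using assms(2,3) unfolding labels_def by blast
  then have "[int y - int x = int y' - int x'] (mod int k)"
    by (intro k_uniformD[OF assms(1)]) auto
  then show ?thesis using *(7,8) by (metis cong_sym cong_trans)
qed

text \<open>
  The diagonals carrying a given entry of \<open>t\<close> form one residue class modulo
  \<open>k\<close>, so all steps are compatible with translation by \<open>(\<alpha>, \<alpha> -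
  k)\<close>. Growth by the entries of \<open>t\<close> yields a core containing the rectangle
  and hence a periodic staircase \<open>S\<close>. Peeling \<open>S\<close> stays periodic and
  below the growing core, so it ends outside the positive quadrant. Let \<open>t' x y\<close> be
  the time at which \<open>(x, y)\<close> is peeled off. Only one box per diagonal goes at each
  time, so equal values of \<open>t'\<close> occur exactly at translates; and a box of a
  neighbouring translate of the rectangle that touches the rectangle goes before or after it
  according to monotonicity, which gives the conditions for \<open>\<alpha> = a\<close> and
  \<open>\<alpha> = k - b\<close>.
\<close>

theorem exists_scrollar_drawing_from:
  assumes "2 \<le> k" "0 < a" "0 < b" and t: "k_uniform k a b g t"
  obtains t' where "scrollar_tableau k a b g t'" "draws_from k a b t' t"
proof -
  define A where "A = labels k a b t"
  have per: "A j (D - int k) \<longleftrightarrow> A j D" for j D by (simp add: A_def labels_period)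
  have cong: "[D = E] (mod int k)" if "A j D" "A j E" for j D E
    using labels_cong[OF t] that by (simp add: A_def)
  have nadj: "\<not> A j (D + 1)" if "A j D" for j D
  proof
    assume "A j (D + 1)"
    from cong[OF that this] have "int k dvd D - (D + 1)" by (simp only: cong_iff_dvd_diff)
    then show False using assms(1) by simp
  qed
  have tab: "tableau a b g t" using t by (simp add: k_uniform_displacement_tableau_def)
  have "t a b \<le> g" using tab assms(2,3) unfolding tableau_def by auto
  then have fin: "int a \<le> grown A g (int b - int a)"
  proof (intro tableau_le_grown[OF tab])
    show "A (t x y) (int y - int x)" if "x \<in> {1..a}" "y \<in> {1..b}" for x y
      using that unfolding A_def labels_def by (blast intro: cong_refl)
  qed (use assms(2,3) in auto)
  obtain \<alpha> where \<alpha>: "0 < \<alpha>" "\<alpha> \<le> min a (k - 1)" "k \<le> \<alpha> + b \<or> \<alpha> = a"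
    "\<And>q::int. int a + q * int \<alpha> \<le> grown A g (int b - int a - q * int k)"
    by (rule core_contains_staircase[of a b k "grown A g" g])
      (use assms fin core_grown[of A k g, OF per nadj] profile_grown grown_lower grown_far in auto)
  define S where "S = staircase k \<alpha> a b"
  define H where "H = (\<lambda>j. peeled A g S (g - j))"
  have k: "0 < k" "\<alpha> < k" using \<alpha>(2) assms(1) by auto
  have S: "profile S" "S (int b - int a) = int a" "S D \<le> grown A g D" "S (D - int k) = S D + int \<alpha>" for D
    using \<alpha>(4) k unfolding S_def
    by (simp_all add: profile_staircase staircase_corner staircase_least profile_grown staircase_period)
  interpret growth H A a b g
    unfolding H_def by (rule growth_peeled) (use S nadj in auto)
  define t' where "t' = entry_time H"
  have Hper: "H j (D - int k) = H j D + int \<alpha>" for j D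
    unfolding H_def by (rule peeled_period) (use S(4) per in auto)
  have Hperl: "H j (D - l * int k) = H j D + l * int \<alpha>" for j D l
  proof -
    have np: "H j (D - int n * int k) = H j D + int n * int \<alpha>" for n D
    proof (induction n)
      case (Suc n)
      then show ?case using Hper[of j "D - int n * int k"] by (simp add: algebra_simps)
    qed simp
    show ?thesis
    proof (cases l)
      case (nonneg n)
      then show ?thesis using np by simp
    next
      case (neg m)
      define n where "n = Suc m"
      have l: "l = - int n" using neg by (simp add: n_def)
      then show ?thesis using np[of "D + int n * int k" n] by simp
    qed
  qed
  have tab': "tableau a b g t'" using tableau_entry_time by (simp add: t'_def)
  have draws: "draws_from k a b t' t"
    using entry_label unfolding draws_from_def t'_def A_def labels_def by metis
  \<comment> \<open>The box entering on a diagonal is its top box, since heights change by at most \<open>1\<close> at a time.\<close>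
  have jump: "int x = H (t' x y) (int y - int x)" if xy: "x \<in> {1..a}" "y \<in> {1..b}" for x y
  proof -
    obtain j where j: "entry_time H x y = Suc j" "j < g"
      "H j (int y - int x) < int x" "int x \<le> H (Suc j) (int y - int x)"
      by (rule entry[OF xy])
    have "H j = shrink (A (Suc j)) (H (Suc j))" unfolding H_def by (rule peeled_Suc[OF j(2)])
    then have "H (Suc j) (int y - int x) \<le> H j (int y - int x) + 1"
      using profileD[OF profile[of "Suc j"], of "int y - int x"] by (auto simp: shrink_def)
    then show ?thesis using j by (simp add: t'_def)
  qed
  have scroll: "t' x y = t' x' y' \<longleftrightarrow>
      (\<exists>l::int. int x' - int x = l * int \<alpha> \<and> int y' - int y = l * (int \<alpha> - int k))"
    if xy: "x \<in> {1..a}" "y \<in> {1..b}" "x' \<in> {1..a}" "y' \<in> {1..b}" for x y x' y'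
  proof
    assume eq: "t' x y = t' x' y'"
    have "[int y - int x = int y' - int x'] (mod int k)"
      using cong[of "t' x y"] entry_label[OF xy(1,2)] entry_label[OF xy(3,4)] eq by (simp add: t'_def)
    then obtain l where l: "int y - int x - (int y' - int x') = int k * l"
      by (auto simp: cong_iff_dvd_diff)
    then have "int y' - int x' = (int y - int x) - l * int k" by (simp add: algebra_simps)
    then have "int x' = int x + l * int \<alpha>"
      using jump[OF xy(1,2)] jump[OF xy(3,4)] Hperl[of "t' x y" "int y - int x" l] eq by simp
    moreover from this have "int y' - int y = l * (int \<alpha> - int k)"
      using l by (simp add: algebra_simps)
    ultimately show "\<exists>l::int. int x' - int x = l * int \<alpha> \<and> int y' - int y = l * (int \<alpha> - int k)"
      by auto
  next
    assume "\<exists>l::int. int x' - int x = l * int \<alpha> \<and> int y' - int y = l * (int \<alpha> - int k)"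
    then obtain l where l: "int x' = int x + l * int \<alpha>" "int y' = int y + l * (int \<alpha> - int k)"
      by (auto simp: algebra_simps)
    then have D: "int y' - int x' = (int y - int x) - l * int k" by (simp add: algebra_simps)
    have "int x' \<le> H j (int y' - int x') \<longleftrightarrow> int x \<le> H j (int y - int x)" for j
      unfolding D Hperl using l(1) by simp
    then show "t' x y = t' x' y'" by (simp add: t'_def entry_time_def)
  qed
  \<comment> \<open>The translate of \<open>(1, y)\<close> by \<open>(a, a - k)\<close> is the right neighbour of \<open>(a, y + a - k)\<close>.\<close>
  have seam1: "t' a (y + a - k) < t' 1 y" if sm: "\<alpha> = a" "y \<in> {1..b}" "k < y + a" for y
  proof -
    obtain j where j: "entry_time H 1 y = Suc j" "j < g"
      "H j (int y - int 1) < int 1" "int 1 \<le> H (Suc j) (int y - int 1)"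
      by (rule entry[OF _ sm(2)]) (use assms(2) in auto)
    have "H j (int y - 1 - int k) < int a + 1" "int a + 1 \<le> H (Suc j) (int y - 1 - int k)"
      using j(3,4) Hper[of _ "int y - 1"] sm(1) by auto
    from step[OF j(2) this] have "int a \<le> H j (int y - int k)" by (simp add: algebra_simps)
    moreover have "int (y + a - k) - int a = int y - int k" using sm(3) by simp
    ultimately have "entry_time H a (y + a - k) \<le> j" by (intro entry_le) simp
    then show ?thesis using j(1) by (simp add: t'_def)
  qed
  \<comment> \<open>The translate of \<open>(x, 1)\<close> by \<open>(b - k, b)\<close> is the upper neighbour of \<open>(x + b - k, b)\<close>.\<close>
  have seam2: "t' (x + b - k) b < t' x 1" if sm: "\<alpha> + b = k" "x \<in> {1..a}" "k < x + b" for x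
  proof -
    obtain j where j: "entry_time H x 1 = Suc j" "j < g"
      "H j (int 1 - int x) < int x" "int x \<le> H (Suc j) (int 1 - int x)"
      by (rule entry[OF sm(2)]) (use assms(3) in auto)
    have "H j (1 - int x + int k) < int x - int \<alpha>" "int x - int \<alpha> \<le> H (Suc j) (1 - int x + int k)"
      using j(3,4) Hper[of _ "1 - int x + int k"] by auto
    from step[OF j(2) this] have "int x - int \<alpha> \<le> H j (int k - int x)" by (simp add: algebra_simps)
    moreover have "int b - int (x + b - k) = int k - int x" "int (x + b - k) = int x - int \<alpha>"
      using sm(1,3) by linarith+
    ultimately have "entry_time H (x + b - k) b \<le> j" by (intro entry_le) metis
    then show ?thesis using j(1) by (simp add: t'_def)
  qed
  have "scrollar_of_type \<alpha> k a b t'"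
    unfolding scrollar_of_type_def using scroll seam1 seam2 by blast
  then have "scrollar_tableau k a b g t'"
    unfolding scrollar_tableau_def using tab' \<alpha>(1-3) by blast
  then show ?thesis using draws that by blast
qed

section \<open>Rigidity of scrollar tableaux\<close>

lemma tableau_row:
  assumes "tableau a b g t" "x \<in> {1..a}" "x' \<in> {1..a}" "y \<in> {1..b}" "x \<le> x'"
  shows "t x y \<le> t x' y"
  using assms(5,3)
proof (induction x' rule: dec_induct)
  case (step n)
  then have "t n y < t (Suc n) y" using assms unfolding tableau_def by auto
  then show ?case using step assms(2) by auto
qed simp

lemma tableau_col:
  assumes "tableau a b g t" "x \<in> {1..a}" "y \<in> {1..b}" "y' \<in> {1..b}" "y \<le> y'"
  shows "t x y \<le> t x y'"
  using assms(5,4)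
proof (induction y' rule: dec_induct)
  case (step n)
  then have "t x n < t x (Suc n)" using assms unfolding tableau_def by auto
  then show ?case using step assms(3) by auto
qed simp

lemma tableau_left: "tableau a b g t \<Longrightarrow> x - 1 \<in> {1..a} \<Longrightarrow> x \<in> {1..a} \<Longrightarrow> y \<in> {1..b} \<Longrightarrow> t (x - 1) y < t x y"
  unfolding tableau_def by (cases x) auto

lemma tableau_below: "tableau a b g t \<Longrightarrow> x \<in> {1..a} \<Longrightarrow> y - 1 \<in> {1..b} \<Longrightarrow> y \<in> {1..b} \<Longrightarrow> t x (y - 1) < t x y"
  unfolding tableau_def by (cases y) auto

lemma tableau_mono:
  assumes "tableau a b g t" "x \<in> {1..a}" "y \<in> {1..b}" "x' \<in> {1..a}" "y' \<in> {1..b}" "x \<le> x'" "y \<le> y'"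
  shows "t x y \<le> t x' y'"
  using tableau_row[OF assms(1,2,4,3,6)] tableau_col[OF assms(1,4,3,5,7)] by simp

text \<open>
  The argument below uses a scrollar tableau only through \<open>mono_translate\<close>, which
  says that its periodic extension to the union of the translates of the rectangle is monotone.
\<close>

locale scrollar_box =
  fixes \<alpha> k a b g :: nat and t :: "nat \<Rightarrow> nat \<Rightarrow> nat"
  assumes t: "tableau a b g t"
    and \<alpha>: "0 < \<alpha>" "\<alpha> \<le> min a (k - 1)" "k \<le> \<alpha> + b \<or> \<alpha> = a"
    and sc: "scrollar_of_type \<alpha> k a b t"
begin

abbreviation \<gamma> :: nat where "\<gamma> \<equiv> k - \<alpha>"

lemma \<gamma>: "0 < \<gamma>" "k = \<alpha> + \<gamma>" "int \<alpha> - int k = - int \<gamma>"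
  using \<alpha> by auto

lemma wrap:
  assumes "x \<in> {1..a}" "y \<in> {1..b}" "x + \<alpha> \<in> {1..a}" "y + \<gamma> \<in> {1..b}"
  shows "t x (y + \<gamma>) = t (x + \<alpha>) y"
proof -
  have iff: "(t x (y + \<gamma>) = t (x + \<alpha>) y) \<longleftrightarrow>
      (\<exists>l::int. int (x + \<alpha>) - int x = l * int \<alpha> \<and> int y - int (y + \<gamma>) = l * (int \<alpha> - int k))"
    using sc assms unfolding scrollar_of_type_def by blast
  show ?thesis unfolding iff by (rule exI[of _ 1]) (use \<gamma> in auto)
qed

text \<open>
  One translation to the right and down. If the translate of \<open>(x, y)\<close> falls below
  the rectangle, then \<open>(x, y)\<close> is first moved up to a box whose translate lies in
  the rectangle; when the rectangle and its translate touch without overlapping, the condition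
  for \<open>\<alpha> = k - b\<close> takes over. The other direction \<open>mono_left\<close>
  uses the condition for \<open>\<alpha> = a\<close> in the same way.
\<close>

lemma mono_right:
  assumes "x \<in> {1..a}" "y \<in> {1..b}" "x' \<in> {1..a}" "y' \<in> {1..b}" "x + \<alpha> \<le> x'" "y \<le> y' + \<gamma>"
  shows "t x y \<le> t x' y'"
proof -
  have xa: "x + \<alpha> \<in> {1..a}" using assms by auto
  consider "\<gamma> < y" | "y \<le> \<gamma>" "\<gamma> < b" | "y \<le> \<gamma>" "\<gamma> = b" | "b < \<gamma>" by linarith
  then show ?thesis
  proof cases
    case 1
    then have z: "y = (y - \<gamma>) + \<gamma>" "1 \<le> y - \<gamma>" by linarith+
    then have "t x y = t (x + \<alpha>) (y - \<gamma>)" using wrap[of x "y - \<gamma>"] z assms xa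
      by (metis atLeastAtMost_iff diff_le_self le_trans)
    also have "\<dots> \<le> t x' y'" by (rule tableau_mono[OF t]) (use 1 assms xa in auto)
    finally show ?thesis .
  next
    case 2
    have "t x y \<le> t x (1 + \<gamma>)" by (rule tableau_mono[OF t]) (use 2 assms in auto)
    also have "\<dots> = t (x + \<alpha>) 1" by (rule wrap) (use 2 assms xa in auto)
    also have "\<dots> \<le> t x' y'" by (rule tableau_mono[OF t]) (use 2 assms xa in auto)
    finally show ?thesis .
  next
    case 3
    have "t x y \<le> t x b" by (rule tableau_mono[OF t]) (use 3 assms in auto)
    also have "\<dots> < t (x + \<alpha>) 1"
    proof -
      have "\<alpha> + b = k" using 3 \<gamma> by simp
      then have "t (x + \<alpha> + b - k) b < t (x + \<alpha>) 1"
        using sc xa assms(1) unfolding scrollar_of_type_def by auto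
      moreover have "x + \<alpha> + b - k = x" using \<open>\<alpha> + b = k\<close> by simp
      ultimately show ?thesis by simp
    qed
    also have "\<dots> \<le> t x' y'" by (rule tableau_mono[OF t]) (use 3 assms xa in auto)
    finally show ?thesis by simp
  next
    case 4
    then show ?thesis using \<alpha> assms by auto
  qed
qed

lemma mono_left:
  assumes "x \<in> {1..a}" "y \<in> {1..b}" "x' \<in> {1..a}" "y' \<in> {1..b}" "x \<le> x' + \<alpha>" "y + \<gamma> \<le> y'"
  shows "t x y \<le> t x' y'"
proof -
  have yb: "y + \<gamma> \<in> {1..b}" using assms by auto
  consider "\<alpha> < x" | "x \<le> \<alpha>" "\<alpha> < a" | "x \<le> \<alpha>" "\<alpha> = a" using \<alpha> by fastforce
  then show ?thesis
  proof cases
    case 1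
    then have z: "x = (x - \<alpha>) + \<alpha>" "1 \<le> x - \<alpha>" by linarith+
    then have "t x y = t (x - \<alpha>) (y + \<gamma>)" using wrap[of "x - \<alpha>" y] z assms yb
      by (metis atLeastAtMost_iff diff_le_self le_trans)
    also have "\<dots> \<le> t x' y'" by (rule tableau_mono[OF t]) (use 1 assms yb in auto)
    finally show ?thesis .
  next
    case 2
    have "t x y \<le> t (1 + \<alpha>) y" by (rule tableau_mono[OF t]) (use 2 assms in auto)
    also have "\<dots> = t 1 (y + \<gamma>)" by (rule wrap[symmetric]) (use 2 assms yb in auto)
    also have "\<dots> \<le> t x' y'" by (rule tableau_mono[OF t]) (use 2 assms yb in auto)
    finally show ?thesis .
  next
    case 3
    have "t x y \<le> t a y" by (rule tableau_mono[OF t]) (use 3 assms in auto)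
    also have "\<dots> < t 1 (y + \<gamma>)"
    proof -
      have y: "k < (y + \<gamma>) + a" "(y + \<gamma>) + a - k = y" using 3 \<gamma>(1,2) assms(2) by auto
      then have "t a ((y + \<gamma>) + a - k) < t 1 (y + \<gamma>)"
        using sc yb 3(2) unfolding scrollar_of_type_def by blast
      then show ?thesis unfolding y(2) .
    qed
    also have "\<dots> \<le> t x' y'" by (rule tableau_mono[OF t]) (use 3 assms yb in auto)
    finally show ?thesis by simp
  qed
qed

text \<open>
  Several translations are split into single ones; the intermediate box is the translate of
  \<open>(x, y)\<close>, pushed back into the rectangle if necessary.
\<close>

lemma mono_translate:
  assumes "x \<in> {1..a}" "y \<in> {1..b}" "x' \<in> {1..a}" "y' \<in> {1..b}"
    and "int x + l * int \<alpha> \<le> int x'" "int y + l * (int \<alpha> - int k) \<le> int y'"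
  shows "t x y \<le> t x' y'"
proof (cases l)
  case (nonneg n)
  have "t x y \<le> t x' y'"
    if "x \<in> {1..a}" "y \<in> {1..b}" "x + n * \<alpha> \<le> x'" "y \<le> y' + n * \<gamma>" for x y
    using that
  proof (induction n arbitrary: x y)
    case 0
    then show ?case using tableau_mono[OF t] assms(3,4) by simp
  next
    case (Suc n)
    have z: "x + \<alpha> \<in> {1..a}" "max 1 (y - \<gamma>) \<in> {1..b}" using Suc.prems assms(3) by auto
    have "t x y \<le> t (x + \<alpha>) (max 1 (y - \<gamma>))" by (rule mono_right) (use Suc.prems z in auto)
    also have "\<dots> \<le> t x' y'" by (rule Suc.IH) (use Suc.prems z assms(4) in auto)
    finally show ?case .
  qed
  moreover have "x + n * \<alpha> \<le> x'" using assms(5) nonneg by (metis of_nat_add of_nat_le_iff of_nat_mult)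
  moreover have "y \<le> y' + n * \<gamma>"
  proof -
    have "int y \<le> int (y' + n * \<gamma>)" using assms(6) nonneg unfolding \<gamma>(3) by simp
    then show ?thesis by linarith
  qed
  ultimately show ?thesis using assms(1,2) by blast
next
  case (neg m)
  define n where "n = Suc m"
  have l: "l = - int n" using neg by (simp add: n_def)
  have "t x y \<le> t x' y'"
    if "x \<in> {1..a}" "y \<in> {1..b}" "x \<le> x' + n * \<alpha>" "y + n * \<gamma> \<le> y'" for x y
    using that
  proof (induction n arbitrary: x y)
    case 0
    then show ?case using tableau_mono[OF t] assms(3,4) by simp
  next
    case (Suc n)
    have z: "max 1 (x - \<alpha>) \<in> {1..a}" "y + \<gamma> \<in> {1..b}" using Suc.prems assms(4) by auto
    have "t x y \<le> t (max 1 (x - \<alpha>)) (y + \<gamma>)" by (rule mono_left) (use Suc.prems z in auto)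
    also have "\<dots> \<le> t x' y'" by (rule Suc.IH) (use Suc.prems z assms(3) in auto)
    finally show ?case .
  qed
  moreover have "x \<le> x' + n * \<alpha>"
  proof -
    have "int x \<le> int (x' + n * \<alpha>)" using assms(5) l by simp
    then show ?thesis by linarith
  qed
  moreover have "y + n * \<gamma> \<le> y'"
  proof -
    have "int (y + n * \<gamma>) \<le> int y'" using assms(6) l unfolding \<gamma>(3) by simp
    then show ?thesis by linarith
  qed
  ultimately show ?thesis using assms(1,2) by blast
qed

lemma draws_same_diagonal:
  assumes "draws_from k a b t' t" "x \<in> {1..a}" "y \<in> {1..b}"
  obtains x0 y0 l where "x0 \<in> {1..a}" "y0 \<in> {1..b}" "t x0 y0 = t' x y"
    "int y - int x - (int y0 - int x0) = l * int k"
proof -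
  obtain x0 y0 where *: "x0 \<in> {1..a}" "y0 \<in> {1..b}" "t x0 y0 = t' x y"
    "[int y0 - int x0 = int y - int x] (mod int k)"
    using assms unfolding draws_from_def by blast
  from *(4) have "[int y - int x = int y0 - int x0] (mod int k)" by (rule cong_sym)
  then obtain l where "int y - int x - (int y0 - int x0) = int k * l"
    by (auto simp: cong_iff_dvd_diff)
  then show ?thesis using that[OF *(1-3), of l] by (simp add: mult.commute)
qed

lemma no_wrap_below_origin:
  assumes "x0 \<in> {1..a}" "y0 \<in> {1..b}" "int x0 \<le> l * int \<alpha>" "int y0 \<le> l * (int \<alpha> - int k)"
  shows False
proof (cases "l \<le> 0")
  case True
  then have "l * int \<alpha> \<le> 0" by (simp add: mult_nonpos_nonneg)
  then show False using assms(1,3) by auto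
next
  case False
  have "int \<alpha> - int k \<le> 0" using \<alpha>(2) by auto
  then have "l * (int \<alpha> - int k) \<le> 0" using False by (intro mult_nonneg_nonpos) auto
  then show False using assms(2,4) by auto
qed

text \<open>
  Let \<open>(x0, y0)\<close> carry the entry \<open>t' x y\<close> in \<open>t\<close>, and
  translate \<open>(x, y)\<close> to the diagonal of \<open>(x0, y0)\<close>. If it lies weakly
  below \<open>(x0, y0)\<close> there, monotonicity gives the claim. If it lies strictly above,
  then the left or lower neighbour of \<open>(x, y)\<close> still lies above \<open>(x0,
  y0)\<close>, so its entry in \<open>t\<close> is at least \<open>t' x y\<close>, although by
  induction it is at most its own, smaller, entry in \<open>t'\<close>. The corner \<open>(1,
  1)\<close> cannot lie strictly above a box of a translate of the rectangle.
\<close>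

lemma le_if_draws_from:
  assumes t': "tableau a b g t'" and d: "draws_from k a b t' t"
    and "x \<in> {1..a}" "y \<in> {1..b}"
  shows "t x y \<le> t' x y"
  using assms(3,4)
proof (induction "t' x y" arbitrary: x y rule: less_induct)
  case less
  obtain x0 y0 l where 0: "x0 \<in> {1..a}" "y0 \<in> {1..b}" "t x0 y0 = t' x y"
    "int y - int x - (int y0 - int x0) = l * int k"
    by (rule draws_same_diagonal[OF d less.prems])
  show ?case
  proof (cases "int x + l * int \<alpha> \<le> int x0")
    case True
    then have "t x y \<le> t x0 y0" using 0(4)
      by (intro mono_translate[OF less.prems 0(1,2), of l]) (auto simp: algebra_simps)
    then show ?thesis using 0(3) by simp
  next
    case False
    then have above: "int x0 + (- l) * int \<alpha> \<le> int x - 1" "int y0 + (- l) * (int \<alpha> - int k) \<le> int y - 1"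
      using 0(4) by (simp_all add: algebra_simps)
    have "1 < y \<or> 1 < x \<or> x = 1 \<and> y = 1" using less.prems by auto
    then consider "1 < y" | "1 < x" | "x = 1" "y = 1" by blast
    then show ?thesis
    proof cases
      case 1
      then have y: "y - 1 \<in> {1..b}" "y = Suc (y - 1)" using less.prems by auto
      have "t x0 y0 \<le> t x (y - 1)"
        using above y by (intro mono_translate[OF 0(1,2) less.prems(1) y(1), of "- l"]) auto
      moreover have lt: "t' x (y - 1) < t' x y"
        by (rule tableau_below[OF t' less.prems(1) y(1) less.prems(2)])
      moreover have "t x (y - 1) \<le> t' x (y - 1)" by (rule less.hyps[OF lt less.prems(1) y(1)])
      ultimately show ?thesis using 0(3) by simp
    next
      case 2
      then have x: "x - 1 \<in> {1..a}" "x = Suc (x - 1)" using less.prems by auto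
      have "t x0 y0 \<le> t (x - 1) y"
        using above x by (intro mono_translate[OF 0(1,2) x(1) less.prems(2), of "- l"]) auto
      moreover have lt: "t' (x - 1) y < t' x y"
        by (rule tableau_left[OF t' x(1) less.prems(1,2)])
      moreover have "t (x - 1) y \<le> t' (x - 1) y" by (rule less.hyps[OF lt x(1) less.prems(2)])
      ultimately show ?thesis using 0(3) by simp
    next
      case 3
      then show ?thesis using above no_wrap_below_origin[OF 0(1,2), of l] by simp
    qed
  qed
qed

text \<open>
  The same argument turned by \<open>180\<close> degrees, by induction from the large entries.
\<close>

lemma ge_if_draws_from:
  assumes t': "tableau a b g t'" and d: "draws_from k a b t' t"
    and "x \<in> {1..a}" "y \<in> {1..b}"
  shows "t' x y \<le> t x y"
  using assms(3,4)
proof (induction "g - t' x y" arbitrary: x y rule: less_induct)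
  case less
  obtain x0 y0 l where 0: "x0 \<in> {1..a}" "y0 \<in> {1..b}" "t x0 y0 = t' x y"
    "int y - int x - (int y0 - int x0) = l * int k"
    by (rule draws_same_diagonal[OF d less.prems])
  show ?case
  proof (cases "int x0 \<le> int x + l * int \<alpha>")
    case True
    then have "t x0 y0 \<le> t x y" using 0(4)
      by (intro mono_translate[OF 0(1,2) less.prems, of "- l"]) (auto simp: algebra_simps)
    then show ?thesis using 0(3) by simp
  next
    case False
    then have below: "int x + l * int \<alpha> \<le> int x0 - 1" "int y + l * (int \<alpha> - int k) \<le> int y0 - 1"
      using 0(4) by (simp_all add: algebra_simps)
    have "y < b \<or> x < a \<or> x = a \<and> y = b" using less.prems by auto
    then consider "y < b" | "x < a" | "x = a" "y = b" by blast
    then show ?thesis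
    proof cases
      case 1
      then have y: "Suc y \<in> {1..b}" using less.prems by auto
      have "t x (Suc y) \<le> t x0 y0"
        using below by (intro mono_translate[OF less.prems(1) y 0(1,2), of l]) auto
      moreover have lt: "t' x y < t' x (Suc y)" "t' x (Suc y) \<le> g"
        using t' less.prems y 1 unfolding tableau_def by auto
      moreover have "t' x (Suc y) \<le> t x (Suc y)"
        by (rule less.hyps[OF _ less.prems(1) y]) (use lt in auto)
      ultimately show ?thesis using 0(3) by simp
    next
      case 2
      then have x: "Suc x \<in> {1..a}" using less.prems by auto
      have "t (Suc x) y \<le> t x0 y0"
        using below by (intro mono_translate[OF x less.prems(2) 0(1,2), of l]) auto
      moreover have lt: "t' x y < t' (Suc x) y" "t' (Suc x) y \<le> g"
        using t' less.prems x 2 unfolding tableau_def by auto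
      moreover have "t' (Suc x) y \<le> t (Suc x) y"
        by (rule less.hyps[OF _ x less.prems(2)]) (use lt in auto)
      ultimately show ?thesis using 0(3) by simp
    next
      case 3
      have "a + 1 - x0 \<in> {1..a}" "b + 1 - y0 \<in> {1..b}" using 0 by auto
      then show ?thesis using below 3 0(1,2) no_wrap_below_origin[of "a + 1 - x0" "b + 1 - y0" "- l"]
        by (simp add: of_nat_diff)
    qed
  qed
qed

end

theorem scrollar_eq_if_draws_from:
  assumes "scrollar_tableau k a b g t" "tableau a b g t'" "draws_from k a b t' t"
    and "x \<in> {1..a}" "y \<in> {1..b}"
  shows "t' x y = t x y"
proof -
  obtain \<alpha> where "scrollar_box \<alpha> k a b g t"
    using assms(1) unfolding scrollar_tableau_def scrollar_box_def by metis
  then interpret scrollar_box \<alpha> k a b g t .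
  show ?thesis using le_if_draws_from[OF assms(2-)] ge_if_draws_from[OF assms(2-)] by simp
qed

lemma k_uniform_if_scrollar:
  assumes "scrollar_tableau k a b g t"
  shows "k_uniform k a b g t"
  unfolding k_uniform_displacement_tableau_def
proof (intro conjI ballI impI)
  show "tableau a b g t" using assms by (simp add: scrollar_tableau_def)
  fix x y x' y' assume "x \<in> {1..a}" "y \<in> {1..b}" "x' \<in> {1..a}" "y' \<in> {1..b}" "t x y = t x' y'"
  then obtain \<alpha> :: nat and l :: int where
    "int x' - int x = l * int \<alpha>" "int y' - int y = l * (int \<alpha> - int k)"
    using assms unfolding scrollar_tableau_def scrollar_of_type_def by metis
  then have "(int x - int y) - (int x' - int y') = - l * int k" by (simp add: algebra_simps)
  then show "[int x - int y = int x' - int y'] (mod int k)" by (simp add: cong_iff_dvd_diff)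
qed

text \<open>
  Entries at most \<open>j\<close> form a Young diagram. If it meets two diagonals at distance
  at least \<open>k - 1\<close>, then it meets all diagonals between them, hence contains
  \<open>k\<close> boxes whose diagonals are distinct modulo \<open>k\<close>. Their entries are
  distinct numbers in \<open>{1..j}\<close>.
\<close>

lemma many_diagonals:
  assumes t: "k_uniform k a b g t" and "0 < k"
    and p: "x \<in> {1..a}" "y \<in> {1..b}" "t x y \<le> j" and q: "x' \<in> {1..a}" "y' \<in> {1..b}" "t x' y' \<le> j"
    and far: "int y - int x + int k - 1 \<le> int y' - int x'"
  shows "k \<le> j"
proof -
  have tab: "tableau a b g t" using t by (simp add: k_uniform_displacement_tableau_def)
  let ?I = "{int y - int x ..< int y - int x + int k}"
  have "\<exists>u v. u \<in> {1..a} \<and> v \<in> {1..b} \<and> int v - int u = D \<and> t u v \<le> j" if D: "D \<in> ?I" for D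
  proof (cases "D < int y")
    case True
    define u where "u = nat (int y - D)"
    have u: "int u = int y - D" using True by (simp add: u_def)
    then have "u \<in> {1..a}" "u \<le> x" using D True p by auto
    then have "t u y \<le> j" using tableau_mono[OF tab _ p(2) p(1,2), of u] p(3) by simp
    then show ?thesis using u \<open>u \<in> {1..a}\<close> p(2) by auto
  next
    case False
    define v where "v = nat (int x' + D)"
    have v: "int v = int x' + D" using False by (simp add: v_def)
    then have "v \<in> {1..b}" "v \<le> y'" using D False p q far by auto
    then have "t x' v \<le> j" using tableau_mono[OF tab q(1) _ q(1,2), of v] q(3) by simp
    then show ?thesis using v \<open>v \<in> {1..b}\<close> q(1) by (intro exI[of _ x'] exI[of _ v]) auto
  qed
  then obtain u v where uv: "\<And>D. D \<in> ?I \<Longrightarrow> u D \<in> {1..a} \<and> v D \<in> {1..b} \<and> int (v D) - int (u D) = D \<and> t (u D) (v D) \<le> j"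
    by metis
  have "inj_on (\<lambda>D. t (u D) (v D)) ?I"
  proof (rule inj_onI)
    fix D E assume *: "D \<in> ?I" "E \<in> ?I" "t (u D) (v D) = t (u E) (v E)"
    then have "[int (v D) - int (u D) = int (v E) - int (u E)] (mod int k)"
      using uv[of D] uv[of E] by (intro k_uniformD[OF t]) auto
    then have "[D = E] (mod int k)" using uv[OF *(1)] uv[OF *(2)] by simp
    then have "int k dvd D - E" by (simp add: cong_iff_dvd_diff)
    moreover have "\<bar>D - E\<bar> < int k" using * by auto
    ultimately have "D - E = 0" using zdvd_not_zless[of "\<bar>D - E\<bar>" "int k"] by (cases "D = E") auto
    then show "D = E" by simp
  qed
  moreover have "(\<lambda>D. t (u D) (v D)) ` ?I \<subseteq> {1..j}"
  proof
    fix m assume "m \<in> (\<lambda>D. t (u D) (v D)) ` ?I"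
    then obtain D where "D \<in> ?I" "m = t (u D) (v D)" by blast
    then show "m \<in> {1..j}" using uv[of D] tab unfolding tableau_def by simp
  qed
  ultimately have "card ?I \<le> card {1..j}" by (intro card_inj_on_le) auto
  then show ?thesis by simp
qed

text \<open>
  On loops with trivial torsion, containment of tori needs equal diagonals, not just congruent
  ones. This is automatic on the first \<open>k - 1\<close> loops: by induction \<open>t\<close>
  has an entry at most \<open>t' x y\<close> on a diagonal equal or next to that of \<open>(x,
  y)\<close>, while the entry \<open>t' x y\<close> itself lies at a distance that is a multiple
  of \<open>k\<close>, and a nonzero multiple contradicts \<open>many_diagonals\<close>.
\<close>

lemma same_diagonal_low:
  assumes t: "k_uniform k a b g t" and t': "k_uniform k a b g t'"
    and d: "draws_from k a b t' t" and "0 < k"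
    and "x \<in> {1..a}" "y \<in> {1..b}" "x0 \<in> {1..a}" "y0 \<in> {1..b}" "t x0 y0 = t' x y" "t' x y < k"
  shows "int y0 - int x0 = int y - int x"
  using assms(5-)
proof (induction "t' x y" arbitrary: x y x0 y0 rule: less_induct)
  case less
  have tab: "tableau a b g t'" using t' by (simp add: k_uniform_displacement_tableau_def)
  have tab0: "tableau a b g t" using t by (simp add: k_uniform_displacement_tableau_def)
  let ?D = "int y - int x" and ?E = "int y0 - int x0"
  obtain x1 y1 where 1: "x1 \<in> {1..a}" "y1 \<in> {1..b}" "t x1 y1 = t' x y"
    "[int y1 - int x1 = ?D] (mod int k)"
    using d less.prems(1,2) unfolding draws_from_def by blast
  have "[?E = int y1 - int x1] (mod int k)"
    by (rule k_uniformD[OF t]) (use less.prems 1 in auto)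
  then have "[?E = ?D] (mod int k)" using 1(4) cong_trans by blast
  then have dvd: "int k dvd ?E - ?D" by (simp add: cong_iff_dvd_diff)
  obtain u v where uv: "u \<in> {1..a}" "v \<in> {1..b}" "t u v \<le> t' x y" "\<bar>int v - int u - ?D\<bar> \<le> 1"
  proof -
    have "1 < y \<or> 1 < x \<or> x = 1 \<and> y = 1" using less.prems by auto
    then consider "1 < y" | "1 < x" | "x = 1" "y = 1" by blast
    then show ?thesis
    proof cases
      case 1
      then have y: "y - 1 \<in> {1..b}" "y = Suc (y - 1)" using less.prems by auto
      have lt: "t' x (y - 1) < t' x y"
        by (rule tableau_below[OF tab less.prems(1) y(1) less.prems(2)])
      obtain u v where "u \<in> {1..a}" "v \<in> {1..b}" "t u v = t' x (y - 1)"
        using d less.prems(1) y(1) unfolding draws_from_def by blast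
      moreover from this have "int v - int u = int (y - 1) - int x"
        using lt less.prems y(1) by (intro less.hyps) auto
      ultimately show ?thesis using that[of u v] lt y(2) by simp
    next
      case 2
      then have x: "x - 1 \<in> {1..a}" "x = Suc (x - 1)" using less.prems by auto
      have lt: "t' (x - 1) y < t' x y"
        by (rule tableau_left[OF tab x(1) less.prems(1,2)])
      obtain u v where "u \<in> {1..a}" "v \<in> {1..b}" "t u v = t' (x - 1) y"
        using d less.prems(2) x(1) unfolding draws_from_def by blast
      moreover from this have "int v - int u = int y - int (x - 1)"
        using lt less.prems x(1) by (intro less.hyps) auto
      ultimately show ?thesis using that[of u v] lt x(2) by simp
    next
      case 3
      have "t 1 1 \<le> t x0 y0" by (rule tableau_mono[OF tab0]) (use less.prems in auto)
      then show ?thesis using that[of 1 1] 3 less.prems by simp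
    qed
  qed
  show ?case
  proof (rule ccontr)
    assume "?E \<noteq> ?D"
    then have "int k \<le> \<bar>?E - ?D\<bar>" using dvd zdvd_imp_le[of "int k" "\<bar>?E - ?D\<bar>"] by simp
    then have "int v - int u + int k - 1 \<le> ?E \<or> ?E + int k - 1 \<le> int v - int u" using uv(4) by linarith
    then have "k \<le> t' x y"
      using many_diagonals[OF t assms(4) uv(1-3) less.prems(3,4)] less.prems(5)
        many_diagonals[OF t assms(4) less.prems(3,4) _ uv(1-3)] by auto
    then show False using less.prems(6) by simp
  qed
qed

definition rotate_tableau :: "nat \<Rightarrow> nat \<Rightarrow> nat \<Rightarrow> (nat \<Rightarrow> nat \<Rightarrow> nat) \<Rightarrow> nat \<Rightarrow> nat \<Rightarrow> nat" where
  "rotate_tableau a b g t x y = g + 1 - t (a + 1 - x) (b + 1 - y)"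

lemma reflect: "x \<in> {1..n::nat} \<Longrightarrow> n + 1 - x \<in> {1..n}" "x \<in> {1..n} \<Longrightarrow> n + 1 - (n + 1 - x) = x"
  "x \<in> {1..n} \<Longrightarrow> int (n + 1 - x) = int n + 1 - int x"
  by auto

lemma rotate_tableau_eq_iff:
  assumes "tableau a b g t" "tableau a b g t'" "x \<in> {1..a}" "y \<in> {1..b}" "x' \<in> {1..a}" "y' \<in> {1..b}"
  shows "rotate_tableau a b g t x y = rotate_tableau a b g t' x' y' \<longleftrightarrow>
    t (a + 1 - x) (b + 1 - y) = t' (a + 1 - x') (b + 1 - y')"
proof -
  have "t (a + 1 - x) (b + 1 - y) \<in> {1..g}" "t' (a + 1 - x') (b + 1 - y') \<in> {1..g}"
    using assms reflect(1) unfolding tableau_def by blast+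
  then show ?thesis unfolding rotate_tableau_def atLeastAtMost_iff by linarith
qed

lemma k_uniform_rotate:
  assumes t: "k_uniform k a b g t"
  shows "k_uniform k a b g (rotate_tableau a b g t)"
proof -
  have tab: "tableau a b g t" using t by (simp add: k_uniform_displacement_tableau_def)
  have "tableau a b g (rotate_tableau a b g t)"
    unfolding tableau_def
  proof (intro ballI conjI impI)
    fix x y assume xy: "x \<in> {1..a}" "y \<in> {1..b}"
    have r: "t (a + 1 - x) (b + 1 - y) \<in> {1..g}"
      using tab reflect(1)[OF xy(1)] reflect(1)[OF xy(2)] unfolding tableau_def by blast
    then show "rotate_tableau a b g t x y \<in> {1..g}" by (auto simp: rotate_tableau_def)
    { assume "y < b"
      then have "b + 1 - Suc y \<in> {1..b}" "b + 1 - y = Suc (b + 1 - Suc y)" "b + 1 - Suc y < b" using xy by auto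
      then have "t (a + 1 - x) (b + 1 - Suc y) < t (a + 1 - x) (b + 1 - y)"
        using tab reflect(1)[OF xy(1)] unfolding tableau_def by metis
      then show "rotate_tableau a b g t x y < rotate_tableau a b g t x (Suc y)"
        using r unfolding rotate_tableau_def atLeastAtMost_iff by linarith }
    { assume "x < a"
      then have "a + 1 - Suc x \<in> {1..a}" "a + 1 - x = Suc (a + 1 - Suc x)" "a + 1 - Suc x < a" using xy by auto
      then have "t (a + 1 - Suc x) (b + 1 - y) < t (a + 1 - x) (b + 1 - y)"
        using tab reflect(1)[OF xy(2)] unfolding tableau_def by metis
      then show "rotate_tableau a b g t x y < rotate_tableau a b g t (Suc x) y"
        using r unfolding rotate_tableau_def atLeastAtMost_iff by linarith }
  qed
  moreover have "[int x - int y = int x' - int y'] (mod int k)"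
    if xy: "x \<in> {1..a}" "y \<in> {1..b}" "x' \<in> {1..a}" "y' \<in> {1..b}"
      and eq: "rotate_tableau a b g t x y = rotate_tableau a b g t x' y'" for x y x' y'
  proof -
    have "[int (b + 1 - y) - int (a + 1 - x) = int (b + 1 - y') - int (a + 1 - x')] (mod int k)"
      using eq rotate_tableau_eq_iff[OF tab tab xy] xy reflect(1) by (intro k_uniformD[OF t]) auto
    then have "int k dvd (int (b + 1 - y) - int (a + 1 - x)) - (int (b + 1 - y') - int (a + 1 - x'))"
      by (simp only: cong_iff_dvd_diff)
    also have "(int (b + 1 - y) - int (a + 1 - x)) - (int (b + 1 - y') - int (a + 1 - x')) =
        (int x - int y) - (int x' - int y')"
      using xy by (simp add: reflect(3))
    finally show ?thesis by (simp only: cong_iff_dvd_diff)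
  qed
  ultimately show ?thesis unfolding k_uniform_displacement_tableau_def by blast
qed

lemma draws_from_rotate:
  assumes d: "draws_from k a b t' t" and tab: "tableau a b g t" "tableau a b g t'"
  shows "draws_from k a b (rotate_tableau a b g t') (rotate_tableau a b g t)"
  unfolding draws_from_def
proof (intro ballI)
  fix x y assume xy: "x \<in> {1..a}" "y \<in> {1..b}"
  obtain x0 y0 where 0: "x0 \<in> {1..a}" "y0 \<in> {1..b}" "t x0 y0 = t' (a + 1 - x) (b + 1 - y)"
    "[int y0 - int x0 = int (b + 1 - y) - int (a + 1 - x)] (mod int k)"
    using d reflect(1)[OF xy(1)] reflect(1)[OF xy(2)] unfolding draws_from_def by blast
  let ?x = "a + 1 - x0" and ?y = "b + 1 - y0"
  have "rotate_tableau a b g t ?x ?y = rotate_tableau a b g t' x y"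
    using 0 xy rotate_tableau_eq_iff[OF tab, of ?x ?y x y] reflect(1,2) by simp
  moreover have "[int ?y - int ?x = int y - int x] (mod int k)"
  proof -
    have "int k dvd (int (b + 1 - y) - int (a + 1 - x)) - (int y0 - int x0)"
      using 0(4)[THEN cong_sym] by (simp only: cong_iff_dvd_diff)
    also have "(int (b + 1 - y) - int (a + 1 - x)) - (int y0 - int x0) = (int ?y - int ?x) - (int y - int x)"
      using xy 0(1,2) by (simp add: reflect(3))
    finally show ?thesis by (simp only: cong_iff_dvd_diff)
  qed
  ultimately show "\<exists>x0\<in>{1..a}. \<exists>y0\<in>{1..b}. rotate_tableau a b g t x0 y0 = rotate_tableau a b g t' x y \<and>
      [int y0 - int x0 = int y - int x] (mod int k)"
    using reflect(1) 0(1,2) by blast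
qed

text \<open>
  The last \<open>k - 1\<close> loops reduce to the first ones by reversing the order of the
  loops and rotating the tableaux.
\<close>

lemma same_diagonal_outer:
  assumes t: "k_uniform k a b g t" and t': "k_uniform k a b g t'"
    and d: "draws_from k a b t' t" and "0 < k"
    and xy: "x \<in> {1..a}" "y \<in> {1..b}" "x0 \<in> {1..a}" "y0 \<in> {1..b}" "t x0 y0 = t' x y"
    and outer: "t' x y < k \<or> t' x y + k > g + 1"
  shows "int y0 - int x0 = int y - int x"
  using outer
proof
  assume "t' x y < k"
  then show ?thesis using same_diagonal_low[OF t t' d assms(4) xy] by simp
next
  assume high: "t' x y + k > g + 1"
  have tab: "tableau a b g t" "tableau a b g t'"
    using t t' by (simp_all add: k_uniform_displacement_tableau_def)
  have r: "t' x y \<in> {1..g}" using tab(2) xy unfolding tableau_def by blast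
  let ?f = "\<lambda>x. a + 1 - x" and ?h = "\<lambda>y. b + 1 - y"
  have "int (?h y0) - int (?f x0) = int (?h y) - int (?f x)"
  proof (rule same_diagonal_low[OF k_uniform_rotate[OF t] k_uniform_rotate[OF t'] draws_from_rotate[OF d tab] assms(4)])
    show "rotate_tableau a b g t (?f x0) (?h y0) = rotate_tableau a b g t' (?f x) (?h y)"
      using xy by (simp only: rotate_tableau_def reflect(2))
    show "rotate_tableau a b g t' (?f x) (?h y) < k"
      using xy(1,2) high r by (simp only: rotate_tableau_def reflect(2)) auto
  qed (use xy reflect(1) in auto)
  then show ?thesis using xy by (simp add: reflect(3))
qed

section \<open>The rank as a game\<close>

lemma grow_le: "profile h \<Longrightarrow> grow A h D \<le> h (D + 1) + 1"
  using profileD(2)[of h D] by (auto simp: grow_def)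

text \<open>
  The opponent puts \<open>e j\<close> chips on loop \<open>j\<close>, and the answer \<open>n
  j\<close> may be \<open>0\<close> only if \<open>e j = 0\<close> and the diagonal \<open>j - 1
  - p\<close> is allowed, where \<open>p\<close> is the number of chips placed so far. Answering
  with \<open>n j \<le> 1\<close>, and with \<open>0\<close> whenever possible, maintains the
  invariant that the height on diagonal \<open>j - p\<close> is at most the number of chips of
  the opponent, so that \<open>p\<close> stays small as long as the diagram is tall.
\<close>

lemma chaser_strategy:
  fixes A :: "nat \<Rightarrow> int \<Rightarrow> bool" and e :: "nat \<Rightarrow> nat"
  assumes A: "\<And>j D. A j D \<Longrightarrow> \<not> A j (D + 1)"
  shows "\<exists>n :: nat \<Rightarrow> nat.
    (\<forall>j\<in>{1..m}. n j = 0 \<longrightarrow> e j = 0 \<and> A j (int j - 1 - (\<Sum>i\<in>{1..<j}. int (n i + e i)))) \<and>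
    grown A m (int m - (\<Sum>i\<in>{1..m}. int (n i + e i))) \<le> (\<Sum>i\<in>{1..m}. int (e i))"
proof (induction m)
  case 0
  then show ?case by simp
next
  case (Suc m)
  then obtain n :: "nat \<Rightarrow> nat" where
    n: "\<And>j. j \<in> {1..m} \<Longrightarrow> n j = 0 \<Longrightarrow> e j = 0 \<and> A j (int j - 1 - (\<Sum>i\<in>{1..<j}. int (n i + e i)))"
    and le: "grown A m (int m - (\<Sum>i\<in>{1..m}. int (n i + e i))) \<le> (\<Sum>i\<in>{1..m}. int (e i))"
    by blast
  define p where "p = (\<Sum>i\<in>{1..m}. int (n i + e i))"
  define s where "s = (\<Sum>i\<in>{1..m}. int (e i))"
  define D where "D = int m - p"
  have h: "grown A m D \<le> s" using le by (simp add: D_def p_def s_def)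
  define v :: nat where "v = (if e (Suc m) = 0 \<and> A (Suc m) D then 0 else 1)"
  define n' where "n' = n(Suc m := v)"
  have old: "(\<Sum>i\<in>{1..<j}. int (n' i + e i)) = (\<Sum>i\<in>{1..<j}. int (n i + e i))" if "j \<le> Suc m" for j
    using that by (intro sum.cong) (auto simp: n'_def)
  have p': "(\<Sum>i\<in>{1..<Suc m}. int (n i + e i)) = p" by (simp add: p_def atLeastLessThanSuc_atLeastAtMost)
  have "n' j = 0 \<longrightarrow> e j = 0 \<and> A j (int j - 1 - (\<Sum>i\<in>{1..<j}. int (n' i + e i)))" if j: "j \<in> {1..Suc m}" for j
  proof (cases "j = Suc m")
    case True
    then show ?thesis using old[of "Suc m"] p' by (simp add: n'_def v_def D_def)
  next
    case False
    then show ?thesis using n[of j] j old[of j] by (simp add: n'_def)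
  qed
  moreover have total: "(\<Sum>i\<in>{1..Suc m}. int (n' i + e i)) = p + int v + int (e (Suc m))"
    using old[of "Suc m"] p' by (simp add: atLeastLessThanSuc_atLeastAtMost n'_def)
  moreover have "grown A (Suc m) (int (Suc m) - (p + int v + int (e (Suc m)))) \<le> s + int (e (Suc m))"
  proof (cases "e (Suc m) = 0")
    case True
    show ?thesis
    proof (cases "A (Suc m) D")
      case A1: True
      have "grown A (Suc m) (D + 1) = grown A m (D + 1)" using A[OF A1] by (simp add: grow_def)
      also have "\<dots> \<le> grown A m D" by (rule profileD(1)[OF profile_grown])
      finally show ?thesis using h True A1 by (simp add: v_def D_def algebra_simps)
    next
      case False
      then have "grown A (Suc m) D = grown A m D" by (simp add: grow_def)
      then show ?thesis using h True False by (simp add: v_def D_def algebra_simps)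
    qed
  next
    case False
    then obtain e' where e': "e (Suc m) = Suc e'" by (cases "e (Suc m)") auto
    have "grown A (Suc m) (D - int e' - 1) \<le> grown A m (D - int e') + 1"
      using grow_le[OF profile_grown, of "A (Suc m)" A m "D - int e' - 1"] by simp
    also have "\<dots> \<le> grown A m D + int e' + 1"
      using profile_shift(2)[OF profile_grown, of A m D e'] by simp
    finally show ?thesis using h e' by (simp add: v_def D_def algebra_simps)
  qed
  moreover have "(\<Sum>i\<in>{1..Suc m}. int (e i)) = s + int (e (Suc m))" by (simp add: s_def)
  ultimately show ?case by (intro exI[of _ n']) (simp only: total, blast)
qed

text \<open>
  Conversely, if the height on diagonal \<open>D\<close> is at most \<open>s\<close>, then the
  opponent can place \<open>s\<close> chips, at most one on each loop apart from
  \<open>e0\<close> chips put down in advance, such that every legal answer ends on a diagonal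
  not exceeding \<open>D\<close>. The recursion for the heights is the recursion for this game:
  on an allowed diagonal the opponent either skips the loop, coming from \<open>D - 1\<close>,
  or plays one chip, coming from \<open>D + 1\<close>.
\<close>

lemma hider_strategy:
  fixes A :: "nat \<Rightarrow> int \<Rightarrow> bool"
  assumes "grown A m D \<le> int s"
  shows "\<exists>(e0::nat) e. e0 + (\<Sum>i\<in>{1..m}. e i) = s \<and> (\<forall>i. e i \<le> (1::nat)) \<and>
    (\<forall>n :: nat \<Rightarrow> nat.
      (\<forall>j\<in>{1..m}. n j = 0 \<longrightarrow> e j = 0 \<and> A j (int j - 1 - int e0 - (\<Sum>i\<in>{1..<j}. int (n i + e i)))) \<longrightarrow>
      int m - int e0 - (\<Sum>i\<in>{1..m}. int (n i + e i)) \<le> D)"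
  using assms
proof (induction m arbitrary: D s)
  case 0
  then show ?case by (intro exI[of _ s] exI[of _ "\<lambda>_. 0"]) auto
next
  case (Suc m)
  \<comment> \<open>Before loop \<open>Suc m\<close> aim at diagonal \<open>E\<close>, and put \<open>v\<close> chips on that loop. A chip there forces an
    answer of at least \<open>1\<close>, and the two chips together lower the diagonal \<open>j - p\<close> by \<open>1\<close>.\<close>
  have extend: ?case if v: "v \<le> 1" "v \<le> s" "grown A m E \<le> int (s - v)"
      and E: "E + 1 - 2 * int v \<le> D \<or> v = 0 \<and> E = D \<and> \<not> A (Suc m) D" for v :: nat and E
  proof -
    obtain e0 :: nat and e where e: "e0 + (\<Sum>i\<in>{1..m}. e i) = s - v" "\<And>i. e i \<le> (1::nat)"
      and IH: "\<And>n :: nat \<Rightarrow> nat.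
      (\<forall>j\<in>{1..m}. n j = 0 \<longrightarrow> e j = 0 \<and> A j (int j - 1 - int e0 - (\<Sum>i\<in>{1..<j}. int (n i + e i)))) \<Longrightarrow>
      int m - int e0 - (\<Sum>i\<in>{1..m}. int (n i + e i)) \<le> E"
      using Suc.IH[OF v(3)] by blast
    define e' where "e' = e(Suc m := v)"
    have old: "(\<Sum>i\<in>{1..<j}. int (n i + e' i)) = (\<Sum>i\<in>{1..<j}. int (n i + e i))" if "j \<le> Suc m" for n j
      using that by (intro sum.cong) (auto simp: e'_def)
    have sum_e: "(\<Sum>i\<in>{1..m}. e' i) = (\<Sum>i\<in>{1..m}. e i)"
      by (intro sum.cong) (auto simp: e'_def)
    show ?thesis
    proof (intro exI[of _ e0] exI[of _ e'] conjI allI impI)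
      show "e0 + (\<Sum>i\<in>{1..Suc m}. e' i) = s" using e(1) v(2) sum_e by (simp add: e'_def)
      show "e' i \<le> 1" for i using e(2) v(1) by (simp add: e'_def)
      fix n :: "nat \<Rightarrow> nat"
      assume n: "\<forall>j\<in>{1..Suc m}. n j = 0 \<longrightarrow> e' j = 0 \<and>
        A j (int j - 1 - int e0 - (\<Sum>i\<in>{1..<j}. int (n i + e' i)))"
      define Q where "Q = int m - int e0 - (\<Sum>i\<in>{1..m}. int (n i + e i))"
      have Q: "int m - int e0 - (\<Sum>i\<in>{1..<Suc m}. int (n i + e' i)) = Q"
        unfolding old[OF order_refl] Q_def by (simp add: atLeastLessThanSuc_atLeastAtMost)
      have "Q \<le> E" unfolding Q_def
      proof (rule IH, intro ballI impI)
        fix j assume "j \<in> {1..m}" "n j = 0"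
        then show "e j = 0 \<and> A j (int j - 1 - int e0 - (\<Sum>i\<in>{1..<j}. int (n i + e i)))"
          using n[rule_format, of j] old[of j n] by (simp add: e'_def)
      qed
      moreover have "v = 0 \<and> A (Suc m) Q" if "n (Suc m) = 0"
        using n[rule_format, of "Suc m"] that Q by (simp add: e'_def)
      moreover have "int (Suc m) - int e0 - (\<Sum>i\<in>{1..Suc m}. int (n i + e' i)) = Q + 1 - int (n (Suc m)) - int v"
        using Q by (simp add: atLeastLessThanSuc_atLeastAtMost e'_def)
      ultimately show "int (Suc m) - int e0 - (\<Sum>i\<in>{1..Suc m}. int (n i + e' i)) \<le> D"
        using E v(1) by (cases "n (Suc m) = 0"; cases "Q = D") auto
    qed
  qed
  show ?case
  proof (cases "A (Suc m) D")
    case False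
    then show ?thesis using extend[of 0 D] Suc.prems by (simp add: grow_def)
  next
    case True
    then have "grown A m (D - 1) \<le> int s \<or> grown A m (D + 1) + 1 \<le> int s"
      using Suc.prems by (auto simp: grow_def min_def split: if_splits)
    then show ?thesis
    proof
      assume "grown A m (D - 1) \<le> int s"
      then show ?thesis using extend[of 0 "D - 1"] by simp
    next
      assume *: "grown A m (D + 1) + 1 \<le> int s"
      then have "1 \<le> s" using grown_lower(1)[of A m "D + 1"] by linarith
      then show ?thesis using extend[of 1 "D + 1"] * by (simp add: of_nat_diff)
    qed
  qed
qed

context chain
begin

definition chips :: "(chain_vertex, chain_edge) divisor \<Rightarrow> nat \<Rightarrow> nat" where
  "chips F i = nat (\<Sum>p\<in>{p\<in>keys F. loop_of p = i}. lookup F p)"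

lemma chips:
  assumes "effective G F"
  shows "int (chips F i) = (\<Sum>p\<in>{p\<in>keys F. loop_of p = i}. lookup F p)"
  using assms unfolding chips_def effective_def by (simp add: sum_nonneg)

lemma weight_by_loop:
  assumes "F \<in> divisors G"
  shows "weight F h = (\<Sum>i\<in>{1..g}. \<Sum>p\<in>{p\<in>keys F. loop_of p = i}. of_int (lookup F p) * h p)"
  unfolding weight_def
  by (rule sum.group[symmetric]) (use assms loop_of_range in \<open>auto simp: divisors_def\<close>)

lemma div_deg_chips:
  assumes "effective G F"
  shows "div_deg F = (\<Sum>i\<in>{1..g}. int (chips F i))"
proof -
  have "F \<in> divisors G" using assms by (simp add: effective_def)
  from weight_by_loop[OF this, of "\<lambda>_. 1"]
  have "real_of_int (div_deg F) = of_int (\<Sum>i\<in>{1..g}. int (chips F i))"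
    unfolding div_deg_weight chips[OF assms] by simp
  then show ?thesis by (simp only: of_int_eq_iff)
qed

text \<open>
  Chips before loop \<open>j\<close> retract to its lefthand vertex, chips after it to its
  righthand vertex, at position \<open>0\<close>.
\<close>

lemma jacobian_no_chips:
  assumes F: "effective G F" and j: "j \<in> {1..g}" and none: "chips F j = 0"
  shows "J j F = of_nat (\<Sum>i\<in>{1..<j}. chips F i) * \<sigma> j"
proof -
  let ?K = "\<lambda>i. {p\<in>keys F. loop_of p = i}"
  let ?s = "\<lambda>i. \<Sum>p\<in>?K i. of_int (lookup F p) * retract \<Gamma> j p"
  have pos: "0 \<le> lookup F p" for p using F by (simp add: effective_def)
  have "(\<Sum>p\<in>?K j. lookup F p) = 0" using chips[OF F, of j] none by simp
  then have zero: "?s j = 0" using pos by (simp add: sum_nonneg_eq_0_iff)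
  have before: "?s i = of_nat (chips F i) * \<sigma> j" if "i < j" for i
  proof -
    have "?s i = (\<Sum>p\<in>?K i. of_int (lookup F p) * \<sigma> j)"
      using that by (intro sum.cong) (auto simp: retract_def)
    also have "\<dots> = of_int (int (chips F i)) * \<sigma> j"
      unfolding chips[OF F] by (simp add: sum_distrib_right)
    finally show ?thesis by simp
  qed
  have after: "?s i = 0" if "j < i" for i
    using that by (intro sum.neutral) (auto simp: retract_def)
  have "J j F = (\<Sum>i\<in>{1..g}. ?s i)"
    unfolding jacobian_def using F by (intro weight_by_loop) (simp add: effective_def)
  also have "\<dots> = (\<Sum>i\<in>{1..<j}. ?s i)"
    using sum_up_to[OF j, of ?s] zero after by simp
  also have "\<dots> = (\<Sum>i\<in>{1..<j}. of_nat (chips F i) * \<sigma> j)"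
    using before by (intro sum.cong) auto
  finally show ?thesis by (simp add: sum_distrib_right)
qed

lemma rcong_top_bottom:
  assumes "j \<in> {1..g}"
  shows "[of_int q * \<sigma> j = - of_int q * \<mu> j] (rmod circ \<Gamma> j)"
proof -
  have "- of_int q * \<mu> j = of_int q * \<sigma> j + of_int (- q) * circ \<Gamma> j"
    by (simp add: algebra_simps)
  then show ?thesis unfolding rcong_altdef by blast
qed

text \<open>
  A loop with at least one chip can realise any invariant: all but one of its chips go to the
  righthand vertex, where they do not contribute, and the position of the last one is free.
\<close>

lemma effective_with_jacobian:
  fixes n :: "nat \<Rightarrow> nat" and z :: "nat \<Rightarrow> real"
  assumes z: "\<And>j. j \<in> {1..g} \<Longrightarrow> n j = 0 \<Longrightarrow> [z j = of_nat (\<Sum>i\<in>{1..<j}. n i) * \<sigma> j] (rmod circ \<Gamma> j)"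
  obtains F where "effective G F" "div_deg F = int (\<Sum>i\<in>{1..g}. n i)"
    "\<And>j. j \<in> {1..g} \<Longrightarrow> [J j F = z j] (rmod circ \<Gamma> j)"
proof -
  define w where "w j = (z j - of_nat (\<Sum>i\<in>{1..<j}. n i) * \<sigma> j) / \<mu> j" for j
  define Fj where "Fj j = (if n j = 0 then 0 else
    frag_cmul (int (n j) - 1) (frag_of (loop_point \<Gamma> j 0)) + frag_of (loop_point \<Gamma> j (w j)))" for j
  define F where "F = (\<Sum>j\<in>{1..g}. Fj j)"
  have "Fj j \<in> divisors G" if "j \<in> {1..g}" for j
    using loop_point(1)[OF that] by (auto simp: Fj_def intro!: divisors_closed)
  then have "F \<in> divisors G" unfolding F_def by (intro divisors_sum)
  moreover have "0 \<le> lookup F p" for p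
    unfolding F_def lookup_sum by (intro sum_nonneg) (simp add: Fj_def lookup_add)
  ultimately have "effective G F" by (simp add: effective_def)
  moreover have "div_deg (Fj j) = int (n j)" for j
    by (simp add: Fj_def div_deg_add div_deg_cmul) (simp add: div_deg_def)
  then have "div_deg F = int (\<Sum>i\<in>{1..g}. n i)" by (simp add: F_def div_deg_sum)
  moreover have "[J j F = z j] (rmod circ \<Gamma> j)" if j: "j \<in> {1..g}" for j
  proof -
    let ?s = "\<lambda>i. weight (Fj i) (retract \<Gamma> j)"
    have before: "?s i = of_nat (n i) * \<sigma> j" if "i \<in> {1..<j}" for i
      using that j retract_loop_point(1)[of i j] by (simp add: Fj_def weight_add weight_cmul algebra_simps)
    have after: "?s i = 0" if "i \<in> {j<..g}" for i
      using that j retract_loop_point(2)[of i j] by (simp add: Fj_def weight_add weight_cmul)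
    have at: "[?s j = z j - of_nat (\<Sum>i\<in>{1..<j}. n i) * \<sigma> j] (rmod circ \<Gamma> j)"
    proof (cases "n j = 0")
      case True
      have "[z j - of_nat (\<Sum>i\<in>{1..<j}. n i) * \<sigma> j =
          of_nat (\<Sum>i\<in>{1..<j}. n i) * \<sigma> j - of_nat (\<Sum>i\<in>{1..<j}. n i) * \<sigma> j] (rmod circ \<Gamma> j)"
        using z[OF j True] by (simp only: rcong_diff_right_cancel)
      then show ?thesis using True by (simp add: Fj_def rcong_sym)
    next
      case False
      have "retract \<Gamma> j (loop_point \<Gamma> j 0) = 0" using loop_point[OF j] by (simp add: retract_def)
      then have "?s j = retract \<Gamma> j (loop_point \<Gamma> j (w j))" using False by (simp add: Fj_def weight_add weight_cmul)
      moreover have "w j * \<mu> j = z j - of_nat (\<Sum>i\<in>{1..<j}. n i) * \<sigma> j"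
        using lens(2)[OF j] by (simp add: w_def)
      ultimately show ?thesis using retract_loop_point(3)[OF j, of "w j"] by simp
    qed
    have "J j F = (\<Sum>i\<in>{1..<j}. ?s i) + ?s j"
      unfolding jacobian_def F_def weight_sum using after by (intro sum_up_to[OF j]) auto
    also have "(\<Sum>i\<in>{1..<j}. ?s i) = of_nat (\<Sum>i\<in>{1..<j}. n i) * \<sigma> j"
      using before by (simp add: sum_distrib_right)
    finally have J: "J j F = of_nat (\<Sum>i\<in>{1..<j}. n i) * \<sigma> j + ?s j" .
    show ?thesis unfolding J
      using rcong_add[OF rcong_refl at, of "of_nat (\<Sum>i\<in>{1..<j}. n i) * \<sigma> j"] by simp
  qed
  ultimately show ?thesis using that by blast
qed

text \<open>
  The summand \<open>j - 1\<close> accounts for the chips that a coordinate divisor has on the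
  loops before \<open>j\<close>, so that this says that \<open>\<xi>\<^sub>j\<close> and
  \<open>\<delta>\<close> are coordinates of the same point.
\<close>

definition admits :: "(chain_vertex, chain_edge) divisor \<Rightarrow> nat \<Rightarrow> int \<Rightarrow> bool" where
  "admits D j \<delta> \<longleftrightarrow> j \<in> {1..g} \<and>
     [J j D = of_int (\<delta> - (int j - 1)) * \<mu> j] (rmod circ \<Gamma> j)"

text \<open>
  Otherwise \<open>bottom_len \<Gamma> j\<close> would be a multiple of the circumference.
\<close>

lemma not_admits_adjacent:
  assumes "admits D j \<delta>" shows "\<not> admits D j (\<delta> + 1)"
proof
  let ?m = "\<mu> j" and ?u = "of_int (\<delta> - (int j - 1)) :: real"
  assume *: "admits D j (\<delta> + 1)"
  have j: "j \<in> {1..g}" using assms by (simp add: admits_def)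
  have "[?u * ?m = of_int (\<delta> + 1 - (int j - 1)) * ?m] (rmod circ \<Gamma> j)"
    using assms * unfolding admits_def by (meson rcong_sym rcong_trans)
  then obtain n :: int where "of_int (\<delta> + 1 - (int j - 1)) * ?m = ?u * ?m + of_int n * circ \<Gamma> j"
    unfolding rcong_altdef by blast
  then have n: "?m = of_int n * circ \<Gamma> j" by (simp add: algebra_simps)
  have "0 < real_of_int n"
    using zero_less_mult_pos2[OF _ circ_pos[OF j]] n lens(2)[OF j] by metis
  then have "1 * circ \<Gamma> j \<le> of_int n * circ \<Gamma> j" using circ_pos[OF j] by (intro mult_right_mono) auto
  then show False using n lens(1)[OF j] by simp
qed

lemma admits_iff_top:
  assumes "j \<in> {1..g}"
  shows "admits D j (int j - 1 - q) \<longleftrightarrow> [J j D = of_int q * \<sigma> j] (rmod circ \<Gamma> j)"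
  using rcong_top_bottom[OF assms, of q] assms unfolding admits_def
  by (simp add: algebra_simps) (meson rcong_sym rcong_trans)

lemma generic_real: "countable S \<Longrightarrow> \<exists>x::real. x \<notin> S"
  using uncountable_UNIV_real by (metis UNIV_eq_I)

text \<open>
  Every coordinate has to avoid countably many values only.
\<close>

lemma generic_coordinates:
  fixes u s :: "nat \<Rightarrow> real"
  shows "\<exists>z. \<forall>j\<in>{1..g}. \<forall>q l::int. z j * \<mu> j \<noteq> u j + of_int q * s j + of_int l * circ \<Gamma> j"
proof -
  have "\<exists>z. \<forall>q l::int. z * \<mu> j \<noteq> u j + of_int q * s j + of_int l * circ \<Gamma> j"
    if j: "j \<in> {1..g}" for j
  proof -
    let ?f = "\<lambda>(q::int, l::int). u j + of_int q * s j + of_int l * circ \<Gamma> j"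
    have "countable (range ?f)" by simp
    then obtain x where x: "x \<notin> range ?f" using generic_real by blast
    have "x / \<mu> j * \<mu> j = x" using lens(2)[OF j] by simp
    moreover have "x \<noteq> ?f (q, l)" for q l using x by blast
    ultimately show ?thesis by (intro exI[of _ "x / \<mu> j"]) simp
  qed
  then show ?thesis by metis
qed

text \<open>
  A divisor \<open>E\<close> is a choice of the opponent and an effective \<open>F\<close>
  equivalent to \<open>D - E\<close> is an answer. If \<open>F\<close> has no chips on a loop
  with none of \<open>E\<close>, then the diagonal given by the number of previous chips is
  admitted. If \<open>E\<close> has chips there, an answer without chips is never needed against
  an arbitrary \<open>E\<close>, and is impossible if the chips of \<open>E\<close> sit at
  generic points.
\<close>

theorem rank_condition:
  fixes r d :: nat
  assumes D: "D \<in> divisors G" "div_deg D = int d" and g: "1 \<le> g"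
  shows "(\<forall>E. effective G E \<and> div_deg E = int r \<longrightarrow> (\<exists>F. effective G F \<and> (D - E, F) \<in> lin_equiv G)) \<longleftrightarrow>
    int r + 1 \<le> grown (admits D) g (int g - int d - 1)"
    (is "?rank \<longleftrightarrow> ?tall")
proof
  assume tall: ?tall
  show ?rank
  proof (intro allI impI)
    fix E assume E: "effective G E \<and> div_deg E = int r"
    define e where "e = chips E"
    have sum_e: "(\<Sum>i\<in>{1..g}. int (e i)) = int r" using E div_deg_chips[of E] by (simp add: e_def)
    obtain n :: "nat \<Rightarrow> nat" where chase:
      "(\<forall>j\<in>{1..g}. n j = 0 \<longrightarrow> e j = 0 \<and> admits D j (int j - 1 - (\<Sum>i\<in>{1..<j}. int (n i + e i)))) \<and>
       grown (admits D) g (int g - (\<Sum>i\<in>{1..g}. int (n i + e i))) \<le> (\<Sum>i\<in>{1..g}. int (e i))"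
      using chaser_strategy[of "admits D" g e, OF not_admits_adjacent] ..
    have n: "e j = 0 \<and> admits D j (int j - 1 - (\<Sum>i\<in>{1..<j}. int (n i + e i)))"
      if "j \<in> {1..g}" "n j = 0" for j
      using chase[THEN conjunct1] that by blast
    define P where "P = (\<Sum>i\<in>{1..g}. int (n i + e i))"
    have le: "grown (admits D) g (int g - P) \<le> int r"
      using chase[THEN conjunct2] unfolding sum_e P_def .
    have "P \<le> int d"
    proof (rule ccontr)
      assume "\<not> P \<le> int d"
      then have "grown (admits D) g (int g - int d - 1) \<le> grown (admits D) g (int g - P)"
        by (intro profile_antimono[OF profile_grown]) linarith
      then show False using tall le by linarith
    qed
    \<comment> \<open>The chips left over are put on the last loop, where they do not affect any other condition.\<close>
    define n' where "n' = n(g := n g + nat (int d - P))"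
    have n': "(\<Sum>i\<in>{1..<j}. n' i) = (\<Sum>i\<in>{1..<j}. n i)" if "j \<in> {1..g}" for j
      using that by (intro sum.cong) (auto simp: n'_def)
    have split: "{1..g} = insert g {1..<g}" using g by auto
    have "(\<Sum>i\<in>{1..g}. n' i) = (\<Sum>i\<in>{1..g}. n i) + nat (int d - P)"
      unfolding split using n'[of g] g by (simp add: n'_def)
    then have total: "int (\<Sum>i\<in>{1..g}. n' i) = int d - int r"
      using \<open>P \<le> int d\<close> sum_e unfolding P_def by (simp add: sum.distrib)
    have "[J j (D - E) = of_nat (\<Sum>i\<in>{1..<j}. n' i) * \<sigma> j] (rmod circ \<Gamma> j)"
      if j: "j \<in> {1..g}" "n' j = 0" for j
    proof -
      have "n j = 0" using j by (auto simp: n'_def split: if_splits)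
      then have e0: "e j = 0" and adm: "admits D j (int j - 1 - (\<Sum>i\<in>{1..<j}. int (n i + e i)))"
        using n[OF j(1)] by auto
      have JE: "J j E = of_nat (\<Sum>i\<in>{1..<j}. e i) * \<sigma> j"
        using jacobian_no_chips[of E j] E j e0 by (simp add: e_def)
      have "[J j D = of_int (\<Sum>i\<in>{1..<j}. int (n i + e i)) * \<sigma> j] (rmod circ \<Gamma> j)"
        using adm admits_iff_top[OF j(1)] by blast
      also have "of_int (\<Sum>i\<in>{1..<j}. int (n i + e i)) * \<sigma> j =
          of_nat (\<Sum>i\<in>{1..<j}. n' i) * \<sigma> j + J j E"
        unfolding JE n'[OF j(1)] by (simp add: sum.distrib algebra_simps)
      finally have "[J j D - J j E =
          of_nat (\<Sum>i\<in>{1..<j}. n' i) * \<sigma> j + J j E - J j E] (rmod circ \<Gamma> j)"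
        by (simp only: rcong_diff_right_cancel)
      then show ?thesis by (simp add: jacobian_def weight_minus)
    qed
    then obtain F where F: "effective G F" "div_deg F = int (\<Sum>i\<in>{1..g}. n' i)"
      "\<And>j. j \<in> {1..g} \<Longrightarrow> [J j F = J j (D - E)] (rmod circ \<Gamma> j)"
      using effective_with_jacobian[of n' "\<lambda>j. J j (D - E)"] by metis
    have "(D - E, F) \<in> lin_equiv G"
      unfolding lin_equiv_iff using F D E total rcong_sym[OF F(3)]
      by (auto simp: effective_def div_deg_minus intro: divisors_closed)
    then show "\<exists>F. effective G F \<and> (D - E, F) \<in> lin_equiv G" using F(1) by blast
  qed
next
  assume rank: ?rank
  show ?tall
  proof (rule ccontr)
    assume "\<not> ?tall"
    then have "grown (admits D) g (int g - int d - 1) \<le> int r" by simp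
    from hider_strategy[OF this] obtain e0 :: nat and e where
      e: "e0 + (\<Sum>i\<in>{1..g}. e i) = r" "\<And>i. e i \<le> (1::nat)"
      and wins: "\<And>n :: nat \<Rightarrow> nat.
      (\<forall>j\<in>{1..g}. n j = 0 \<longrightarrow> e j = 0 \<and> admits D j (int j - 1 - int e0 - (\<Sum>i\<in>{1..<j}. int (n i + e i)))) \<Longrightarrow>
      int g - int e0 - (\<Sum>i\<in>{1..g}. int (n i + e i)) \<le> int g - int d - 1"
      by blast
    obtain w where w: "\<And>j q l. j \<in> {1..g} \<Longrightarrow>
        w j * \<mu> j \<noteq> J j D + of_int (q::int) * \<sigma> j + of_int (l::int) * circ \<Gamma> j"
      using generic_coordinates[of "\<lambda>j. J j D" "\<sigma>"] by blast
    let ?p = "Vertex (Lefthand 1) :: (chain_vertex, chain_edge) point"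
    define E where "E = frag_cmul (int e0) (frag_of ?p) + (\<Sum>j\<in>{1..g}. frag_cmul (int (e j)) (frag_of (loop_point \<Gamma> j (w j))))"
    have p: "?p \<in> points G" using g by (auto simp: points_def)
    have "E \<in> divisors G"
      unfolding E_def using p loop_point(1) by (intro divisors_closed divisors_sum) auto
    moreover have "0 \<le> lookup E q" for q
      unfolding E_def by (simp add: lookup_add lookup_sum sum_nonneg)
    ultimately have E: "effective G E" by (simp add: effective_def)
    have "div_deg E = int r"
      unfolding E_def by (simp add: div_deg_add div_deg_cmul div_deg_sum flip: e(1))
    with rank E obtain F where F: "effective G F" "(D - E, F) \<in> lin_equiv G" by blast
    have JE: "J j E = of_int (int e0 + (\<Sum>i\<in>{1..<j}. int (e i))) * \<sigma> j +
        of_nat (e j) * retract \<Gamma> j (loop_point \<Gamma> j (w j))" if j: "j \<in> {1..g}" for j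
    proof -
      let ?s = "\<lambda>i. of_nat (e i) * retract \<Gamma> j (loop_point \<Gamma> i (w i))"
      have "(\<Sum>i\<in>{1..g}. ?s i) = (\<Sum>i\<in>{1..<j}. ?s i) + ?s j"
        using retract_loop_point(2)[of _ j] j by (intro sum_up_to) auto
      also have "(\<Sum>i\<in>{1..<j}. ?s i) = of_int (\<Sum>i\<in>{1..<j}. int (e i)) * \<sigma> j"
        using retract_loop_point(1)[of _ j] j by (simp add: sum_distrib_right)
      moreover have "retract \<Gamma> j ?p = \<sigma> j" using j by (auto simp: retract_def)
      ultimately show ?thesis
        unfolding jacobian_def E_def by (simp add: weight_add weight_cmul weight_sum algebra_simps)
    qed
    define n where "n = chips F"
    have cond: "e j = 0 \<and> admits D j (int j - 1 - int e0 - (\<Sum>i\<in>{1..<j}. int (n i + e i)))"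
      if j: "j \<in> {1..g}" "n j = 0" for j
    proof -
      define q where "q = int e0 + (\<Sum>i\<in>{1..<j}. int (n i + e i))"
      have "J j F = of_nat (\<Sum>i\<in>{1..<j}. n i) * \<sigma> j"
        unfolding n_def by (rule jacobian_no_chips) (use F j in \<open>auto simp: n_def\<close>)
      moreover have "[J j D - J j E = J j F] (rmod circ \<Gamma> j)"
        using F(2) j(1) unfolding lin_equiv_iff by (simp add: jacobian_def weight_minus)
      ultimately have "[J j D - J j E + J j E =
          of_nat (\<Sum>i\<in>{1..<j}. n i) * \<sigma> j + J j E] (rmod circ \<Gamma> j)"
        by (simp only: rcong_add_right_cancel)
      then have J: "[J j D = of_int q * \<sigma> j + of_nat (e j) * retract \<Gamma> j (loop_point \<Gamma> j (w j))] (rmod circ \<Gamma> j)"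
        unfolding JE[OF j(1)] q_def by (simp add: algebra_simps sum.distrib)
      have "e j = 0"
      proof (rule ccontr)
        assume "e j \<noteq> 0"
        then have "e j = 1" using e(2)[of j] by simp
        have "[of_int q * \<sigma> j + retract \<Gamma> j (loop_point \<Gamma> j (w j)) = of_int q * \<sigma> j + w j * \<mu> j] (rmod circ \<Gamma> j)"
          using retract_loop_point(3)[OF j(1), of "w j"] by (simp only: rcong_add_left_cancel)
        with J \<open>e j = 1\<close> have "[J j D = of_int q * \<sigma> j + w j * \<mu> j] (rmod circ \<Gamma> j)"
          by (auto intro: rcong_trans)
        then obtain l :: int where "of_int q * \<sigma> j + w j * \<mu> j = J j D + of_int l * circ \<Gamma> j"
          unfolding rcong_altdef by blast
        then show False using w[OF j(1), of "- q" l] by (simp add: algebra_simps)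
      qed
      moreover from this J have "admits D j (int j - 1 - q)" using admits_iff_top[OF j(1), of D q] by simp
      ultimately show ?thesis by (simp add: q_def algebra_simps)
    qed
    have "div_deg F = div_deg D - div_deg E"
      using F(2) unfolding lin_equiv_iff by (simp add: div_deg_minus)
    then have "(\<Sum>i\<in>{1..g}. int (n i)) = int d - int r"
      using div_deg_chips[OF F(1)] D(2) \<open>div_deg E = int r\<close> by (simp add: n_def)
    moreover have "int e0 + (\<Sum>i\<in>{1..g}. int (e i)) = int r"
      unfolding e(1)[symmetric] by simp
    moreover have "int g - int e0 - (\<Sum>i\<in>{1..g}. int (n i + e i)) \<le> int g - int d - 1"
      using cond by (intro wins) blast
    ultimately show False by (simp add: sum.distrib)
  qed
qed

text \<open>
  The set in the definition of the rank is bounded by the degree, and it is downward closed from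
  \<open>0\<close> on: to treat \<open>E\<close>, add chips at one point to both
  \<open>E\<close> and the effective divisor found for it.
\<close>

lemma bn_rank_ge_iff:
  assumes D: "D \<in> divisors G" and g: "1 \<le> g"
  shows "int r \<le> bn_rank G D \<longleftrightarrow>
    (\<forall>E. effective G E \<and> div_deg E = int r \<longrightarrow> (\<exists>F. effective G F \<and> (D - E, F) \<in> lin_equiv G))"
proof -
  let ?p = "Vertex (Lefthand 1) :: (chain_vertex, chain_edge) point"
  have p: "?p \<in> points G" using g by (auto simp: points_def)
  have eff: "effective G (frag_cmul (int n) (frag_of ?p))" for n
    using p by (auto simp: effective_def intro!: divisors_closed)
  have deg: "div_deg (frag_cmul c (frag_of q)) = c" for c and q :: "(chain_vertex, chain_edge) point"
    by (simp add: div_deg_cmul)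
  have nonneg: "0 \<le> div_deg E" if "effective G E" for E
    using div_deg_chips[OF that] by (simp add: sum_nonneg)
  define P where "P s \<longleftrightarrow> (\<forall>E. effective G E \<and> div_deg E = s \<longrightarrow> (\<exists>F. effective G F \<and> (D - E, F) \<in> lin_equiv G))" for s
  let ?S = "{s. - 1 \<le> s \<and> P s}"
  have bound: "s \<le> max 0 (div_deg D)" if Ps: "P s" for s
  proof (cases "s \<le> 0")
    case False
    then have "effective G (frag_cmul s (frag_of ?p)) \<and> div_deg (frag_cmul s (frag_of ?p)) = s"
      using eff[of "nat s"] deg by simp
    then obtain F where "effective G F" "(D - frag_cmul s (frag_of ?p), F) \<in> lin_equiv G"
      using Ps unfolding P_def by blast
    then have "0 \<le> div_deg D - s" using nonneg[of F] unfolding lin_equiv_iff by (simp add: div_deg_minus deg)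
    then show ?thesis by simp
  qed simp
  have fin: "finite ?S"
    by (rule finite_subset[of _ "{- 1..max 0 (div_deg D)}"]) (use bound in auto)
  have "- 1 \<in> ?S" using nonneg unfolding P_def by fastforce
  then have "int r \<le> bn_rank G D \<longleftrightarrow> (\<exists>s\<in>?S. int r \<le> s)"
    unfolding bn_rank_def P_def[symmetric] using fin by (intro Max_ge_iff) auto
  also have "\<dots> \<longleftrightarrow> P (int r)"
  proof
    assume "\<exists>s\<in>?S. int r \<le> s"
    then obtain s where s: "P s" "int r \<le> s" by blast
    show "P (int r)" unfolding P_def
    proof (intro allI impI)
      fix E assume E: "effective G E \<and> div_deg E = int r"
      let ?T = "frag_cmul (int (nat (s - int r))) (frag_of ?p)"
      have ET: "effective G (E + ?T)" using E eff[of "nat (s - int r)"]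
        by (auto simp: effective_def lookup_add intro: divisors_closed)
      have "div_deg (E + ?T) = s" using E s(2) by (simp add: div_deg_add deg)
      then obtain F where F: "effective G F" "(D - (E + ?T), F) \<in> lin_equiv G"
        using s(1) ET unfolding P_def by blast
      have FT: "effective G (F + ?T)" using F(1) eff[of "nat (s - int r)"]
        by (auto simp: effective_def lookup_add intro: divisors_closed)
      moreover have "(D - E, F + ?T) \<in> lin_equiv G"
      proof -
        have eq: "D - (E + ?T) - F = D - E - (F + ?T)" by (simp only: diff_diff_eq add_ac)
        have "principal G (D - (E + ?T) - F)"
          using F(2) by (simp only: lin_equiv_def mem_Collect_eq case_prod_conv)
        then have "principal G (D - E - (F + ?T))" unfolding eq .
        then show ?thesis using FT E D by (simp add: lin_equiv_def effective_def divisors_closed)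
      qed
      ultimately show "\<exists>F. effective G F \<and> (D - E, F) \<in> lin_equiv G" by blast
    qed
  next
    assume "P (int r)"
    then show "\<exists>s\<in>?S. int r \<le> s" by (intro bexI[of _ "int r"]) auto
  qed
  finally show ?thesis unfolding P_def .
qed

end

section \<open>Brill-Noether loci and tori\<close>

context chain
begin

lemma Pic_class:
  assumes "C \<in> Pic G d" "D \<in> C"
  shows "D \<in> divisors G" "div_deg D = d" "C = {E. (D, E) \<in> lin_equiv G}"
proof -
  obtain D0 where D0: "D0 \<in> divisors G" "div_deg D0 = d" "C = lin_equiv G `` {D0}"
    using assms(1) by (auto simp: Pic_def elim!: quotientE)
  have D: "(D0, D) \<in> lin_equiv G" using assms(2) D0(3) by simp
  then show "D \<in> divisors G" "div_deg D = d" using D0 by (simp_all add: lin_equiv_iff)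
  have "[J j D0 = J j E] (rmod circ \<Gamma> j) \<longleftrightarrow> [J j D = J j E] (rmod circ \<Gamma> j)"
    if "j \<in> {1..g}" for j E
    using D that by (simp add: lin_equiv_iff rcong_def)
  then have "(D0, E) \<in> lin_equiv G \<longleftrightarrow> (D, E) \<in> lin_equiv G" for E
    using D unfolding lin_equiv_iff by simp
  then show "C = {E. (D, E) \<in> lin_equiv G}" using D0(3) by auto
qed

lemma class_in_Pic:
  assumes "D \<in> divisors G" "div_deg D = d"
  shows "{E. (D, E) \<in> lin_equiv G} \<in> Pic G d" "D \<in> {E. (D, E) \<in> lin_equiv G}"
proof -
  have "{E. (D, E) \<in> lin_equiv G} = lin_equiv G `` {D}" by auto
  then show "{E. (D, E) \<in> lin_equiv G} \<in> Pic G d"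
    unfolding Pic_def using assms by (auto intro: quotientI)
  show "D \<in> {E. (D, E) \<in> lin_equiv G}" using assms by (simp add: lin_equiv_iff)
qed

lemma Pic_nonempty: "C \<in> Pic G d \<Longrightarrow> \<exists>D. D \<in> C"
  unfolding Pic_def by (auto simp: lin_equiv_iff elim!: quotientE)

lemma coord_divisor:
  assumes "1 \<le> g"
  shows "coord_divisor \<Gamma> d \<xi> \<in> divisors G" "div_deg (coord_divisor \<Gamma> d \<xi>) = d"
    and "\<And>j. j \<in> {1..g} \<Longrightarrow>
      [J j (coord_divisor \<Gamma> d \<xi>) = (\<xi> j - of_int (int j - 1)) * \<mu> j] (rmod circ \<Gamma> j)"
proof -
  have last: "g \<in> {1..g}" using assms by simp
  show "coord_divisor \<Gamma> d \<xi> \<in> divisors G"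
    unfolding coord_divisor_def using loop_point(1) last by (intro divisors_closed divisors_sum) auto
  show "div_deg (coord_divisor \<Gamma> d \<xi>) = d"
    by (simp add: coord_divisor_def div_deg_add div_deg_cmul div_deg_sum)
  fix j assume j: "j \<in> {1..g}"
  let ?s = "\<lambda>i. retract \<Gamma> j (loop_point \<Gamma> i (\<xi> i))"
  have base: "retract \<Gamma> j (loop_point \<Gamma> g 0) = 0"
    using j last retract_loop_point(2)[OF last, of j] loop_point[OF last]
    by (cases "j = g") (auto simp: retract_def)
  have "(\<Sum>i\<in>{1..g}. ?s i) = (\<Sum>i\<in>{1..<j}. ?s i) + ?s j"
    using retract_loop_point(2)[of _ j] j by (intro sum_up_to) auto
  also have "(\<Sum>i\<in>{1..<j}. ?s i) = of_int (int j - 1) * \<sigma> j"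
    using retract_loop_point(1)[of _ j] j by (simp add: of_nat_diff)
  finally have "J j (coord_divisor \<Gamma> d \<xi>) = of_int (int j - 1) * \<sigma> j + ?s j"
    by (simp add: jacobian_def coord_divisor_def weight_add weight_cmul weight_sum base)
  also have "[of_int (int j - 1) * \<sigma> j + ?s j =
      - of_int (int j - 1) * \<mu> j + \<xi> j * \<mu> j] (rmod circ \<Gamma> j)"
    by (rule rcong_add[OF rcong_top_bottom[OF j] retract_loop_point(3)[OF j]])
  finally show "[J j (coord_divisor \<Gamma> d \<xi>) = (\<xi> j - of_int (int j - 1)) * \<mu> j] (rmod circ \<Gamma> j)"
    by (simp add: algebra_simps)
qed

text \<open>
  Existence of coordinates: \<open>\<xi> j\<close> is solved for in the formula for the
  invariants of a coordinate divisor.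
\<close>

lemma coord_divisor_in_class:
  assumes "1 \<le> g" "C \<in> Pic G d"
  shows "coord_divisor \<Gamma> d (coord \<Gamma> d C) \<in> C"
proof -
  obtain D where D: "D \<in> C" using Pic_nonempty[OF assms(2)] by blast
  note cls = Pic_class[OF assms(2) D]
  define \<xi> where "\<xi> j = J j D / \<mu> j + of_int (int j - 1)" for j
  have "[J j D = J j (coord_divisor \<Gamma> d \<xi>)] (rmod circ \<Gamma> j)" if j: "j \<in> {1..g}" for j
  proof -
    have "(\<xi> j - of_int (int j - 1)) * \<mu> j = J j D"
      using lens(2)[OF j] by (simp add: \<xi>_def)
    then show ?thesis using coord_divisor(3)[OF assms(1) j, of d \<xi>] by (simp add: rcong_sym)
  qed
  then have "coord_divisor \<Gamma> d \<xi> \<in> C"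
    unfolding cls(3) mem_Collect_eq lin_equiv_iff using cls(1,2) coord_divisor(1,2)[OF assms(1)] by simp
  then show ?thesis unfolding coord_def by (rule someI[where P = "\<lambda>\<xi>. coord_divisor \<Gamma> d \<xi> \<in> C"])
qed

definition coord_at :: "int \<Rightarrow> (chain_vertex, chain_edge) divisor set \<Rightarrow> nat \<Rightarrow> int \<Rightarrow> bool" where
  "coord_at d C j \<delta> \<longleftrightarrow> j \<in> {1..g} \<and> loop_point \<Gamma> j (coord \<Gamma> d C j) = loop_point \<Gamma> j (of_int \<delta>)"

text \<open>
  In particular the point with coordinate \<open>\<xi> j\<close> depends on the class only.
\<close>

lemma admits_iff_coordinate:
  assumes "1 \<le> g" "j \<in> {1..g}" "(D, coord_divisor \<Gamma> d \<xi>) \<in> lin_equiv G"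
  shows "admits D j \<delta> \<longleftrightarrow>
    [\<xi> j * \<mu> j = of_int \<delta> * \<mu> j] (rmod circ \<Gamma> j)"
proof -
  let ?c = "of_int (int j - 1) :: real" and ?m = "\<mu> j"
  have "[J j D = J j (coord_divisor \<Gamma> d \<xi>)] (rmod circ \<Gamma> j)"
    using assms(2,3) by (simp add: lin_equiv_iff)
  then have J: "[J j D = (\<xi> j - ?c) * ?m] (rmod circ \<Gamma> j)"
    using coord_divisor(3)[OF assms(1,2)] rcong_trans by blast
  have "admits D j \<delta> \<longleftrightarrow> [(\<xi> j - ?c) * ?m = of_int (\<delta> - (int j - 1)) * ?m] (rmod circ \<Gamma> j)"
    using J assms(2) unfolding admits_def by (meson rcong_sym rcong_trans)
  also have "\<dots> \<longleftrightarrow> [\<xi> j * ?m - ?c * ?m = of_int \<delta> * ?m - ?c * ?m] (rmod circ \<Gamma> j)"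
    by (simp only: left_diff_distrib of_int_diff)
  finally show ?thesis unfolding rcong_diff_right_cancel .
qed

lemma admits_eq_coord_at:
  assumes "1 \<le> g" "C \<in> Pic G d" "D \<in> C"
  shows "admits D = coord_at d C"
proof (intro ext)
  fix j \<delta>
  have "(D, coord_divisor \<Gamma> d (coord \<Gamma> d C)) \<in> lin_equiv G"
    using coord_divisor_in_class[OF assms(1,2)] Pic_class(3)[OF assms(2,3)] by auto
  then show "admits D j \<delta> = coord_at d C j \<delta>"
    using admits_iff_coordinate[OF assms(1)] loop_point_eq_iff
    unfolding coord_at_def by (metis admits_def)
qed

lemma W_iff:
  assumes "1 \<le> g"
  shows "C \<in> W G (int r) (int d) \<longleftrightarrow>
    C \<in> Pic G (int d) \<and> int r + 1 \<le> grown (coord_at (int d) C) g (int g - int d - 1)"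
proof -
  have "int r \<le> bn_rank G D \<longleftrightarrow> int r + 1 \<le> grown (coord_at (int d) C) g (int g - int d - 1)"
    if C: "C \<in> Pic G (int d)" and D: "D \<in> C" for D
    using bn_rank_ge_iff[OF Pic_class(1)[OF C D] assms]
      rank_condition[OF Pic_class(1,2)[OF C D] assms] admits_eq_coord_at[OF assms C D] by simp
  then show ?thesis unfolding W_def using Pic_nonempty by blast
qed

lemma torus_iff:
  assumes "tableau a b g t"
  shows "C \<in> torus \<Gamma> d a b t \<longleftrightarrow>
    C \<in> Pic G d \<and> (\<forall>x\<in>{1..a}. \<forall>y\<in>{1..b}. coord_at d C (t x y) (int y - int x))"
  using assms unfolding torus_def tableau_def coord_at_def by auto

end

locale gonal_chain = chain +
  fixes k :: nat
  assumes k: "2 \<le> k" and gonal: "k_gonal_chain k (genus \<Gamma>) \<Gamma>" and g_pos: "1 \<le> genus \<Gamma>"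
begin

lemma coord_at_cong:
  assumes "coord_at d C j u" "coord_at d C j v"
  shows "[u = v] (mod int k)"
proof -
  have j: "j \<in> {1..g}" using assms by (simp add: coord_at_def)
  then have "[of_int u * \<mu> j = of_int v * \<mu> j] (rmod circ \<Gamma> j)"
    using assms loop_point_eq_iff[OF j, of "of_int u" "of_int v"] by (simp add: coord_at_def)
  then have "[u = v] (mod int (torsion_order \<Gamma> j))" using torsion[OF j] by simp
  then show ?thesis using gonal j unfolding k_gonal_chain_def by (auto split: if_splits)
qed

text \<open>
  The torsion order is \<open>k\<close> on the inner loops and \<open>0\<close> on the outer
  ones.
\<close>

lemma coord_at_shift:
  assumes "coord_at d C j u" "[u = v] (mod int k)" "j < k \<or> j + k > g + 1 \<Longrightarrow> u = v"
  shows "coord_at d C j v"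
proof -
  have j: "j \<in> {1..g}" using assms by (simp add: coord_at_def)
  have "[u = v] (mod int (torsion_order \<Gamma> j))"
    using gonal j assms(2,3) unfolding k_gonal_chain_def by auto
  then have "[of_int u * \<mu> j = of_int v * \<mu> j] (rmod circ \<Gamma> j)"
    using torsion[OF j] by simp
  then have "loop_point \<Gamma> j (of_int u) = loop_point \<Gamma> j (of_int v)"
    using loop_point_eq_iff[OF j] by simp
  then show ?thesis using assms(1) by (simp add: coord_at_def)
qed

text \<open>
  The diagonal of the corner \<open>(r + 1, b)\<close> is the one in the rank condition. A class
  in the locus provides the tableau of entry times of its growing diagram; conversely, the
  diagram of a class in the torus of \<open>t\<close> grows at least as fast as
  \<open>t\<close>.
\<close>

theorem W_eq_Union_torus:
  assumes b: "int b = int g + int r - int d" "0 < b"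
  shows "W G (int r) (int d) =
    (\<Union>t\<in>{t. k_uniform k (r + 1) b g t}. torus \<Gamma> (int d) (r + 1) b t)"
proof (intro equalityI subsetI)
  have corner: "int g - int d - 1 = int b - int (r + 1)" using b by simp
  fix C
  {
    assume "C \<in> W G (int r) (int d)"
    then have C: "C \<in> Pic G (int d)" and tall: "int (r + 1) \<le> grown (coord_at (int d) C) g (int b - int (r + 1))"
      unfolding W_iff[OF g_pos] corner by (simp_all add: add.commute)
    interpret growth "grown (coord_at (int d) C)" "coord_at (int d) C" "r + 1" b g
      by (rule growth_grown[OF tall])
    let ?t = "entry_time (grown (coord_at (int d) C))"
    have "k_uniform k (r + 1) b g ?t"
      unfolding k_uniform_displacement_tableau_def
    proof (intro conjI ballI impI)
      show "tableau (r + 1) b g ?t" by (rule tableau_entry_time)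
      fix x y x' y' assume "x \<in> {1..r + 1}" "y \<in> {1..b}" "x' \<in> {1..r + 1}" "y' \<in> {1..b}" "?t x y = ?t x' y'"
      then have "[int y - int x = int y' - int x'] (mod int k)" using entry_label coord_at_cong by metis
      then have "[- (int y - int x) = - (int y' - int x')] (mod int k)" by (simp only: cong_minus_minus_iff)
      then show "[int x - int y = int x' - int y'] (mod int k)" by simp
    qed
    moreover have "C \<in> torus \<Gamma> (int d) (r + 1) b ?t"
      unfolding torus_iff[OF tableau_entry_time] using C entry_label by blast
    ultimately show "C \<in> (\<Union>t\<in>{t. k_uniform k (r + 1) b g t}. torus \<Gamma> (int d) (r + 1) b t)"
      by blast
  next
    assume "C \<in> (\<Union>t\<in>{t. k_uniform k (r + 1) b g t}. torus \<Gamma> (int d) (r + 1) b t)"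
    then obtain t where t: "tableau (r + 1) b g t" and C: "C \<in> torus \<Gamma> (int d) (r + 1) b t"
      by (auto simp: k_uniform_displacement_tableau_def)
    have coord_at: "C \<in> Pic G (int d)" "\<And>x y. x \<in> {1..r + 1} \<Longrightarrow> y \<in> {1..b} \<Longrightarrow> coord_at (int d) C (t x y) (int y - int x)"
      using C torus_iff[OF t] by blast+
    have "t (r + 1) b \<le> g" using t b(2) unfolding tableau_def by auto
    then have "int (r + 1) \<le> grown (coord_at (int d) C) g (int b - int (r + 1))"
      by (intro tableau_le_grown[OF t, where A = "coord_at (int d) C"] coord_at(2)) (use b(2) in auto)
    then show "C \<in> W G (int r) (int d)"
      unfolding W_iff[OF g_pos] corner using coord_at(1) by (simp add: add.commute)
  }
qed

lemma torus_subset_if_draws_from: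
  assumes t: "k_uniform k a b g t" and t': "k_uniform k a b g t'"
    and d: "draws_from k a b t' t"
  shows "torus \<Gamma> e a b t \<subseteq> torus \<Gamma> e a b t'"
proof
  have tab: "tableau a b g t" "tableau a b g t'"
    using t t' by (simp_all add: k_uniform_displacement_tableau_def)
  fix C assume C: "C \<in> torus \<Gamma> e a b t"
  have "coord_at e C (t' x y) (int y - int x)" if xy: "x \<in> {1..a}" "y \<in> {1..b}" for x y
  proof -
    obtain x0 y0 where 0: "x0 \<in> {1..a}" "y0 \<in> {1..b}" "t x0 y0 = t' x y"
      "[int y0 - int x0 = int y - int x] (mod int k)"
      using d xy unfolding draws_from_def by blast
    have "coord_at e C (t' x y) (int y0 - int x0)" using C 0(1-3) torus_iff[OF tab(1)] by metis
    then show ?thesis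
    proof (rule coord_at_shift[OF _ 0(4)])
      show "int y0 - int x0 = int y - int x" if "t' x y < k \<or> t' x y + k > g + 1"
        by (rule same_diagonal_outer[OF t t' d _ xy 0(1-3) that]) (use k in simp)
    qed
  qed
  then show "C \<in> torus \<Gamma> e a b t'" using C torus_iff tab by blast
qed

text \<open>
  The coordinates on loops that occur in \<open>t\<close> are prescribed, the others are chosen
  generic.
\<close>

lemma generic_class:
  assumes t: "k_uniform k a b g t"
  obtains C where "C \<in> torus \<Gamma> e a b t"
    "\<And>j \<delta>. coord_at e C j \<delta> \<Longrightarrow> \<exists>x\<in>{1..a}. \<exists>y\<in>{1..b}. t x y = j \<and> [int y - int x = \<delta>] (mod int k)"
proof -
  have tab: "tableau a b g t" using t by (simp add: k_uniform_displacement_tableau_def)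
  have self: "draws_from k a b t t" unfolding draws_from_def by (blast intro: cong_refl)
  obtain z where z: "\<And>j u l. j \<in> {1..g} \<Longrightarrow>
      z j * \<mu> j \<noteq> 0 + of_int (u::int) * \<mu> j + of_int (l::int) * circ \<Gamma> j"
    using generic_coordinates[of "\<lambda>_. 0" "\<mu>"] by blast
  let ?P = "\<lambda>j p. case p of (x, y) \<Rightarrow> x \<in> {1..a} \<and> y \<in> {1..b} \<and> t x y = j"
  define \<xi> where "\<xi> j = (if \<exists>p. ?P j p then case (SOME p. ?P j p) of (x, y) \<Rightarrow> real y - real x else z j)" for j
  define D where "D = coord_divisor \<Gamma> e \<xi>"
  define C where "C = {E. (D, E) \<in> lin_equiv G}"
  have D: "D \<in> divisors G" "div_deg D = e" using coord_divisor[OF g_pos] by (simp_all add: D_def)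
  have C: "C \<in> Pic G e" "D \<in> C" using class_in_Pic[OF D] by (simp_all add: C_def)
  have coord_at: "coord_at e C j \<delta> \<longleftrightarrow>
      [\<xi> j * \<mu> j = of_int \<delta> * \<mu> j] (rmod circ \<Gamma> j)"
    if "j \<in> {1..g}" for j \<delta>
    using admits_iff_coordinate[OF g_pos that, of D e \<xi>] admits_eq_coord_at[OF g_pos C] C(2)
    by (simp add: C_def D_def)
  have chosen: "\<exists>x y. x \<in> {1..a} \<and> y \<in> {1..b} \<and> t x y = j \<and> \<xi> j = of_int (int y - int x)"
    if ex: "\<exists>p. ?P j p" for j
  proof -
    have "?P j (SOME p. ?P j p)" using ex by (rule someI_ex)
    then show ?thesis using ex by (auto simp: \<xi>_def split: prod.splits)
  qed
  have "C \<in> torus \<Gamma> e a b t"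
    unfolding torus_iff[OF tab]
  proof (intro conjI ballI C(1))
    fix x y assume xy: "x \<in> {1..a}" "y \<in> {1..b}"
    have j: "t x y \<in> {1..g}" using tab xy unfolding tableau_def by blast
    obtain x0 y0 where 0: "x0 \<in> {1..a}" "y0 \<in> {1..b}" "t x0 y0 = t x y" "\<xi> (t x y) = of_int (int y0 - int x0)"
      using chosen[of "t x y"] xy by auto
    have "coord_at e C (t x y) (int y0 - int x0)" unfolding coord_at[OF j] 0(4) by (rule rcong_refl)
    then show "coord_at e C (t x y) (int y - int x)"
    proof (rule coord_at_shift)
      show "[int y0 - int x0 = int y - int x] (mod int k)"
        by (rule k_uniformD[OF t 0(1,2) xy 0(3)])
      show "int y0 - int x0 = int y - int x" if "t x y < k \<or> t x y + k > g + 1"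
        by (rule same_diagonal_outer[OF t t self _ xy 0(1-3) that]) (use k in simp)
    qed
  qed
  moreover have "\<exists>x\<in>{1..a}. \<exists>y\<in>{1..b}. t x y = j \<and> [int y - int x = \<delta>] (mod int k)" if s: "coord_at e C j \<delta>" for j \<delta>
  proof -
    have j: "j \<in> {1..g}" using s by (simp add: coord_at_def)
    show ?thesis
    proof (cases "\<exists>p. ?P j p")
      case True
      then obtain x y where xy: "x \<in> {1..a}" "y \<in> {1..b}" "t x y = j" "\<xi> j = of_int (int y - int x)"
        using chosen by blast
      then have "coord_at e C j (int y - int x)" unfolding coord_at[OF j] by simp
      then have "[int y - int x = \<delta>] (mod int k)" using s by (rule coord_at_cong)
      then show ?thesis using xy by blast
    next
      case False
      then have "\<xi> j = z j" unfolding \<xi>_def by (rule if_not_P)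
      then have "[of_int \<delta> * \<mu> j = z j * \<mu> j] (rmod circ \<Gamma> j)"
        using s coord_at[OF j] by (simp add: rcong_sym)
      then show ?thesis using z[OF j] unfolding rcong_altdef by (metis add_0)
    qed
  qed
  ultimately show ?thesis using that by blast
qed

text \<open>
  A class that is generic in the torus of \<open>t\<close> satisfies no conditions except those
  imposed by \<open>t\<close>.
\<close>

lemma torus_subset_iff:
  assumes t: "k_uniform k a b g t" and t': "k_uniform k a b g t'"
  shows "torus \<Gamma> e a b t \<subseteq> torus \<Gamma> e a b t' \<longleftrightarrow> draws_from k a b t' t"
proof
  assume sub: "torus \<Gamma> e a b t \<subseteq> torus \<Gamma> e a b t'"
  have tab': "tableau a b g t'" using t' by (simp add: k_uniform_displacement_tableau_def)
  obtain C where C: "C \<in> torus \<Gamma> e a b t"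
    "\<And>j \<delta>. coord_at e C j \<delta> \<Longrightarrow> \<exists>x\<in>{1..a}. \<exists>y\<in>{1..b}. t x y = j \<and> [int y - int x = \<delta>] (mod int k)"
    using generic_class[OF t] by blast
  have "C \<in> torus \<Gamma> e a b t'" using C(1) sub by blast
  then show "draws_from k a b t' t"
    unfolding draws_from_def using C(2) torus_iff[OF tab'] by blast
qed (rule torus_subset_if_draws_from[OF assms])

text \<open>
  If the torus of \<open>t\<close> is maximal, it coincides with that of a scrollar tableau
  \<open>t'\<close> drawing from \<open>t\<close>. Then \<open>t\<close> also draws from
  \<open>t'\<close> and equals it by rigidity, which gives the converse as well.
\<close>

theorem maximal_torus_iff_scrollar:
  assumes t: "k_uniform k a b g t" and "0 < a" "0 < b"
  shows "maximal_torus \<Gamma> e k a b t \<longleftrightarrow> scrollar_tableau k a b g t"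
proof
  assume max: "maximal_torus \<Gamma> e k a b t"
  obtain t' where t': "scrollar_tableau k a b g t'" "draws_from k a b t' t"
    using exists_scrollar_drawing_from[OF k assms(2,3) t] by blast
  have u: "k_uniform k a b g t'" by (rule k_uniform_if_scrollar[OF t'(1)])
  have "torus \<Gamma> e a b t \<subseteq> torus \<Gamma> e a b t'" using torus_subset_iff[OF t u] t'(2) by blast
  then have "torus \<Gamma> e a b t' \<subseteq> torus \<Gamma> e a b t" using max u unfolding maximal_torus_def by blast
  then have "draws_from k a b t t'" using torus_subset_iff[OF u t] by blast
  then have eq: "t x y = t' x y" if "x \<in> {1..a}" "y \<in> {1..b}" for x y
    using scrollar_eq_if_draws_from[OF t'(1) _ _ that] t by (simp add: k_uniform_displacement_tableau_def)
  obtain \<alpha> where \<alpha>: "0 < \<alpha>" "\<alpha> \<le> min a (k - 1)" "k \<le> \<alpha> + b \<or> \<alpha> = a" "scrollar_of_type \<alpha> k a b t'"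
    using t'(1) unfolding scrollar_tableau_def by blast
  have "scrollar_of_type \<alpha> k a b t"
    unfolding scrollar_of_type_def
  proof (intro conjI ballI impI)
    fix x y x' y' assume "x \<in> {1..a}" "y \<in> {1..b}" "x' \<in> {1..a}" "y' \<in> {1..b}"
    then show "t x y = t x' y' \<longleftrightarrow>
        (\<exists>l::int. int x' - int x = l * int \<alpha> \<and> int y' - int y = l * (int \<alpha> - int k))"
      using \<alpha>(4) eq unfolding scrollar_of_type_def by simp
  next
    fix y assume y: "\<alpha> = a" "y \<in> {1..b}" "k < y + a"
    have "y + a - k \<in> {1..b}" using y \<alpha>(2) by auto
    then show "t a (y + a - k) < t 1 y"
      using y \<alpha>(4) eq assms(2) unfolding scrollar_of_type_def by simp
  next
    fix x assume x: "\<alpha> + b = k" "x \<in> {1..a}" "k < x + b"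
    have "x + b - k \<in> {1..a}" using x \<alpha>(1) by auto
    then show "t (x + b - k) b < t x 1"
      using x \<alpha>(4) eq assms(3) unfolding scrollar_of_type_def by simp
  qed
  then show "scrollar_tableau k a b g t"
    unfolding scrollar_tableau_def using \<alpha>(1-3) t by (auto simp: k_uniform_displacement_tableau_def)
next
  assume s: "scrollar_tableau k a b g t"
  show "maximal_torus \<Gamma> e k a b t"
    unfolding maximal_torus_def
  proof (intro allI impI, elim conjE)
    fix t' assume t': "k_uniform k a b g t'" and "torus \<Gamma> e a b t \<subseteq> torus \<Gamma> e a b t'"
    then have "draws_from k a b t' t" using torus_subset_iff[OF t t'] by blast
    then have "t' x y = t x y" if "x \<in> {1..a}" "y \<in> {1..b}" for x y
      using scrollar_eq_if_draws_from[OF s _ _ that] t' by (simp add: k_uniform_displacement_tableau_def)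
    then show "torus \<Gamma> e a b t = torus \<Gamma> e a b t'" by (simp add: torus_def)
  qed
qed

theorem Union_torus_eq_Union_scrollar:
  assumes "0 < a" "0 < b"
  shows "(\<Union>t\<in>{t. k_uniform k a b g t}. torus \<Gamma> e a b t) =
    (\<Union>t\<in>{t. scrollar_tableau k a b g t}. torus \<Gamma> e a b t)"
proof (intro equalityI UN_least)
  fix t assume "t \<in> {t. k_uniform k a b g t}"
  then have t: "k_uniform k a b g t" by simp
  obtain t' where t': "scrollar_tableau k a b g t'" "draws_from k a b t' t"
    using exists_scrollar_drawing_from[OF k assms t] by blast
  have "torus \<Gamma> e a b t \<subseteq> torus \<Gamma> e a b t'"
    by (rule torus_subset_if_draws_from[OF t k_uniform_if_scrollar[OF t'(1)] t'(2)])
  then show "torus \<Gamma> e a b t \<subseteq> (\<Union>t\<in>{t. scrollar_tableau k a b g t}. torus \<Gamma> e a b t)"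
    using t'(1) by blast
next
  fix t assume "t \<in> {t. scrollar_tableau k a b g t}"
  then show "torus \<Gamma> e a b t \<subseteq> (\<Union>t\<in>{t. k_uniform k a b g t}. torus \<Gamma> e a b t)"
    using k_uniform_if_scrollar by blast
qed

end

theorem theorem1p4:
  fixes g r d k :: nat and \<Gamma> :: loop_chain
  assumes "0 < g" and "0 < r" and "0 < d" and "0 < k"
    and "int r > int d - int g"
    and "2 \<le> k" and "int k < \<lfloor>(real g + 3) / 2\<rfloor>"
    and "k_gonal_chain k g \<Gamma>"
  shows "(\<forall>t. k_uniform_displacement_tableau k (r + 1) (g + r - d) g t \<longrightarrow>
            (maximal_torus \<Gamma> (int d) k (r + 1) (g + r - d) t \<longleftrightarrow>
             scrollar_tableau k (r + 1) (g + r - d) g t)) \<and>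
         W (chain_graph \<Gamma>) (int r) (int d) =
           (\<Union>t\<in>{t. scrollar_tableau k (r + 1) (g + r - d) g t}.
              torus \<Gamma> (int d) (r + 1) (g + r - d) t)"
proof -
  have genus: "genus \<Gamma> = g" using assms(8) by (simp add: k_gonal_chain_def)
  interpret gonal_chain \<Gamma> k
    by unfold_locales (use assms genus in \<open>auto simp: k_gonal_chain_def\<close>)
  have b: "int (g + r - d) = int (genus \<Gamma>) + int r - int d" "0 < g + r - d" using assms(5) genus by linarith+
  show ?thesis
    using maximal_torus_iff_scrollar[of "r + 1" "g + r - d"] b W_eq_Union_torus[OF b]
      Union_torus_eq_Union_scrollar[of "r + 1" "g + r - d" "int d"] genus by simp
qed

end
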